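(* Let $0<p<1$, let $(X_i)_{i\in\mathbb{Z}}$ be a strictly stationary real-valued sequence, let $g:\mathbb{R}^2\to\mathbb{R}$ be symmetric and measurable, and let $h(x,y,t)=\mathbf 1_{\{g(x,y)\le t\}}$. Suppose: (1) (Short-range dependence) $(X_i)_{i\in\mathbb{Z}}$ is near epoch dependent in probability, with approximation constants $(a_l)$ and function $\phi$, on an absolutely regular sequence $(Z_i)_{i\in\mathbb{Z}}$ with absolute regularity coefficients $(\beta_k)$, such that $a_l\phi(l^{-6})=O(l^{-6})$ as $l\to\infty$ and $\sum_{k=1}^\infty k\beta_k<\infty$. (2) (Variation condition for $h$) There is a constant $L$ such that for all $t$ in a neighborhood of $U^{-1}(p)$ and all $\epsilon>0$ $$E\Big[\sup_{x,y:\ \|(x,y)-(X,Y)\|\le\epsilon}|h(x,y,t)-h(X,Y,t)|^2\Big]\le L\epsilon .$$ (3) (Smoothness) $U$ is differentiable in a neighborhood of $U^{-1}(p)\in\mathbb{R}$ with derivative $u=U'$, $u(U^{-1}(p))>0$, and $|U(t)-p-u(U^{-1}(p))(t-U^{-1}(p))|=o(|t-U^{-1}(p)|^{3/2})$ as $t\to U^{-1}(p)$. (4) (Density kernel) $K:\mathbb{R}\to\mathbb{R}$ is symmetric around $0$, Lipschitz continuous with bounded support and of bounded variation, and integrates to $1$; the bandwidths $d_n>0$ satisfy $d_n\to0$ and $nd_n^{8/3}\to\infty$. (5) (HAC kernel) $W:[0,\infty)\to[0,1]$ satisfies $W(0)=1$, is continuous at $0$ and at all but a finite number of points, $|W|$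 is dominated by a non-increasing integrable function, and $\int_0^\infty|\int_0^\infty W(t)\cos(xt)\,dt|\,dx<\infty$; the bandwidths $b_n>0$ satisfy $b_n\to\infty$ and $b_n/\sqrt n\to0$. (6) (Variation condition for $g$) There is a constant $L$ such that for all $\epsilon>0$ $$E\Big[\Big(\sup_{x,y:\ \|(x,y)-(X,Y)\|\le\epsilon}|g(x,y)-g(X,Y)|\Big)^2\Big]\le L\epsilon .$$ Then $\hat\sigma^2_{p,n}\to\sigma_p^2$ in probability as $n\to\infty$, where $$\hat\sigma_{p,n}^2=\frac{4}{\hat u_n^2(U_n^{-1}(p))}\sum_{r=-(n-1)}^{n-1}W(|r|/b_n)\,\hat\rho(|r|,U_n^{-1}(p)),$$ $$\sigma_p^2=\frac{4}{u^2(U^{-1}(p))}\sum_{r=-\infty}^{\infty}\mathrm{Cov}\big(h_1(X_0,U^{-1}(p)),h_1(X_r,U^{-1}(p))\big).$$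
   Context: Throughout, $X,Y$ are independent, each with the distribution of $X_0$; $\|\cdot\|$ is the Euclidean norm on $\mathbb{R}^2$. For $n\ge2$, $U_n(t)=\frac{2}{n(n-1)}\sum_{1\le i<j\le n}h(X_i,X_j,t)$; $U(t)=E[h(X,Y,t)]$; $U^{-1}(p)=\inf\{t: U(t)\ge p\}$; $U_n^{-1}(p)=\inf\{t:U_n(t)\ge p\}$; $h_1(x,t)=E\,h(x,X_0,t)-U(t)$. Estimators: $\hat u_n(t)=\frac{2}{n(n-1)d_n}\sum_{1\le i<j\le n}K\big(\frac{g(X_i,X_j)-t}{d_n}\big)$; $\hat h_1(x,t)=\frac1n\sum_{i=1}^nh(x,X_i,t)-\frac1{n^2}\sum_{i,j=1}^nh(X_i,X_j,t)$; $\hat\rho(r,t)=\frac1n\sum_{i=1}^{n-r}\hat h_1(X_i,t)\hat h_1(X_{i+r},t)$ for $r\ge0$. Absolute regularity: for $\sigma$-fields $\mathcal A,\mathcal B$, $\beta(\mathcal A,\mathcal B)=E[\sup_{A\in\mathcal A}|P(A|\mathcal B)-P(A)|]$. For a stationary real-valued process $(Z_i)_{i\in\mathbb Z}$, $\beta_k=\beta(\sigma(\ldots,Z_{-1},Z_0),\sigma(Z_k,Z_{k+1},\ldots))$; the process is absolutely regular if $\beta_k\to0$. Near epoch dependence in probability: let $((X_i,Z_i))_{i\in\mathbb Z}$ be stationary. $(X_i)$ is near epoch dependent in probability on $(Z_i)$ with approximation constants $(a_l)_{l\in\mathbb N}$ if $a_l\to0$ and there are functions $f_l:\mathbb{R}^{2l+1}\to\mathbb{R}$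 and a non-increasing function $\phi:(0,\infty)\to(0,\infty)$ with $P(|X_0-f_l(Z_{-l},\ldots,Z_l)|>\epsilon)\le a_l\phi(\epsilon)$ for all $l\in\mathbb N$, $\epsilon>0$. *)

theory Defs
  imports "HOL-Probability.Probability" "HOL-Library.Landau_Symbols"
begin

section \<open>Generic probabilistic notions\<close>

definition strictly_stationary ::
  "'a measure \<Rightarrow> (int \<Rightarrow> 'a \<Rightarrow> 'b::topological_space) \<Rightarrow> bool" where
  "strictly_stationary M V \<longleftrightarrow>
     (\<forall>i. V i \<in> borel_measurable M) \<and>
     (\<forall>k. distr M (PiM UNIV (\<lambda>_. borel)) (\<lambda>\<omega> i. V (i + k) \<omega>)
        = distr M (PiM UNIV (\<lambda>_. borel)) (\<lambda>\<omega> i. V i \<omega>))"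

definition generated_algebra ::
  "'a measure \<Rightarrow> (int \<Rightarrow> 'a \<Rightarrow> real) \<Rightarrow> int set \<Rightarrow> 'a measure" where
  "generated_algebra M Z I =
     sigma (space M) (\<Union>i\<in>I. {Z i -` B \<inter> space M | B. B \<in> sets borel})"

text \<open>
  Conditional probabilities are only defined up to null sets, so the supremum of the
  uncountable family of random variables \<open>\<bar>P(A|\<B>) - P(A)\<bar>\<close>, \<open>A \<in> \<A>\<close>, is the essential
  supremum: the almost surely smallest random variable dominating each member almost surely.
  It exists for every bounded nonempty family and is unique up to null sets, so the
  expectation below does not depend on the choice.
\<close>

definition is_family_ess_sup :: "'a measure \<Rightarrow> ('a \<Rightarrow> real) set \<Rightarrow> ('a \<Rightarrow> real) \<Rightarrow> bool" where
  "is_family_ess_sup M F S \<longleftrightarrow>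
     S \<in> borel_measurable M \<and>
     (\<forall>f\<in>F. AE \<omega> in M. f \<omega> \<le> S \<omega>) \<and>
     (\<forall>T\<in>borel_measurable M. (\<forall>f\<in>F. AE \<omega> in M. f \<omega> \<le> T \<omega>) \<longrightarrow> (AE \<omega> in M. S \<omega> \<le> T \<omega>))"

definition family_ess_sup :: "'a measure \<Rightarrow> ('a \<Rightarrow> real) set \<Rightarrow> 'a \<Rightarrow> real" where
  "family_ess_sup M F = (SOME S. is_family_ess_sup M F S)"

definition beta_mixing :: "'a measure \<Rightarrow> 'a measure \<Rightarrow> 'a measure \<Rightarrow> real" where
  "beta_mixing M \<A> \<B> =
     (LINT \<omega>|M. family_ess_sup M
        {(\<lambda>\<omega>. \<bar>real_cond_exp M \<B> (indicator A) \<omega> - measure M A\<bar>) | A. A \<in> sets \<A>} \<omega>)"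

definition beta_coeff :: "'a measure \<Rightarrow> (int \<Rightarrow> 'a \<Rightarrow> real) \<Rightarrow> nat \<Rightarrow> real" where
  "beta_coeff M Z k =
     beta_mixing M (generated_algebra M Z {..0}) (generated_algebra M Z {int k..})"

definition absolutely_regular :: "'a measure \<Rightarrow> (int \<Rightarrow> 'a \<Rightarrow> real) \<Rightarrow> bool" where
  "absolutely_regular M Z \<longleftrightarrow> strictly_stationary M Z \<and> beta_coeff M Z \<longlonglongrightarrow> 0"

text \<open>
  A measurable function of the \<open>2l+1\<close> variables \<open>Z\<^sub>-\<^sub>l, \<dots>, Z\<^sub>l\<close> is a measurable function on
  the product space indexed by the integers from \<open>-l\<close> to \<open>l\<close>.
\<close>

definition near_epoch_dependent_in_prob ::
  "'a measure \<Rightarrow> (int \<Rightarrow> 'a \<Rightarrow> real) \<Rightarrow> (int \<Rightarrow> 'a \<Rightarrow> real) \<Rightarrow>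
   (nat \<Rightarrow> real) \<Rightarrow> (real \<Rightarrow> real) \<Rightarrow> bool" where
  "near_epoch_dependent_in_prob M X Z a \<phi> \<longleftrightarrow>
     strictly_stationary M (\<lambda>i \<omega>. (X i \<omega>, Z i \<omega>)) \<and>
     a \<longlonglongrightarrow> 0 \<and>
     (\<forall>x>0. 0 < \<phi> x) \<and> antimono_on {0<..} \<phi> \<and>
     (\<exists>f :: nat \<Rightarrow> (int \<Rightarrow> real) \<Rightarrow> real.
        (\<forall>l\<ge>1. f l \<in> borel_measurable (PiM {- int l..int l} (\<lambda>_. borel))) \<and>
        (\<forall>l\<ge>1. \<forall>\<epsilon>>0.
           measure M {\<omega> \<in> space M. \<epsilon> < \<bar>X 0 \<omega> - f l (\<lambda>i\<in>{- int l..int l}. Z i \<omega>)\<bar>}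
             \<le> a l * \<phi> \<epsilon>))"

definition covariance :: "'a measure \<Rightarrow> ('a \<Rightarrow> real) \<Rightarrow> ('a \<Rightarrow> real) \<Rightarrow> real" where
  "covariance M V W =
     (LINT \<omega>|M. (V \<omega> - (LINT \<omega>'|M. V \<omega>')) * (W \<omega> - (LINT \<omega>'|M. W \<omega>')))"

definition tendsto_in_prob :: "'a measure \<Rightarrow> (nat \<Rightarrow> 'a \<Rightarrow> real) \<Rightarrow> real \<Rightarrow> bool" where
  "tendsto_in_prob M Y c \<longleftrightarrow>
     (\<forall>n. Y n \<in> borel_measurable M) \<and>
     (\<forall>\<epsilon>>0. (\<lambda>n. measure M {\<omega> \<in> space M. \<epsilon> < \<bar>Y n \<omega> - c\<bar>}) \<longlonglongrightarrow> 0)"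

definition bounded_variation_real :: "(real \<Rightarrow> real) \<Rightarrow> bool" where
  "bounded_variation_real f \<longleftrightarrow>
     (\<exists>B. \<forall>n. \<forall>x :: nat \<Rightarrow> real. mono x \<longrightarrow> (\<Sum>i<n. \<bar>f (x (Suc i)) - f (x i)\<bar>) \<le> B)"

section \<open>The kernel h, the U-distribution function and its quantile\<close>

definition h_ker :: "(real \<Rightarrow> real \<Rightarrow> real) \<Rightarrow> real \<Rightarrow> real \<Rightarrow> real \<Rightarrow> real" where
  "h_ker g x y t = indicator {..t} (g x y)"

definition gen_inv :: "(real \<Rightarrow> real) \<Rightarrow> real \<Rightarrow> real" where
  "gen_inv F p = Inf {t. p \<le> F t}"

text \<open>The joint law of two independent variables \<open>X, Y\<close> distributed as \<open>X\<^sub>0\<close>.\<close>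

definition pair_law :: "'a measure \<Rightarrow> (int \<Rightarrow> 'a \<Rightarrow> real) \<Rightarrow> (real \<times> real) measure" where
  "pair_law M X = distr M borel (X 0) \<Otimes>\<^sub>M distr M borel (X 0)"

definition U_fun ::
  "'a measure \<Rightarrow> (int \<Rightarrow> 'a \<Rightarrow> real) \<Rightarrow> (real \<Rightarrow> real \<Rightarrow> real) \<Rightarrow> real \<Rightarrow> real" where
  "U_fun M X g t = (LINT z|pair_law M X. h_ker g (fst z) (snd z) t)"

definition U_inv ::
  "'a measure \<Rightarrow> (int \<Rightarrow> 'a \<Rightarrow> real) \<Rightarrow> (real \<Rightarrow> real \<Rightarrow> real) \<Rightarrow> real \<Rightarrow> real" where
  "U_inv M X g p = gen_inv (U_fun M X g) p"

definition h1 ::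
  "'a measure \<Rightarrow> (int \<Rightarrow> 'a \<Rightarrow> real) \<Rightarrow> (real \<Rightarrow> real \<Rightarrow> real) \<Rightarrow> real \<Rightarrow> real \<Rightarrow> real" where
  "h1 M X g x t = (LINT \<omega>|M. h_ker g x (X 0 \<omega>) t) - U_fun M X g t"

text \<open>
  The supremum of a Borel function over a moving ball is in general only universally
  measurable, hence the completion of the joint law in the following two conditions.
  The supremum is taken in \<^typ>\<open>ennreal\<close>, as it may be infinite.
\<close>

definition variation_condition_h ::
  "'a measure \<Rightarrow> (int \<Rightarrow> 'a \<Rightarrow> real) \<Rightarrow> (real \<Rightarrow> real \<Rightarrow> real) \<Rightarrow> real \<Rightarrow> bool" where
  "variation_condition_h M X g q \<longleftrightarrow>
     (\<exists>L. \<forall>\<^sub>F t in nhds q. \<forall>\<epsilon>>0.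
        (\<integral>\<^sup>+ z. (SUP w\<in>{w. norm (w - z) \<le> \<epsilon>}.
                 ennreal (\<bar>h_ker g (fst w) (snd w) t - h_ker g (fst z) (snd z) t\<bar>\<^sup>2))
          \<partial>completion (pair_law M X)) \<le> ennreal (L * \<epsilon>))"

definition variation_condition_g ::
  "'a measure \<Rightarrow> (int \<Rightarrow> 'a \<Rightarrow> real) \<Rightarrow> (real \<Rightarrow> real \<Rightarrow> real) \<Rightarrow> bool" where
  "variation_condition_g M X g \<longleftrightarrow>
     (\<exists>L. \<forall>\<epsilon>>0.
        (\<integral>\<^sup>+ z. (SUP w\<in>{w. norm (w - z) \<le> \<epsilon>}.
                 ennreal \<bar>g (fst w) (snd w) - g (fst z) (snd z)\<bar>)\<^sup>2
          \<partial>completion (pair_law M X)) \<le> ennreal (L * \<epsilon>))"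

section \<open>Estimators\<close>

definition U_stat ::
  "(int \<Rightarrow> 'a \<Rightarrow> real) \<Rightarrow> (real \<Rightarrow> real \<Rightarrow> real) \<Rightarrow> nat \<Rightarrow> 'a \<Rightarrow> real \<Rightarrow> real" where
  "U_stat X g n \<omega> t =
     2 / (real n * (real n - 1)) *
       (\<Sum>i\<in>{1..int n}. \<Sum>j\<in>{i<..int n}. h_ker g (X i \<omega>) (X j \<omega>) t)"

definition U_stat_inv ::
  "(int \<Rightarrow> 'a \<Rightarrow> real) \<Rightarrow> (real \<Rightarrow> real \<Rightarrow> real) \<Rightarrow> nat \<Rightarrow> 'a \<Rightarrow> real \<Rightarrow> real" where
  "U_stat_inv X g n \<omega> p = gen_inv (U_stat X g n \<omega>) p"

definition u_hat ::
  "(int \<Rightarrow> 'a \<Rightarrow> real) \<Rightarrow> (real \<Rightarrow> real \<Rightarrow> real) \<Rightarrow> (real \<Rightarrow> real) \<Rightarrow> (nat \<Rightarrow> real) \<Rightarrow>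
   nat \<Rightarrow> 'a \<Rightarrow> real \<Rightarrow> real" where
  "u_hat X g K d n \<omega> t =
     2 / (real n * (real n - 1) * d n) *
       (\<Sum>i\<in>{1..int n}. \<Sum>j\<in>{i<..int n}. K ((g (X i \<omega>) (X j \<omega>) - t) / d n))"

definition h1_hat ::
  "(int \<Rightarrow> 'a \<Rightarrow> real) \<Rightarrow> (real \<Rightarrow> real \<Rightarrow> real) \<Rightarrow> nat \<Rightarrow> 'a \<Rightarrow> real \<Rightarrow> real \<Rightarrow> real" where
  "h1_hat X g n \<omega> x t =
     1 / real n * (\<Sum>i\<in>{1..int n}. h_ker g x (X i \<omega>) t)
     - 1 / (real n)\<^sup>2 * (\<Sum>i\<in>{1..int n}. \<Sum>j\<in>{1..int n}. h_ker g (X i \<omega>) (X j \<omega>) t)"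

definition rho_hat ::
  "(int \<Rightarrow> 'a \<Rightarrow> real) \<Rightarrow> (real \<Rightarrow> real \<Rightarrow> real) \<Rightarrow> nat \<Rightarrow> 'a \<Rightarrow> int \<Rightarrow> real \<Rightarrow> real" where
  "rho_hat X g n \<omega> r t =
     1 / real n *
       (\<Sum>i\<in>{1..int n - r}. h1_hat X g n \<omega> (X i \<omega>) t * h1_hat X g n \<omega> (X (i + r) \<omega>) t)"

definition sigma2_hat ::
  "(int \<Rightarrow> 'a \<Rightarrow> real) \<Rightarrow> (real \<Rightarrow> real \<Rightarrow> real) \<Rightarrow> (real \<Rightarrow> real) \<Rightarrow> (nat \<Rightarrow> real) \<Rightarrow>
   (real \<Rightarrow> real) \<Rightarrow> (nat \<Rightarrow> real) \<Rightarrow> real \<Rightarrow> nat \<Rightarrow> 'a \<Rightarrow> real" where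
  "sigma2_hat X g K d W b p n \<omega> =
     4 / (u_hat X g K d n \<omega> (U_stat_inv X g n \<omega> p))\<^sup>2 *
       (\<Sum>r\<in>{- (int n - 1)..int n - 1}.
          W (real_of_int \<bar>r\<bar> / b n) * rho_hat X g n \<omega> \<bar>r\<bar> (U_stat_inv X g n \<omega> p))"

definition h1_autocov ::
  "'a measure \<Rightarrow> (int \<Rightarrow> 'a \<Rightarrow> real) \<Rightarrow> (real \<Rightarrow> real \<Rightarrow> real) \<Rightarrow> real \<Rightarrow> int \<Rightarrow> real" where
  "h1_autocov M X g p r =
     covariance M (\<lambda>\<omega>. h1 M X g (X 0 \<omega>) (U_inv M X g p))
                  (\<lambda>\<omega>. h1 M X g (X r \<omega>) (U_inv M X g p))"

definition sigma2 ::
  "'a measure \<Rightarrow> (int \<Rightarrow> 'a \<Rightarrow> real) \<Rightarrow> (real \<Rightarrow> real \<Rightarrow> real) \<Rightarrow> real \<Rightarrow> real" where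
  "sigma2 M X g p =
     4 / (deriv (U_fun M X g) (U_inv M X g p))\<^sup>2 * (\<Sum>\<^sub>\<infinity>r\<in>UNIV. h1_autocov M X g p r)"

section \<open>Conditions on the smoothing kernels\<close>

definition density_kernel :: "(real \<Rightarrow> real) \<Rightarrow> bool" where
  "density_kernel K \<longleftrightarrow>
     (\<forall>x. K (- x) = K x) \<and>
     (\<exists>C. C-lipschitz_on UNIV K) \<and>
     bounded {x. K x \<noteq> 0} \<and>
     bounded_variation_real K \<and>
     integrable lborel K \<and> (LINT x|lborel. K x) = 1"

text \<open>Only the values of \<open>W\<close> on \<open>[0,\<infinity>)\<close> matter.\<close>

definition hac_kernel :: "(real \<Rightarrow> real) \<Rightarrow> bool" where
  "hac_kernel W \<longleftrightarrow>
     (\<forall>t\<ge>0. 0 \<le> W t \<and> W t \<le> 1) \<and>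
     W 0 = 1 \<and>
     continuous (at 0 within {0..}) W \<and>
     (\<exists>F. finite F \<and> (\<forall>t\<in>{0..} - F. continuous (at t within {0..}) W)) \<and>
     (\<exists>V. antimono_on {0..} V \<and> set_integrable lborel {0..} V \<and> (\<forall>t\<ge>0. \<bar>W t\<bar> \<le> V t)) \<and>
     (\<integral>\<^sup>+ x\<in>{0..}. ennreal \<bar>LINT t:{0..}|lborel. W t * cos (x * t)\<bar> \<partial>lborel) < \<infinity>"

end

theory Submission
  imports Defs
begin

text \<open>
  Absolute regularity enters only through a decoupling principle: the coefficient \<open>\<beta>\<^sub>k\<close>
  bounds the total variation distance between the joint law of past and future and the product
  of their laws, and the approximants \<open>Y l i\<close> of \<open>X i\<close> depend on finitely many \<open>Z j\<close>. Under
  a product law the variation condition on \<open>h\<close> makes it harmless to replace \<open>X\<close> by \<open>Y\<close>, so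
  mixed moments of \<open>h\<^sub>1(X\<^sub>i, t)\<close> and of the degenerate part of the kernel are bounded by a
  summable sequence \<open>\<gamma>\<close> evaluated at the gaps between indices. This yields
  \<open>E (U\<^sub>n(t) - U(t))\<^sup>2 = O(1/n)\<close> near the quantile \<open>q\<close>, whence \<open>U\<^sub>n\<^sup>-\<^sup>1(p) - q = o(s\<^sub>n)\<close> in
  probability whenever \<open>s\<^sub>n \<surd>n \<rightarrow> \<infinity>\<close>. Approximating \<open>K\<close> by step functions turns the density
  estimator into finitely many difference quotients of \<open>U\<^sub>n\<close>.

  For the numerator, write it as \<open>Q(x, x)\<close> with
  \<open>Q(x, y) = (1/n) \<Sum>\<^sub>i\<^sub>,\<^sub>j W(\<bar>i - j\<bar>/b\<^sub>n) x\<^sub>i y\<^sub>j\<close>, and split \<open>x = a + e\<close> with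
  \<open>a\<^sub>i = h\<^sub>1(X\<^sub>i, q)\<close>. The mean square of \<open>e\<close> is \<open>o(1/b\<^sub>n)\<close> and \<open>\<bar>Q(e, e)\<bar>\<close> is at most \<open>O(b\<^sub>n)\<close>
  times it; the cross term \<open>Q(e, a)\<close> is controlled by Cauchy-Schwarz, because the smoothed
  sequence \<open>\<Sum>\<^sub>j W(\<bar>i - j\<bar>/b\<^sub>n) a\<^sub>j\<close> has second moment only \<open>O(b\<^sub>n)\<close>. Finally the lag averages in
  \<open>Q(a, a)\<close> have standard deviation \<open>O(1/\<surd>n)\<close> uniformly in the lag, and \<open>b\<^sub>n/\<surd>n \<rightarrow> 0\<close>.
\<close>

section \<open>Absolute regularity and decoupling\<close>

text \<open>The variation condition speaks of independent copies, whereas the kernel jumps and is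
  evaluated at dependent pairs \<open>(X i, X j)\<close>, so closeness of \<open>X\<close> and
  \<open>Y\<close> alone says nothing about it. The way out is an event about the approximants only:
  that the kernel changes value close to \<open>(Y l i, Y l j)\<close>. It is determined by two
  windows of \<open>Z\<close>, so its probability may be computed under the product law at the price
  of \<open>2 * \<beta> k\<close>, and there it can be carried back to \<open>X\<close>. For indices
  \<open>m\<close> apart, \<open>l = m div 3\<close> cuts the gap in three: half a window at each
  end, the rest for mixing. Radius and failure probability are both of order
  \<open>1 / l ^ 6\<close>, which stays summable after weighting by \<open>m\<close>. The weight in
  the mixing assumption is spent on fourth moments: at lag \<open>r\<close> about
  \<open>2 * r + 1\<close> overlapping products each cost a squared autocovariance, and
  \<open>r * \<gamma> r\<close> must stay bounded to get a bound uniform in the lag. The random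
  level is handled through monotonicity in \<open>t\<close> alone, which encloses everything between
  deterministic levels.\<close>

lemma (in prob_space) is_family_ess_sup_exists:
  fixes F :: "('a \<Rightarrow> real) set"
  assumes ne: "F \<noteq> {}" and F: "F \<subseteq> borel_measurable M"
    and bnd: "\<And>f. f \<in> F \<Longrightarrow> AE \<omega> in M. 0 \<le> f \<omega> \<and> f \<omega> \<le> 1"
  shows "\<exists>S. is_family_ess_sup M F S"
proof -
  \<comment> \<open>The members lie in \<open>[0, 1]\<close> only almost surely; clipping makes the
    countable suprema finite at every point and alters each member on a null set only.\<close>
  define cl where "cl x = max 0 (min 1 x)" for x :: real
  define S where "S s \<omega> = (SUP n. cl (s n \<omega>))" for s :: "nat \<Rightarrow> 'a \<Rightarrow> real" and \<omega>
  have cl: "0 \<le> cl x" "cl x \<le> 1" for x by (auto simp: cl_def)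
  have bdd: "bdd_above (range (\<lambda>n. cl (s n \<omega>)))" for s :: "nat \<Rightarrow> 'a \<Rightarrow> real" and \<omega>
    using cl by (auto intro!: bdd_aboveI[where M = 1])
  have up: "cl (s n \<omega>) \<le> S s \<omega>" for s n \<omega>
    unfolding S_def by (rule cSUP_upper[OF _ bdd]) simp
  have least: "(\<And>n. cl (s n \<omega>) \<le> c) \<Longrightarrow> S s \<omega> \<le> c" for s \<omega> c
    unfolding S_def by (rule cSUP_least) auto
  have S01: "0 \<le> S s \<omega>" "S s \<omega> \<le> 1" for s \<omega>
    using up[of s 0 \<omega>] cl(1)[of "s 0 \<omega>"] least[of s \<omega> 1] cl(2) by auto
  have meas: "S s \<in> borel_measurable M" if "range s \<subseteq> F" for s
  proof -
    have [measurable]: "s n \<in> borel_measurable M" for n using that F by auto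
    have "(\<lambda>\<omega>. SUP n\<in>UNIV. cl (s n \<omega>)) \<in> borel_measurable M"
      by (rule borel_measurable_cSUP) (use bdd in \<open>auto simp: cl_def\<close>)
    then show ?thesis by (simp add: S_def[abs_def])
  qed
  have int: "integrable M (S s)" if "range s \<subseteq> F" for s
    by (rule integrable_const_bound[where B = 1]) (use S01 meas[OF that] in auto)
  \<comment> \<open>Exhaustion argument: among the suprema of countable subfamilies, find one of
    maximal expectation.\<close>
  define E where "E = {expectation (S s) | s. range s \<subseteq> F}"
  define v where "v = Sup E"
  have bddE: "bdd_above E"
  proof (rule bdd_aboveI[where M = 1])
    fix x assume "x \<in> E"
    then obtain s where s: "range s \<subseteq> F" "x = expectation (S s)" by (auto simp: E_def)
    show "x \<le> 1" unfolding s using integral_le_const[OF int[OF s(1)], of 1] S01 by simp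
  qed
  from ne obtain f0 where "f0 \<in> F" by auto
  then have "expectation (S (\<lambda>_. f0)) \<in> E" by (auto simp: E_def)
  then have neE: "E \<noteq> {}" by auto
  have "\<exists>s. range s \<subseteq> F \<and> v - 1 / real (Suc m) < expectation (S s)" for m
  proof -
    have "v - 1 / real (Suc m) < Sup E" by (simp add: v_def)
    then obtain x where "x \<in> E" "v - 1 / real (Suc m) < x" using less_cSupE neE by metis
    then show ?thesis by (auto simp: E_def)
  qed
  then obtain s where s: "\<And>m. range (s m) \<subseteq> F" "\<And>m. v - 1 / real (Suc m) < expectation (S (s m))"
    by metis
  \<comment> \<open>A pairing function merges the near-maximal subfamilies into one countable
    subfamily, which attains the supremum \<open>v\<close>.\<close>
  define s' where "s' k = s (fst (prod_decode k)) (snd (prod_decode k))" for k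
  have s'F: "range s' \<subseteq> F" using s(1) by (auto simp: s'_def)
  have le: "S (s m) \<omega> \<le> S s' \<omega>" for m \<omega>
  proof (rule least)
    fix n show "cl (s m n \<omega>) \<le> S s' \<omega>"
      using up[of s' "prod_encode (m, n)" \<omega>] by (simp add: s'_def)
  qed
  have "v - 1 / real (Suc m) \<le> expectation (S s')" for m
    using s(2)[of m] integral_mono[OF int[OF s(1)] int[OF s'F], of m] le by fastforce
  moreover have "(\<lambda>m. v - 1 / real (Suc m)) \<longlonglongrightarrow> v" by real_asymp
  ultimately have v: "v \<le> expectation (S s')"
    by (intro LIMSEQ_le_const2) auto
  have "is_family_ess_sup M F (S s')"
    unfolding is_family_ess_sup_def
  proof (intro conjI ballI impI)
    show "S s' \<in> borel_measurable M" by (rule meas[OF s'F])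
  next
    fix f assume f: "f \<in> F"
    \<comment> \<open>Adjoining \<open>f\<close> cannot raise the maximal expectation, so it changes
      the supremum on a null set only; hence \<open>f\<close> lies below \<open>S s'\<close> almost
      surely.\<close>
    define s'' where "s'' n = (case n of 0 \<Rightarrow> f | Suc k \<Rightarrow> s' k)" for n
    have s''F: "range s'' \<subseteq> F" using f s'F by (auto simp: s''_def image_subset_iff split: nat.splits)
    have le': "S s' \<omega> \<le> S s'' \<omega>" for \<omega>
    proof (rule least)
      fix n show "cl (s' n \<omega>) \<le> S s'' \<omega>" using up[of s'' "Suc n" \<omega>] by (simp add: s''_def)
    qed
    have "expectation (S s'') \<le> v"
      unfolding v_def by (rule cSup_upper[OF _ bddE]) (use s''F in \<open>auto simp: E_def\<close>)
    then have "expectation (\<lambda>\<omega>. S s'' \<omega> - S s' \<omega>) \<le> 0"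
      using v by (simp add: int[OF s'F] int[OF s''F])
    moreover have "expectation (\<lambda>\<omega>. S s'' \<omega> - S s' \<omega>) \<ge> 0"
      by (rule integral_nonneg_AE) (use le' in auto)
    ultimately have "expectation (\<lambda>\<omega>. S s'' \<omega> - S s' \<omega>) = 0" by linarith
    then have "AE \<omega> in M. S s'' \<omega> - S s' \<omega> = 0"
      using int[OF s'F] int[OF s''F]
      by (subst (asm) integral_nonneg_eq_0_iff_AE) (auto simp: le')
    with bnd[OF f] show "AE \<omega> in M. f \<omega> \<le> S s' \<omega>"
    proof eventually_elim
      case (elim \<omega>)
      then show ?case using up[of s'' 0 \<omega>] by (auto simp: s''_def cl_def)
    qed
  next
    fix T assume T: "T \<in> borel_measurable M" "\<forall>f\<in>F. AE \<omega> in M. f \<omega> \<le> T \<omega>"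
    have "AE \<omega> in M. s' n \<omega> \<le> T \<omega> \<and> 0 \<le> s' n \<omega> \<and> s' n \<omega> \<le> 1" for n
    proof -
      have "s' n \<in> F" using s'F by auto
      with T(2) bnd show ?thesis by (simp add: eventually_conj_iff)
    qed
    then have "AE \<omega> in M. \<forall>n. s' n \<omega> \<le> T \<omega> \<and> 0 \<le> s' n \<omega> \<and> s' n \<omega> \<le> 1"
      by (simp add: AE_all_countable)
    then show "AE \<omega> in M. S s' \<omega> \<le> T \<omega>"
    proof eventually_elim
      case (elim \<omega>)
      then show ?case by (intro least) (auto simp: cl_def)
    qed
  qed
  then show ?thesis by blast
qed

text \<open>A discrete layer-cake formula: rounding \<open>f\<close> down to a multiple of
  \<open>1 / N\<close> gives the average of the indicators of \<open>N\<close> level sets. The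
  average of \<open>N\<close> differences, each at most \<open>\<beta>\<close>, is again at most
  \<open>\<beta>\<close>, so refining the levels costs nothing.\<close>

lemma tv_integral_le:
  fixes f :: "'b \<Rightarrow> real"
  assumes "prob_space P" "prob_space Q" and sets: "sets P = sets Q"
    and tv: "\<And>C. C \<in> sets P \<Longrightarrow> \<bar>measure P C - measure Q C\<bar> \<le> \<beta>"
    and f [measurable]: "f \<in> borel_measurable P" and f01: "\<And>x. 0 \<le> f x" "\<And>x. f x \<le> 1"
  shows "\<bar>(LINT x|P. f x) - (LINT x|Q. f x)\<bar> \<le> \<beta>"
proof -
  interpret P: prob_space P by fact
  interpret Q: prob_space Q by fact
  have sp: "space P = space Q" using sets by (rule sets_eq_imp_space_eq)
  have [measurable]: "f \<in> borel_measurable Q" using f measurable_cong_sets[OF sets refl] by blast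
  have ip: "integrable P f" "integrable Q f"
    by (auto intro!: P.integrable_const_bound[where B = 1] Q.integrable_const_bound[where B = 1] simp: f01)
  have main: "\<bar>(LINT x|P. f x) - (LINT x|Q. f x)\<bar> \<le> \<beta> + 1 / real N" if N: "N > 0" for N :: nat
  proof -
    define C where "C k = {x \<in> space P. real k \<le> real N * f x}" for k :: nat
    have CP: "C k \<in> sets P" for k unfolding C_def by measurable
    have CQ: "C k \<in> sets Q" for k using CP sets by simp
    define F where "F x = (\<Sum>k\<in>{1..N}. indicator (C k) x) / real N" for x
    have F: "F x \<le> f x \<and> f x \<le> F x + 1 / real N" if "x \<in> space P" for x
    proof -
      define m where "m = nat \<lfloor>real N * f x\<rfloor>"
      have fl: "real m \<le> real N * f x" "real N * f x < real m + 1"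
        using f01[of x] by (auto simp: m_def)
      have "real N * f x \<le> real N" using f01(2)[of x] by (simp add: mult_left_le)
      then have mN: "m \<le> N" using fl by linarith
      have "(\<Sum>k\<in>{1..N}. indicator (C k) x) = (\<Sum>k\<in>{1..N}. if k \<le> m then 1 else (0::real))"
      proof (rule sum.cong)
        fix k :: nat
        have "real k \<le> real N * f x \<longleftrightarrow> k \<le> m" using fl by linarith
        then show "indicator (C k) x = (if k \<le> m then 1 else (0::real))"
          using that by (auto simp: C_def indicator_def)
      qed simp
      also have "\<dots> = real (card {k\<in>{1..N}. k \<le> m})"
        by (subst sum.inter_filter[symmetric]) auto
      also have "{k\<in>{1..N}. k \<le> m} = {1..m}" using mN by auto
      finally have "F x = real m / real N" by (simp add: F_def)
      moreover have "real m / real N \<le> f x" using fl N by (simp add: pos_divide_le_eq mult.commute)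
      moreover have "f x \<le> real m / real N + 1 / real N"
        using fl N by (simp add: add_divide_distrib[symmetric] pos_le_divide_eq mult.commute)
      ultimately show ?thesis by simp
    qed
    have iF: "integrable P F" "integrable Q F"
      unfolding F_def using CP CQ
      by (auto intro!: integrable_sum integrable_divide integrable_real_indicator
          simp: P.emeasure_eq_measure Q.emeasure_eq_measure)
    have eF: "(LINT x|P. F x) = (\<Sum>k\<in>{1..N}. measure P (C k)) / real N"
      "(LINT x|Q. F x) = (\<Sum>k\<in>{1..N}. measure Q (C k)) / real N"
      unfolding F_def using CP CQ sets.sets_into_space[OF CQ] sets.sets_into_space[OF CP]
      by (subst integral_divide_zero; subst Bochner_Integration.integral_sum;
          auto simp: P.emeasure_eq_measure Q.emeasure_eq_measure Int_absorb2 Int_absorb1)+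
    have "\<bar>(LINT x|P. F x) - (LINT x|Q. F x)\<bar> = \<bar>\<Sum>k\<in>{1..N}. measure P (C k) - measure Q (C k)\<bar> / real N"
      using N by (simp add: eF sum_subtractf diff_divide_distrib[symmetric] abs_divide)
    also have "\<dots> \<le> (\<Sum>k\<in>{1..N}. \<beta>) / real N"
      by (intro divide_right_mono order_trans[OF sum_abs] sum_mono tv CP) auto
    also have "\<dots> = \<beta>" using N by simp
    finally have 1: "\<bar>(LINT x|P. F x) - (LINT x|Q. F x)\<bar> \<le> \<beta>" .
    have 2: "(LINT x|P. F x) \<le> (LINT x|P. f x)" "(LINT x|Q. F x) \<le> (LINT x|Q. f x)"
      using F sp by (auto intro!: integral_mono iF ip)
    have "(LINT x|P. f x) \<le> (LINT x|P. F x + 1 / real N)"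
      using F by (intro integral_mono ip Bochner_Integration.integrable_add iF) auto
    then have 3: "(LINT x|P. f x) \<le> (LINT x|P. F x) + 1 / real N" by (simp add: iF P.prob_space)
    have "(LINT x|Q. f x) \<le> (LINT x|Q. F x + 1 / real N)"
      using F sp by (intro integral_mono ip Bochner_Integration.integrable_add iF) auto
    then have 4: "(LINT x|Q. f x) \<le> (LINT x|Q. F x) + 1 / real N" by (simp add: iF Q.prob_space)
    from 1 2 3 4 show ?thesis by linarith
  qed
  show ?thesis
  proof (rule LIMSEQ_le_const)
    show "(\<lambda>N. \<beta> + 1 / real N) \<longlonglongrightarrow> \<beta>" by real_asymp
    show "\<exists>N. \<forall>n\<ge>N. \<bar>(LINT x|P. f x) - (LINT x|Q. f x)\<bar> \<le> \<beta> + 1 / real n"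
      using main by (intro exI[of _ 1]) auto
  qed
qed

section \<open>Approximation of product-measurable sets by finite unions of rectangles\<close>

text \<open>Finite unions of rectangles, written so that complements and unions need no bookkeeping:
  the second coordinate selects, through a finite partition \<open>\<pi>\<close>, the section in the first.\<close>

definition rect_algebra :: "'b measure \<Rightarrow> 'c measure \<Rightarrow> ('b \<times> 'c) set set" where
  "rect_algebra N1 N2 = {D. \<exists>(m::nat) A \<pi>. \<pi> \<in> measurable N2 (count_space UNIV) \<and>
     (\<forall>v\<in>space N2. \<pi> v < m) \<and> (\<forall>k. A k \<in> sets N1) \<and>
     D = {z \<in> space N1 \<times> space N2. fst z \<in> A (\<pi> (snd z))}}"

lemma rect_algebra_sets:
  assumes "D \<in> rect_algebra N1 N2" shows "D \<in> sets (N1 \<Otimes>\<^sub>M N2)"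
proof -
  obtain m :: nat and A \<pi> where \<pi>: "\<pi> \<in> measurable N2 (count_space UNIV)"
     "\<And>v. v \<in> space N2 \<Longrightarrow> \<pi> v < m" "\<And>k. A k \<in> sets N1"
     and D: "D = {z \<in> space N1 \<times> space N2. fst z \<in> A (\<pi> (snd z))}"
    using assms unfolding rect_algebra_def by blast
  have "D = (\<Union>k. A k \<times> (\<pi> -` {k} \<inter> space N2))"
    using sets.sets_into_space[OF \<pi>(3)] by (auto simp: D)
  also have "\<dots> \<in> sets (N1 \<Otimes>\<^sub>M N2)"
    by (intro sets.countable_UN image_subsetI pair_measureI \<pi>(3) measurable_sets[OF \<pi>(1)]) auto
  finally show ?thesis .
qed

lemma rect_algebra_rect:
  assumes "A \<in> sets N1" "B \<in> sets N2"
  shows "A \<times> B \<in> rect_algebra N1 N2"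
proof -
  have "(\<lambda>v. if v \<in> B then 1 else 0 :: nat) \<in> measurable N2 (count_space UNIV)" using assms by measurable
  moreover have "A \<times> B = {z \<in> space N1 \<times> space N2. fst z \<in> (\<lambda>k. if k = 1 then A else {}) ((\<lambda>v. if v \<in> B then 1 else 0 :: nat) (snd z))}"
    using sets.sets_into_space[OF assms(1)] sets.sets_into_space[OF assms(2)] by (auto split: if_splits)
  ultimately show ?thesis unfolding rect_algebra_def using assms
    by (intro CollectI exI[of _ 2] exI[of _ "\<lambda>k. if k = 1 then A else {}"] exI[of _ "\<lambda>v. if v \<in> B then 1 else 0 :: nat"]) auto
qed

lemma rect_algebra_compl:
  assumes "D \<in> rect_algebra N1 N2"
  shows "space N1 \<times> space N2 - D \<in> rect_algebra N1 N2"
proof -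
  obtain m :: nat and A \<pi> where \<pi>: "\<pi> \<in> measurable N2 (count_space UNIV)"
     "\<And>v. v \<in> space N2 \<Longrightarrow> \<pi> v < m" "\<And>k. A k \<in> sets N1"
     and D: "D = {z \<in> space N1 \<times> space N2. fst z \<in> A (\<pi> (snd z))}"
    using assms unfolding rect_algebra_def by blast
  show ?thesis unfolding rect_algebra_def
    using \<pi> by (intro CollectI exI[of _ m] exI[of _ "\<lambda>k. space N1 - A k"] exI[of _ \<pi>]) (auto simp: D)
qed

lemma rect_algebra_Un:
  assumes "D \<in> rect_algebra N1 N2" "D' \<in> rect_algebra N1 N2"
  shows "D \<union> D' \<in> rect_algebra N1 N2"
proof -
  obtain m :: nat and A \<pi> where \<pi> [measurable]: "\<pi> \<in> measurable N2 (count_space UNIV)"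
     and \<pi>': "\<And>v. v \<in> space N2 \<Longrightarrow> \<pi> v < m" "\<And>k. A k \<in> sets N1"
     and D: "D = {z \<in> space N1 \<times> space N2. fst z \<in> A (\<pi> (snd z))}"
    using assms(1) unfolding rect_algebra_def by blast
  obtain m' :: nat and A' \<sigma> where \<sigma> [measurable]: "\<sigma> \<in> measurable N2 (count_space UNIV)"
     and \<sigma>': "\<And>v. v \<in> space N2 \<Longrightarrow> \<sigma> v < m'" "\<And>k. A' k \<in> sets N1"
     and D': "D' = {z \<in> space N1 \<times> space N2. fst z \<in> A' (\<sigma> (snd z))}"
    using assms(2) unfolding rect_algebra_def by blast
  \<comment> \<open>Mixed-radix code of the two selectors: since \<open>\<pi> v < m\<close>,
    \<open>mod\<close> and \<open>div\<close> recover them, and the common refinement is again a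
    selector with finitely many values.\<close>
  define \<tau> where "\<tau> v = \<pi> v + m * \<sigma> v" for v
  have \<tau>: "\<tau> \<in> measurable N2 (count_space UNIV)" unfolding \<tau>_def[abs_def] by measurable
  have dec: "\<tau> v mod m = \<pi> v" "\<tau> v div m = \<sigma> v" "\<tau> v < m * m'" if "v \<in> space N2" for v
  proof -
    show "\<tau> v mod m = \<pi> v" "\<tau> v div m = \<sigma> v" using \<pi>'(1)[OF that] by (auto simp: \<tau>_def)
    have "\<tau> v < m + m * \<sigma> v" using \<pi>'(1)[OF that] by (simp add: \<tau>_def)
    also have "\<dots> = m * Suc (\<sigma> v)" by simp
    also have "\<dots> \<le> m * m'" using \<sigma>'(1)[OF that] by (intro mult_le_mono2) simp
    finally show "\<tau> v < m * m'" .
  qed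
  show ?thesis unfolding rect_algebra_def
    using \<tau> dec \<pi>'(2) \<sigma>'(2)
    by (intro CollectI exI[of _ "m * m'"] exI[of _ "\<lambda>k. A (k mod m) \<union> A' (k div m)"] exI[of _ \<tau>])
       (auto simp: D D')
qed

lemma rect_algebra_UN:
  fixes n :: nat
  assumes "\<And>i. i < n \<Longrightarrow> D i \<in> rect_algebra N1 N2"
  shows "(\<Union>i<n. D i) \<in> rect_algebra N1 N2"
  using assms
proof (induct n)
  case 0
  then show ?case using rect_algebra_rect[of "{}" N1 "{}" N2] by simp
next
  case (Suc n)
  then show ?case using rect_algebra_Un[of "D n" N1 N2 "\<Union>i<n. D i"] by (simp add: lessThan_Suc)
qed

text \<open>One approximant has to serve both measures, because the joint law and the product law
  will be compared on it. The sets that can be approximated for both at once are closed under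
  complements, which leave the symmetric difference unchanged, and under countable unions, after
  truncation to finitely many members.\<close>

lemma rect_algebra_approx:
  assumes "finite_measure P" "finite_measure Q"
    and sP: "sets P = sets (N1 \<Otimes>\<^sub>M N2)" and sQ: "sets Q = sets (N1 \<Otimes>\<^sub>M N2)"
    and C: "C \<in> sets (N1 \<Otimes>\<^sub>M N2)" and "0 < \<epsilon>"
  shows "\<exists>D\<in>rect_algebra N1 N2. measure P (sym_diff C D) < \<epsilon> \<and> measure Q (sym_diff C D) < \<epsilon>"
proof -
  interpret P: finite_measure P by fact
  interpret Q: finite_measure Q by fact
  have "C \<in> sigma_sets (space N1 \<times> space N2) {A \<times> B | A B. A \<in> sets N1 \<and> B \<in> sets N2}"
    using C by (simp add: sets_pair_measure)
  then show ?thesis using \<open>0 < \<epsilon>\<close>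
  proof (induction arbitrary: \<epsilon> rule: sigma_sets.induct)
    case (Basic C)
    then show ?case using rect_algebra_rect by (intro bexI[of _ C]) auto
  next
    case Empty
    then show ?case using rect_algebra_rect[of "{}" N1 "{}" N2] by (intro bexI[of _ "{}"]) auto
  next
    case (Compl C)
    then obtain D where D: "D \<in> rect_algebra N1 N2" "measure P (sym_diff C D) < \<epsilon>" "measure Q (sym_diff C D) < \<epsilon>"
      by blast
    let ?E = "space N1 \<times> space N2 - D"
    have "C \<subseteq> space N1 \<times> space N2"
      using Compl.hyps sets.sets_into_space[of _ "N1 \<Otimes>\<^sub>M N2"] by (auto simp: sets_pair_measure space_pair_measure)
    moreover have "D \<subseteq> space N1 \<times> space N2"
      using rect_algebra_sets[OF D(1)] sets.sets_into_space[of _ "N1 \<Otimes>\<^sub>M N2"] by (auto simp: space_pair_measure)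
    ultimately have "sym_diff (space N1 \<times> space N2 - C) ?E = sym_diff C D" by blast
    then show ?case using D rect_algebra_compl[OF D(1)] by (intro bexI[of _ ?E]) auto
  next
    case (Union C)
    have CS: "C i \<in> sets (N1 \<Otimes>\<^sub>M N2)" for i using Union.hyps by (simp add: sets_pair_measure)
    have inc: "incseq (\<lambda>n. \<Union>i<n. C i)" by (intro monoI UN_mono) auto
    have un: "(\<Union>n. \<Union>i<n. C i) = (\<Union>i. C i)" by auto
    have lim: "(\<lambda>n. measure P (\<Union>i<n. C i)) \<longlonglongrightarrow> measure P (\<Union>i. C i)"
      "(\<lambda>n. measure Q (\<Union>i<n. C i)) \<longlonglongrightarrow> measure Q (\<Union>i. C i)"
      using P.finite_Lim_measure_incseq[OF _ inc] Q.finite_Lim_measure_incseq[OF _ inc] CS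
      unfolding un by (auto simp: sP sQ)
    have "\<forall>\<^sub>F n in sequentially. measure P (\<Union>i<n. C i) > measure P (\<Union>i. C i) - \<epsilon>/2 \<and> measure Q (\<Union>i<n. C i) > measure Q (\<Union>i. C i) - \<epsilon>/2"
      using Union.prems by (intro eventually_conj order_tendstoD(1)[OF lim(1)] order_tendstoD(1)[OF lim(2)]) auto
    then obtain n where n: "measure P (\<Union>i<n. C i) > measure P (\<Union>i. C i) - \<epsilon>/2" "measure Q (\<Union>i<n. C i) > measure Q (\<Union>i. C i) - \<epsilon>/2"
      by (auto simp: eventually_sequentially)
    \<comment> \<open>Half of \<open>\<epsilon>\<close> goes to truncating the union, the other half
      to the \<open>n\<close> approximants; \<open>Suc n\<close> keeps the denominator positive for
      \<open>n = 0\<close>.\<close>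
    define \<delta> where "\<delta> = \<epsilon> / (2 * real (Suc n))"
    have \<delta>: "\<delta> > 0" using Union.prems by (simp add: \<delta>_def)
    have "\<forall>i. \<exists>D\<in>rect_algebra N1 N2. measure P (sym_diff (C i) D) < \<delta> \<and> measure Q (sym_diff (C i) D) < \<delta>"
      using Union.IH[OF \<delta>] by blast
    then obtain D where D: "\<And>i. D i \<in> rect_algebra N1 N2" "\<And>i. measure P (sym_diff (C i) (D i)) < \<delta>" "\<And>i. measure Q (sym_diff (C i) (D i)) < \<delta>"
      by metis
    define E where "E = (\<Union>i<n. D i)"
    have ER: "E \<in> rect_algebra N1 N2" unfolding E_def by (rule rect_algebra_UN) (rule D)
    have DS: "D i \<in> sets (N1 \<Otimes>\<^sub>M N2)" for i by (rule rect_algebra_sets[OF D(1)])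
    have sub: "sym_diff (\<Union>i. C i) E \<subseteq> ((\<Union>i. C i) - (\<Union>i<n. C i)) \<union> (\<Union>i<n. sym_diff (C i) (D i))"
      by (auto simp: E_def)
    have bound: "measure R (sym_diff (\<Union>i. C i) E) < \<epsilon>"
      if "finite_measure R" and sR: "sets R = sets (N1 \<Otimes>\<^sub>M N2)"
        and nR: "measure R (\<Union>i<n. C i) > measure R (\<Union>i. C i) - \<epsilon>/2"
        and DR: "\<And>i. measure R (sym_diff (C i) (D i)) < \<delta>" for R
    proof -
      interpret R: finite_measure R by fact
      have "measure R (sym_diff (\<Union>i. C i) E) \<le> measure R (((\<Union>i. C i) - (\<Union>i<n. C i)) \<union> (\<Union>i<n. sym_diff (C i) (D i)))"
        by (rule R.finite_measure_mono[OF sub]) (use CS DS sR in auto)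
      also have "\<dots> \<le> measure R ((\<Union>i. C i) - (\<Union>i<n. C i)) + measure R (\<Union>i<n. sym_diff (C i) (D i))"
        by (rule measure_Un_le) (use CS DS sR in auto)
      also have "measure R ((\<Union>i. C i) - (\<Union>i<n. C i)) = measure R (\<Union>i. C i) - measure R (\<Union>i<n. C i)"
        by (rule R.finite_measure_Diff) (use CS sR in auto)
      also have "measure R (\<Union>i<n. sym_diff (C i) (D i)) \<le> (\<Sum>i<n. measure R (sym_diff (C i) (D i)))"
        by (rule R.finite_measure_subadditive_finite) (use CS DS sR in auto)
      also have "\<dots> \<le> (\<Sum>i<n. \<delta>)" by (intro sum_mono less_imp_le DR)
      also have "\<dots> \<le> \<epsilon> / 2" using Union.prems by (simp add: \<delta>_def field_simps)
      finally show ?thesis using nR by linarith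
    qed
    show ?case using bound[OF \<open>finite_measure P\<close> sP n(1) D(2)] bound[OF \<open>finite_measure Q\<close> sQ n(2) D(3)] ER
      by blast
  qed
qed

section \<open>Absolute regularity as a total variation distance\<close>

context prob_space
begin

context
  fixes A B :: "'a measure"
  assumes A: "subalgebra M A" and B: "subalgebra M B"
begin

text \<open>The choice in \<open>family_ess_sup\<close> is resolved here once: existence turns it
  into a genuine dominating variable \<open>S\<close>, and only the properties listed are used
  afterwards.\<close>

lemma beta_mixing_ess_sup:
  obtains S where "S \<in> borel_measurable M" "AE \<omega> in M. 0 \<le> S \<omega> \<and> S \<omega> \<le> 1"
    "expectation S = beta_mixing M A B"
    "\<And>C. C \<in> sets A \<Longrightarrow> AE \<omega> in M. \<bar>real_cond_exp M B (indicator C) \<omega> - prob C\<bar> \<le> S \<omega>"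
proof -
  interpret finite_measure_subalgebra M B using B by unfold_locales
  define F where "F = {(\<lambda>\<omega>. \<bar>real_cond_exp M B (indicator C) \<omega> - prob C\<bar>) | C. C \<in> sets A}"
  have AM: "C \<in> sets A \<Longrightarrow> C \<in> sets M" for C using A by (auto simp: subalgebra_def)
  have b: "AE \<omega> in M. 0 \<le> f \<omega> \<and> f \<omega> \<le> 1" if "f \<in> F" for f
  proof -
    obtain C where C: "C \<in> sets A" "f = (\<lambda>\<omega>. \<bar>real_cond_exp M B (indicator C) \<omega> - prob C\<bar>)"
      using \<open>f \<in> F\<close> by (auto simp: F_def)
    have "integrable M (indicator C :: 'a \<Rightarrow> real)" using AM[OF C(1)]
      by (auto intro!: integrable_real_indicator simp: emeasure_eq_measure)
    then have "AE \<omega> in M. real_cond_exp M B (indicator C) \<omega> \<ge> 0" "AE \<omega> in M. real_cond_exp M B (indicator C) \<omega> \<le> 1"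
      by (intro real_cond_exp_ge_c real_cond_exp_le_c; auto simp: indicator_def)+
    then show ?thesis
    proof eventually_elim
      case (elim \<omega>)
      then show ?case using prob_le_1[of C] measure_nonneg[of M C] unfolding C(2) by linarith
    qed
  qed
  have FM: "F \<subseteq> borel_measurable M" by (auto simp: F_def)
  have Fe: "F \<noteq> {}" by (auto simp: F_def)
  define S where "S = family_ess_sup M F"
  have S: "is_family_ess_sup M F S"
    unfolding S_def family_ess_sup_def by (rule someI_ex[OF is_family_ess_sup_exists[OF Fe FM b]])
  have S1: "S \<in> borel_measurable M" using S by (simp add: is_family_ess_sup_def)
  have "AE \<omega> in M. S \<omega> \<le> 1"
  proof -
    have "\<forall>f\<in>F. AE \<omega> in M. f \<omega> \<le> 1" using b by (fastforce simp: eventually_conj_iff)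
    then show ?thesis using S by (auto simp: is_family_ess_sup_def)
  qed
  moreover have "AE \<omega> in M. 0 \<le> S \<omega>"
  proof -
    obtain f where f: "f \<in> F" using Fe by auto
    have "AE \<omega> in M. f \<omega> \<le> S \<omega>" using S f by (auto simp: is_family_ess_sup_def)
    with b[OF f] show ?thesis by eventually_elim auto
  qed
  moreover have "expectation S = beta_mixing M A B" by (simp add: S_def beta_mixing_def F_def)
  moreover have "AE \<omega> in M. \<bar>real_cond_exp M B (indicator C) \<omega> - prob C\<bar> \<le> S \<omega>" if "C \<in> sets A" for C
  proof -
    have "(\<lambda>\<omega>. \<bar>real_cond_exp M B (indicator C) \<omega> - prob C\<bar>) \<in> F" using that by (auto simp: F_def)
    then show ?thesis using S unfolding is_family_ess_sup_def by fast
  qed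
  ultimately show ?thesis using that[OF S1] by (auto simp: eventually_conj_iff)
qed

lemma beta_mixing_nonneg: "0 \<le> beta_mixing M A B"
  by (rule beta_mixing_ess_sup) (metis (mono_tags, lifting) AE_mp AE_I2 integral_nonneg_AE)

text \<open>After conditioning on \<open>B\<close>, the difference is the expectation of the sum
  over \<open>k\<close> of \<open>indicator (VB k)\<close> times a conditional deviation for
  \<open>UC k\<close>. The sets \<open>VB k\<close> partition the space, so at each point a single
  deviation survives and \<open>S\<close> bounds it; the number \<open>m\<close> of rectangles drops
  out.\<close>

lemma joint_law_rect_algebra:
  assumes U: "U \<in> measurable A N1" and V: "V \<in> measurable B N2" and D: "D \<in> rect_algebra N1 N2"
  shows "\<bar>measure (distr M (N1 \<Otimes>\<^sub>M N2) (\<lambda>\<omega>. (U \<omega>, V \<omega>))) D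
           - measure (distr M N1 U \<Otimes>\<^sub>M distr M N2 V) D\<bar> \<le> beta_mixing M A B"
proof -
  interpret finite_measure_subalgebra M B using B by unfold_locales
  obtain S where S [measurable]: "S \<in> borel_measurable M" and S01: "AE \<omega> in M. 0 \<le> S \<omega> \<and> S \<omega> \<le> 1"
    and ES: "expectation S = beta_mixing M A B"
    and Sb: "\<And>C. C \<in> sets A \<Longrightarrow> AE \<omega> in M. \<bar>real_cond_exp M B (indicator C) \<omega> - prob C\<bar> \<le> S \<omega>"
    by (rule beta_mixing_ess_sup) blast
  have iS: "integrable M S"
    by (rule integrable_const_bound[where B = 1]) (use S01 in \<open>auto elim: eventually_mono\<close>)
  obtain m :: nat and C \<pi> where \<pi>: "\<pi> \<in> measurable N2 (count_space UNIV)"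
     and \<pi>m: "\<And>v. v \<in> space N2 \<Longrightarrow> \<pi> v < m" and C: "\<And>k. C k \<in> sets N1"
     and D': "D = {z \<in> space N1 \<times> space N2. fst z \<in> C (\<pi> (snd z))}"
    using D unfolding rect_algebra_def by blast
  have UM [measurable]: "U \<in> measurable M N1" by (rule measurable_from_subalg[OF A U])
  have VM [measurable]: "V \<in> measurable M N2" by (rule measurable_from_subalg[OF B V])
  note [measurable] = \<pi>
  interpret U: prob_space "distr M N1 U" by (rule prob_space_distr) simp
  interpret V: prob_space "distr M N2 V" by (rule prob_space_distr) simp
  interpret UV: pair_prob_space "distr M N1 U" "distr M N2 V" ..
  interpret J: prob_space "distr M (N1 \<Otimes>\<^sub>M N2) (\<lambda>\<omega>. (U \<omega>, V \<omega>))"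
    by (rule prob_space_distr) simp
  define B' where "B' k = \<pi> -` {k} \<inter> space N2" for k
  have B' [measurable]: "B' k \<in> sets N2" for k unfolding B'_def by (rule measurable_sets[OF \<pi>]) auto
  note [measurable] = C
  define VB where "VB k = V -` B' k \<inter> space M" for k
  define UC where "UC k = U -` C k \<inter> space M" for k
  have VBB: "VB k \<in> sets B" for k using measurable_sets[OF V B'] B by (simp add: VB_def subalgebra_def)
  have UCA: "UC k \<in> sets A" for k using measurable_sets[OF U C] A by (simp add: UC_def subalgebra_def)
  have VBM [measurable]: "VB k \<in> sets M" and UCM [measurable]: "UC k \<in> sets M" for k
    by (simp_all add: VB_def UC_def)
  have DU: "D = (\<Union>k<m. C k \<times> B' k)"
    using sets.sets_into_space[OF C] \<pi>m by (auto simp: D' B'_def)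
  have disj: "disjoint_family_on (\<lambda>k. C k \<times> B' k) {..<m}"
    by (auto simp: disjoint_family_on_def B'_def)
  have 1: "measure (distr M (N1 \<Otimes>\<^sub>M N2) (\<lambda>\<omega>. (U \<omega>, V \<omega>))) D = (\<Sum>k<m. prob (UC k \<inter> VB k))"
    unfolding DU
  proof (subst J.finite_measure_finite_Union)
    have eq: "(\<lambda>\<omega>. (U \<omega>, V \<omega>)) -` (C k \<times> B' k) \<inter> space M = UC k \<inter> VB k" for k
      by (auto simp: UC_def VB_def)
    show "(\<Sum>k<m. measure (distr M (N1 \<Otimes>\<^sub>M N2) (\<lambda>\<omega>. (U \<omega>, V \<omega>))) (C k \<times> B' k)) = (\<Sum>k<m. prob (UC k \<inter> VB k))"
      by (intro sum.cong refl, subst measure_distr) (auto simp: eq)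
  qed (use disj in auto)
  have 2: "measure (distr M N1 U \<Otimes>\<^sub>M distr M N2 V) D = (\<Sum>k<m. prob (UC k) * prob (VB k))"
    unfolding DU
  proof (subst UV.finite_measure_finite_Union)
    show "(\<Sum>k<m. measure (distr M N1 U \<Otimes>\<^sub>M distr M N2 V) (C k \<times> B' k)) = (\<Sum>k<m. prob (UC k) * prob (VB k))"
      by (intro sum.cong refl) (simp add: measure_def V.emeasure_pair_measure_Times emeasure_distr
          enn2real_mult UC_def VB_def)
  qed (use disj in auto)
  have cov_eq: "prob (UC k \<inter> VB k) - prob (UC k) * prob (VB k)
      = expectation (\<lambda>\<omega>. indicator (VB k) \<omega> * (real_cond_exp M B (indicator (UC k)) \<omega> - prob (UC k)))" for k
  proof -
    have iU: "integrable M (indicator (UC k) :: 'a \<Rightarrow> real)"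
      by (auto intro!: integrable_real_indicator simp: emeasure_eq_measure)
    have "(LINT \<omega>:VB k|M. indicator (UC k) \<omega>) = (LINT \<omega>:VB k|M. real_cond_exp M B (indicator (UC k)) \<omega>)"
      by (rule real_cond_exp_intA[OF iU VBB])
    moreover have "(LINT \<omega>:VB k|M. indicator (UC k) \<omega>) = prob (UC k \<inter> VB k)"
    proof -
      have "(\<lambda>\<omega>. indicator (VB k) \<omega> *\<^sub>R indicator (UC k) \<omega>) = (indicator (UC k \<inter> VB k) :: 'a \<Rightarrow> real)"
        by (auto simp: indicator_def)
      then show ?thesis using sets.sets_into_space[OF UCM[of k]]
        by (simp add: set_lebesgue_integral_def Int_absorb1 Int_absorb2 le_infI1)
    qed
    moreover have "integrable M (\<lambda>\<omega>. indicator (VB k) \<omega> * real_cond_exp M B (indicator (UC k)) \<omega>)"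
      using integrable_mult_indicator[OF VBM real_cond_exp_int(1)[OF iU]] by simp
    moreover have "integrable M (\<lambda>\<omega>. indicator (VB k) \<omega> * prob (UC k))"
      by (auto intro!: integrable_real_indicator simp: emeasure_eq_measure)
    ultimately show ?thesis
      using sets.sets_into_space[OF VBM[of k]]
      by (simp add: set_lebesgue_integral_def right_diff_distrib Int_absorb2 Int_absorb1)
  qed
  have iterm: "integrable M (\<lambda>\<omega>. indicator (VB k) \<omega> * (real_cond_exp M B (indicator (UC k)) \<omega> - prob (UC k)))" for k
  proof -
    have iU: "integrable M (indicator (UC k) :: 'a \<Rightarrow> real)"
      by (auto intro!: integrable_real_indicator simp: emeasure_eq_measure)
    show ?thesis
      using integrable_mult_indicator[OF VBM, of "\<lambda>\<omega>. real_cond_exp M B (indicator (UC k)) \<omega> - prob (UC k)" k] real_cond_exp_int(1)[OF iU] by simp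
  qed
  have "AE \<omega> in M. \<forall>k\<in>{..<m}. \<bar>real_cond_exp M B (indicator (UC k)) \<omega> - prob (UC k)\<bar> \<le> S \<omega>"
    by (rule AE_finite_allI) (auto intro: Sb UCA)
  with S01 AE_space have key: "AE \<omega> in M. \<bar>\<Sum>k<m. indicator (VB k) \<omega> * (real_cond_exp M B (indicator (UC k)) \<omega> - prob (UC k))\<bar> \<le> S \<omega>"
  proof eventually_elim
    case (elim \<omega>)
    define j where "j = \<pi> (V \<omega>)"
    have Vs: "V \<omega> \<in> space N2" using elim(2) measurable_space[OF VM] by auto
    have j: "j < m" using \<pi>m[OF Vs] by (simp add: j_def)
    have "(\<Sum>k<m. indicator (VB k) \<omega> * (real_cond_exp M B (indicator (UC k)) \<omega> - prob (UC k)))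
       = (\<Sum>k<m. if k = j then (real_cond_exp M B (indicator (UC j)) \<omega> - prob (UC j)) else 0)"
      using elim(2) Vs by (intro sum.cong) (auto simp: VB_def B'_def j_def)
    also have "\<dots> = real_cond_exp M B (indicator (UC j)) \<omega> - prob (UC j)" using j by simp
    finally show ?case using elim j by simp
  qed
  have "\<bar>measure (distr M (N1 \<Otimes>\<^sub>M N2) (\<lambda>\<omega>. (U \<omega>, V \<omega>))) D - measure (distr M N1 U \<Otimes>\<^sub>M distr M N2 V) D\<bar>
    = \<bar>expectation (\<lambda>\<omega>. \<Sum>k<m. indicator (VB k) \<omega> * (real_cond_exp M B (indicator (UC k)) \<omega> - prob (UC k)))\<bar>"
    unfolding 1 2 sum_subtractf[symmetric] cov_eq using iterm by (subst Bochner_Integration.integral_sum) auto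
  also have "\<dots> \<le> expectation (\<lambda>\<omega>. \<bar>\<Sum>k<m. indicator (VB k) \<omega> * (real_cond_exp M B (indicator (UC k)) \<omega> - prob (UC k))\<bar>)"
    by (rule integral_abs_bound)
  also have "\<dots> \<le> expectation S"
    by (intro integral_mono_AE integrable_abs Bochner_Integration.integrable_sum iterm iS key)
  finally show ?thesis using ES by simp
qed

lemma joint_law_sets:
  assumes U: "U \<in> measurable A N1" and V: "V \<in> measurable B N2" and C: "C \<in> sets (N1 \<Otimes>\<^sub>M N2)"
  shows "\<bar>measure (distr M (N1 \<Otimes>\<^sub>M N2) (\<lambda>\<omega>. (U \<omega>, V \<omega>))) C
           - measure (distr M N1 U \<Otimes>\<^sub>M distr M N2 V) C\<bar> \<le> beta_mixing M A B"
proof (rule field_le_epsilon)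
  fix \<epsilon> :: real assume \<epsilon>: "0 < \<epsilon>"
  have UM [measurable]: "U \<in> measurable M N1" by (rule measurable_from_subalg[OF A U])
  have VM [measurable]: "V \<in> measurable M N2" by (rule measurable_from_subalg[OF B V])
  interpret U: prob_space "distr M N1 U" by (rule prob_space_distr) simp
  interpret V: prob_space "distr M N2 V" by (rule prob_space_distr) simp
  interpret UV: pair_prob_space "distr M N1 U" "distr M N2 V" ..
  let ?P = "distr M (N1 \<Otimes>\<^sub>M N2) (\<lambda>\<omega>. (U \<omega>, V \<omega>))" and ?Q = "distr M N1 U \<Otimes>\<^sub>M distr M N2 V"
  interpret P: prob_space ?P by (rule prob_space_distr) simp
  have sQ: "sets ?Q = sets (N1 \<Otimes>\<^sub>M N2)" by (intro sets_pair_measure_cong) auto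
  obtain D where D: "D \<in> rect_algebra N1 N2" "measure ?P (sym_diff C D) < \<epsilon>/2" "measure ?Q (sym_diff C D) < \<epsilon>/2"
    using rect_algebra_approx[of ?P ?Q N1 N2 C "\<epsilon>/2"] sQ C \<epsilon> P.finite_measure_axioms UV.finite_measure_axioms by auto
  have diff: "\<bar>measure R C - measure R D\<bar> \<le> measure R (sym_diff C D)" if "finite_measure R" "sets R = sets (N1 \<Otimes>\<^sub>M N2)" for R
  proof -
    interpret R: finite_measure R by fact
    have CR: "C \<in> sets R" "D \<in> sets R" using C rect_algebra_sets[OF D(1)] that by auto
    have "measure R C \<le> measure R (D \<union> sym_diff C D)" "measure R D \<le> measure R (C \<union> sym_diff C D)"
      using CR by (auto intro!: R.finite_measure_mono)
    moreover have "measure R (D \<union> sym_diff C D) \<le> measure R D + measure R (sym_diff C D)"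
      "measure R (C \<union> sym_diff C D) \<le> measure R C + measure R (sym_diff C D)"
      using CR by (auto intro!: measure_Un_le)
    ultimately show ?thesis by linarith
  qed
  have "\<bar>measure ?P D - measure ?Q D\<bar> \<le> beta_mixing M A B" by (rule joint_law_rect_algebra[OF U V D(1)])
  with diff[of ?P] diff[of ?Q] D(2,3) sQ P.finite_measure_axioms UV.finite_measure_axioms
  show "\<bar>measure ?P C - measure ?Q C\<bar> \<le> beta_mixing M A B + \<epsilon>" by auto
qed

text \<open>Both orders of iterated integration are provided, because the variable of the inner
  integral will lie in the future in one application and in the past in another.\<close>

lemma joint_law_integral:
  fixes \<Phi> :: "'b \<Rightarrow> 'c \<Rightarrow> real"
  assumes U: "U \<in> measurable A N1" and V: "V \<in> measurable B N2"
    and \<Phi>: "(\<lambda>(u, v). \<Phi> u v) \<in> borel_measurable (N1 \<Otimes>\<^sub>M N2)" and bnd: "\<And>u v. \<bar>\<Phi> u v\<bar> \<le> 1"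
  shows "\<bar>expectation (\<lambda>\<omega>. \<Phi> (U \<omega>) (V \<omega>)) - (LINT \<omega>|M. LINT \<omega>'|M. \<Phi> (U \<omega>) (V \<omega>'))\<bar> \<le> 2 * beta_mixing M A B"
    and "\<bar>expectation (\<lambda>\<omega>. \<Phi> (U \<omega>) (V \<omega>)) - (LINT \<omega>'|M. LINT \<omega>|M. \<Phi> (U \<omega>) (V \<omega>'))\<bar> \<le> 2 * beta_mixing M A B"
proof -
  have UM [measurable]: "U \<in> measurable M N1" by (rule measurable_from_subalg[OF A U])
  have VM [measurable]: "V \<in> measurable M N2" by (rule measurable_from_subalg[OF B V])
  note \<Phi> [measurable]
  interpret U: prob_space "distr M N1 U" by (rule prob_space_distr) simp
  interpret V: prob_space "distr M N2 V" by (rule prob_space_distr) simp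
  interpret UV: pair_prob_space "distr M N1 U" "distr M N2 V" ..
  interpret MM: pair_prob_space M M ..
  let ?P = "distr M (N1 \<Otimes>\<^sub>M N2) (\<lambda>\<omega>. (U \<omega>, V \<omega>))" and ?Q = "distr M N1 U \<Otimes>\<^sub>M distr M N2 V"
  interpret P: prob_space ?P by (rule prob_space_distr) simp
  have sQ: "sets ?Q = sets (N1 \<Otimes>\<^sub>M N2)" by (intro sets_pair_measure_cong) auto
  \<comment> \<open>Rescaling from \<open>[-1, 1]\<close> to \<open>[0, 1]\<close> produces the
    factor 2.\<close>
  define f where "f z = (1 + (\<lambda>(u, v). \<Phi> u v) z) / 2" for z
  have f: "f \<in> borel_measurable (N1 \<Otimes>\<^sub>M N2)" unfolding f_def[abs_def] by measurable
  have fP: "f \<in> borel_measurable ?P" using f by simp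
  have fQ: "f \<in> borel_measurable ?Q" using f measurable_cong_sets[OF sQ refl] by blast
  have f01: "0 \<le> f z" "f z \<le> 1" for z using bnd[of "fst z" "snd z"] by (auto simp: f_def split: prod.splits)
  have iP: "integrable ?P f" by (rule P.integrable_const_bound[where B = 1]) (use f01 fP in auto)
  have iQ: "integrable ?Q f" by (rule UV.integrable_const_bound[where B = 1]) (use f01 fQ in auto)
  have main: "\<bar>(LINT x|?P. f x) - (LINT x|?Q. f x)\<bar> \<le> beta_mixing M A B"
    by (rule tv_integral_le) (use joint_law_sets[OF U V] sQ f01 fP P.prob_space_axioms UV.prob_space_axioms in auto)
  have e1: "(LINT x|?P. f x) = (1 + expectation (\<lambda>\<omega>. \<Phi> (U \<omega>) (V \<omega>))) / 2"
  proof -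
    have "integrable M (\<lambda>\<omega>. \<Phi> (U \<omega>) (V \<omega>))"
      by (rule integrable_const_bound[where B = 1]) (use bnd in auto)
    then show ?thesis by (subst integral_distr[OF _ f]) (auto simp: f_def prob_space)
  qed
  have iMM: "integrable (M \<Otimes>\<^sub>M M) (\<lambda>z. \<Phi> (U (fst z)) (V (snd z)))"
    by (rule MM.integrable_const_bound[where B = 1]) (use bnd in auto)
  have dd: "?Q = distr (M \<Otimes>\<^sub>M M) (N1 \<Otimes>\<^sub>M N2) (\<lambda>(x, y). (U x, V y))"
    by (rule pair_measure_distr) (auto intro: V.sigma_finite_measure_axioms)
  have e2: "(LINT x|?Q. f x) = (1 + (LINT z|(M \<Otimes>\<^sub>M M). \<Phi> (U (fst z)) (V (snd z)))) / 2"
    unfolding dd by (subst integral_distr[OF _ f]) (auto simp: f_def MM.P.prob_space case_prod_beta iMM MM.prob_space)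
  have e3: "(LINT z|(M \<Otimes>\<^sub>M M). \<Phi> (U (fst z)) (V (snd z))) = (LINT \<omega>|M. LINT \<omega>'|M. \<Phi> (U \<omega>) (V \<omega>'))"
    using MM.integral_fst'[OF iMM] by simp
  have e4: "(LINT z|(M \<Otimes>\<^sub>M M). \<Phi> (U (fst z)) (V (snd z))) = (LINT \<omega>'|M. LINT \<omega>|M. \<Phi> (U \<omega>) (V \<omega>'))"
    using MM.integral_snd[of "\<lambda>x y. \<Phi> (U x) (V y)"] iMM by (simp add: case_prod_beta')
  show "\<bar>expectation (\<lambda>\<omega>. \<Phi> (U \<omega>) (V \<omega>)) - (LINT \<omega>|M. LINT \<omega>'|M. \<Phi> (U \<omega>) (V \<omega>'))\<bar> \<le> 2 * beta_mixing M A B"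
    using main unfolding e1 e2 e3 by (simp add: diff_divide_distrib[symmetric] abs_divide)
  show "\<bar>expectation (\<lambda>\<omega>. \<Phi> (U \<omega>) (V \<omega>)) - (LINT \<omega>'|M. LINT \<omega>|M. \<Phi> (U \<omega>) (V \<omega>'))\<bar> \<le> 2 * beta_mixing M A B"
    using main unfolding e1 e2 e4 by (simp add: diff_divide_distrib[symmetric] abs_divide)
qed

end
end

section \<open>Kernels of near epoch dependent sequences\<close>

text \<open>The strict inequality makes this a Borel set: on either side of the level set of
  \<open>g\<close> it is cut out by a union of open balls. The supremum over closed balls in the
  variation condition dominates its indicator.\<close>

definition unstable :: "(real \<Rightarrow> real \<Rightarrow> real) \<Rightarrow> real \<Rightarrow> real \<Rightarrow> (real \<times> real) set" where
  "unstable g t \<epsilon> = {z. \<exists>w. dist w z < \<epsilon> \<and> h_ker g (fst w) (snd w) t \<noteq> h_ker g (fst z) (snd z) t}"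

lemma h_ker_bounds [simp]: "0 \<le> h_ker g x y t" "h_ker g x y t \<le> 1"
  by (simp_all add: h_ker_def)

lemma h_ker_if: "h_ker g x y t = (if g x y \<le> t then 1 else 0)"
  by (simp add: h_ker_def)

lemma unstable_borel:
  assumes "(\<lambda>(x, y). g x y) \<in> borel_measurable borel"
  shows "unstable g t \<epsilon> \<in> sets borel"
proof -
  define A where "A = {z. g (fst z) (snd z) \<le> t}"
  have g: "(\<lambda>z. g (fst z) (snd z)) \<in> borel_measurable borel" using assms by (simp add: case_prod_beta')
  have A: "A \<in> sets borel" unfolding A_def using borel_measurable_le[OF g borel_measurable_const[of t]] by simp
  have eq: "unstable g t \<epsilon> = {z. \<exists>w. dist w z < \<epsilon> \<and> (w \<in> A) \<noteq> (z \<in> A)}"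
    unfolding unstable_def A_def h_ker_if by auto
  have "unstable g t \<epsilon> = (A \<inter> (\<Union>w\<in>-A. ball w \<epsilon>)) \<union> (- A \<inter> (\<Union>w\<in>A. ball w \<epsilon>))"
    unfolding eq ball_def by blast
  moreover have "open (\<Union>w\<in>-A. ball w \<epsilon>)" "open (\<Union>w\<in>A. ball w \<epsilon>)" by auto
  ultimately show ?thesis using A by auto
qed

lemma (in prob_space) subalgebra_generated_algebra:
  assumes "\<And>i. Z i \<in> borel_measurable M"
  shows "subalgebra M (generated_algebra M Z I)"
proof -
  have "(\<Union>i\<in>I. {Z i -` B \<inter> space M | B. B \<in> sets borel}) \<subseteq> sets M"
    using assms by (auto simp: measurable_sets)
  moreover from this have "(\<Union>i\<in>I. {Z i -` B \<inter> space M | B. B \<in> sets borel}) \<subseteq> Pow (space M)"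
    using sets.space_closed by blast
  ultimately show ?thesis
    unfolding subalgebra_def generated_algebra_def
    by (simp add: space_measure_of sets_measure_of sets.sigma_sets_subset)
qed

lemma (in prob_space) expectation_indicator_eq:
  assumes "{\<omega> \<in> space M. P \<omega>} \<in> events"
  shows "expectation (\<lambda>\<omega>. of_bool (P \<omega>) :: real) = prob {\<omega> \<in> space M. P \<omega>}"
proof -
  have "expectation (\<lambda>\<omega>. of_bool (P \<omega>) :: real) = expectation (indicator {\<omega> \<in> space M. P \<omega>})"
    by (rule Bochner_Integration.integral_cong) (auto simp: indicator_def)
  also have "\<dots> = prob {\<omega> \<in> space M. P \<omega>}"
    using sets.sets_into_space[OF assms] by (simp add: Int_absorb2)
  finally show ?thesis .
qed

lemma generated_algebra_measurable:
  assumes "i \<in> I"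
  shows "Z i \<in> borel_measurable (generated_algebra M Z I)"
proof -
  have sub: "(\<Union>i\<in>I. {Z i -` B \<inter> space M | B. B \<in> sets borel}) \<subseteq> Pow (space M)" by auto
  show ?thesis
  proof (rule measurableI)
    fix B :: "real set" assume "B \<in> sets borel"
    then have "Z i -` B \<inter> space M \<in> (\<Union>i\<in>I. {Z i -` B \<inter> space M | B. B \<in> sets borel})" using assms by auto
    then show "Z i -` B \<inter> space (generated_algebra M Z I) \<in> sets (generated_algebra M Z I)"
      unfolding generated_algebra_def by (auto simp: space_measure_of[OF sub] sets_measure_of[OF sub])
  qed auto
qed

lemma h_ker_mono: "s \<le> t \<Longrightarrow> h_ker g x y s \<le> h_ker g x y t"
  by (simp add: h_ker_if)

section \<open>Elementary inequalities and series\<close>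

lemma dist_prod_le: "dist (x, y) (x', y') \<le> \<bar>x - x'\<bar> + \<bar>y - y'\<bar>" for x y x' y' :: real
  using real_sqrt_sum_squares_triangle_ineq[of "x - x'" 0 0 "y - y'"] by (simp add: dist_prod_def dist_real_def)

lemma abs_diff_le_one: "0 \<le> x \<Longrightarrow> x \<le> 1 \<Longrightarrow> 0 \<le> y \<Longrightarrow> y \<le> 1 \<Longrightarrow> \<bar>x - y\<bar> \<le> 1" for x y :: real
  by linarith

lemma abs_mult_le_one: "\<bar>x\<bar> \<le> 1 \<Longrightarrow> \<bar>y\<bar> \<le> 1 \<Longrightarrow> \<bar>x * y\<bar> \<le> 1" for x y :: real
  using mult_mono[of "\<bar>x\<bar>" 1 "\<bar>y\<bar>" 1] by (simp add: abs_mult)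

lemma prod_diff_le:
  fixes x y x' y' :: real
  assumes "\<bar>y\<bar> \<le> 1" "\<bar>x'\<bar> \<le> 1"
  shows "\<bar>x * y - x' * y'\<bar> \<le> \<bar>x - x'\<bar> + \<bar>y - y'\<bar>"
proof -
  have "\<bar>x * y - x' * y'\<bar> = \<bar>(x - x') * y + x' * (y - y')\<bar>" by (simp add: algebra_simps)
  also have "\<dots> \<le> \<bar>x - x'\<bar> * \<bar>y\<bar> + \<bar>x'\<bar> * \<bar>y - y'\<bar>" by (metis abs_mult abs_triangle_ineq)
  also have "\<dots> \<le> \<bar>x - x'\<bar> * 1 + 1 * \<bar>y - y'\<bar>" using assms by (intro add_mono mult_mono) auto
  finally show ?thesis by simp
qed

lemma sq_le_one: "\<bar>x\<bar> \<le> 1 \<Longrightarrow> x\<^sup>2 \<le> 1" for x :: real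
  using abs_le_square_iff[of x 1] by simp

lemma sum_sq_le:
  fixes x :: "'b \<Rightarrow> real"
  assumes "finite A"
  shows "(\<Sum>i\<in>A. x i)\<^sup>2 \<le> real (card A) * (\<Sum>i\<in>A. (x i)\<^sup>2)"
  using Cauchy_Schwarz_ineq_sum[of "\<lambda>_. 1" x A] by simp

lemma sum_pairs_sym:
  fixes F :: "int \<Rightarrow> int \<Rightarrow> real"
  assumes "\<And>i j. F i j = F j i"
  shows "(\<Sum>i\<in>{1..int n}. \<Sum>j\<in>{1..int n}. F i j) = 2 * (\<Sum>i\<in>{1..int n}. \<Sum>j\<in>{i<..int n}. F i j) + (\<Sum>i\<in>{1..int n}. F i i)"
proof (induction n)
  case (Suc n)
  have I: "{1..int (Suc n)} = insert (int n + 1) {1..int n}" by auto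
  have J: "(\<Sum>j\<in>{i<..int (Suc n)}. F i j) = F i (int n + 1) + (\<Sum>j\<in>{i<..int n}. F i j)" if "i \<in> {1..int n}" for i
  proof -
    have "{i<..int (Suc n)} = insert (int n + 1) {i<..int n}" using that by auto
    then show ?thesis by simp
  qed
  have E: "{int n + 1<..int (Suc n)} = {}" by auto
  have "(\<Sum>i\<in>{1..int (Suc n)}. \<Sum>j\<in>{i<..int (Suc n)}. F i j) = (\<Sum>i\<in>{1..int n}. \<Sum>j\<in>{i<..int (Suc n)}. F i j)"
    unfolding I using E by simp
  also have "\<dots> = (\<Sum>i\<in>{1..int n}. F i (int n + 1) + (\<Sum>j\<in>{i<..int n}. F i j))"
    by (intro sum.cong refl J)
  also have "\<dots> = (\<Sum>i\<in>{1..int n}. F i (int n + 1)) + (\<Sum>i\<in>{1..int n}. \<Sum>j\<in>{i<..int n}. F i j)"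
    by (rule sum.distrib)
  finally have 1: "(\<Sum>i\<in>{1..int (Suc n)}. \<Sum>j\<in>{i<..int (Suc n)}. F i j) = (\<Sum>i\<in>{1..int n}. F i (int n + 1)) + (\<Sum>i\<in>{1..int n}. \<Sum>j\<in>{i<..int n}. F i j)" .
  have 2: "(\<Sum>j\<in>{1..int n}. F (int n + 1) j) = (\<Sum>i\<in>{1..int n}. F i (int n + 1))" by (intro sum.cong refl assms)
  show ?case unfolding 1 unfolding I using Suc 2 by (simp add: sum.distrib)
qed simp

lemma summable_split3:
  fixes F :: "nat \<Rightarrow> real"
  assumes nn: "\<And>n. 0 \<le> F n" and "summable (\<lambda>n. F (3 * n))" "summable (\<lambda>n. F (3 * n + 1))" "summable (\<lambda>n. F (3 * n + 2))"
  shows "summable F"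
proof (rule summableI_nonneg_bounded[where x = "suminf (\<lambda>n. F (3 * n)) + suminf (\<lambda>n. F (3 * n + 1)) + suminf (\<lambda>n. F (3 * n + 2))"])
  fix n
  have "(\<Sum>i<n. F i) \<le> (\<Sum>i<3 * n. F i)" by (intro sum_mono2) (auto simp: nn)
  also have "\<dots> = (\<Sum>i<n. F (3 * i)) + (\<Sum>i<n. F (3 * i + 1)) + (\<Sum>i<n. F (3 * i + 2))"
  proof (induction n)
    case (Suc n)
    have "3 * Suc n = Suc (Suc (Suc (3 * n)))" by simp
    then have "(\<Sum>i<3 * Suc n. F i) = (\<Sum>i<3 * n. F i) + F (3 * n) + F (3 * n + 1) + F (3 * n + 2)"
      by (simp only: sum.lessThan_Suc) simp
    then show ?case using Suc by simp
  qed simp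
  also have "\<dots> \<le> suminf (\<lambda>n. F (3 * n)) + suminf (\<lambda>n. F (3 * n + 1)) + suminf (\<lambda>n. F (3 * n + 2))"
    by (intro add_mono sum_le_suminf assms) (auto simp: nn)
  finally show "(\<Sum>i<n. F i) \<le> \<dots>" .
qed (rule nn)

lemma summable_power_gap: "summable (\<lambda>m. real m / real (m div 3) ^ 6)"
proof -
  have "(\<lambda>m. real m / real (m div 3) ^ 6) \<in> O(\<lambda>m. 1 / real m ^ 2)"
  \<comment> \<open>For \<open>3 \<le> m\<close> one has \<open>m \<le> 6 * (m div 3)\<close>,
    whence the constant.\<close>
  proof (rule bigoI[where c = "6 ^ 6"])
    show "\<forall>\<^sub>F m in sequentially. norm (real m / real (m div 3) ^ 6) \<le> 6 ^ 6 * norm (1 / real m ^ 2)"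
      using eventually_ge_at_top[of 3]
    proof eventually_elim
      case (elim m)
      have "q * 3 + r = m \<Longrightarrow> r < 3 \<Longrightarrow> m \<le> 6 * q \<and> 0 < q" for q r :: nat using elim by arith
      from this[OF div_mult_mod_eq mod_less_divisor] have d: "m \<le> 6 * (m div 3)" "0 < m div 3" by auto
      then have "real m \<le> 6 * real (m div 3)" by (metis of_nat_le_iff of_nat_mult of_nat_numeral)
      then have "real m ^ 6 \<le> (6 * real (m div 3)) ^ 6" by (rule power_mono) simp
      then have 1: "real m ^ 6 \<le> 6 ^ 6 * real (m div 3) ^ 6" by (simp add: power_mult_distrib)
      have "real m * real m ^ 2 \<le> real m ^ 6" using elim power_increasing[of 3 6 "real m"] by (simp add: power3_eq_cube power2_eq_square)
      with 1 have "real m * real m ^ 2 \<le> 6 ^ 6 * real (m div 3) ^ 6" by linarith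
      then show ?case using d elim by (simp add: field_simps)
    qed
  qed
  then show ?thesis by (rule summable_comparison_test_bigo[rotated]) (use inverse_power_summable[of 2, where 'a = real] in \<open>simp add: inverse_eq_divide\<close>)
qed

lemma (in prob_space) integrable_bounded:
  fixes F :: "'a \<Rightarrow> real"
  assumes "F \<in> borel_measurable M" "\<And>\<omega>. \<bar>F \<omega>\<bar> \<le> B"
  shows "integrable M F"
  by (rule integrable_const_bound[where B = B]) (use assms in auto)

lemma (in prob_space) expectation_prod_diff:
  fixes F G F' G' :: "'a \<Rightarrow> real"
  assumes [measurable]: "F \<in> borel_measurable M" "G \<in> borel_measurable M" "F' \<in> borel_measurable M" "G' \<in> borel_measurable M"
    and b: "\<And>\<omega>. \<bar>F \<omega>\<bar> \<le> 1" "\<And>\<omega>. \<bar>G \<omega>\<bar> \<le> 1" "\<And>\<omega>. \<bar>F' \<omega>\<bar> \<le> 1" "\<And>\<omega>. \<bar>G' \<omega>\<bar> \<le> 1"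
    and d: "expectation (\<lambda>\<omega>. \<bar>F \<omega> - F' \<omega>\<bar>) \<le> \<delta>" "expectation (\<lambda>\<omega>. \<bar>G \<omega> - G' \<omega>\<bar>) \<le> \<delta>'"
  shows "expectation (\<lambda>\<omega>. \<bar>F \<omega> * G \<omega> - F' \<omega> * G' \<omega>\<bar>) \<le> \<delta> + \<delta>'"
proof -
  have i: "integrable M F" "integrable M G" "integrable M F'" "integrable M G'"
    by (rule integrable_bounded[where B = 1], measurable, rule b)+
  have "integrable M (\<lambda>\<omega>. F \<omega> * G \<omega>)" "integrable M (\<lambda>\<omega>. F' \<omega> * G' \<omega>)"
    by (rule integrable_bounded[where B = 1], measurable, intro abs_mult_le_one b)+
  then have "expectation (\<lambda>\<omega>. \<bar>F \<omega> * G \<omega> - F' \<omega> * G' \<omega>\<bar>) \<le> expectation (\<lambda>\<omega>. \<bar>F \<omega> - F' \<omega>\<bar> + \<bar>G \<omega> - G' \<omega>\<bar>)"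
    using i by (intro integral_mono prod_diff_le b) auto
  also have "\<dots> = expectation (\<lambda>\<omega>. \<bar>F \<omega> - F' \<omega>\<bar>) + expectation (\<lambda>\<omega>. \<bar>G \<omega> - G' \<omega>\<bar>)"
    using i by (intro Bochner_Integration.integral_add) auto
  finally show ?thesis using d by linarith
qed

text \<open>The hypotheses in the quantitative form in which they are used: \<open>C\<close> absorbs
  the near epoch rate at the threshold \<open>1 / l ^ 6\<close>, and \<open>T\<close> collects
  levels at which the variation bound holds with the common constant \<open>L\<close>.\<close>

locale ned_kernel = prob_space M for M :: "'a measure" +
  fixes X Z :: "int \<Rightarrow> 'a \<Rightarrow> real" and f :: "nat \<Rightarrow> (int \<Rightarrow> real) \<Rightarrow> real"
    and g :: "real \<Rightarrow> real \<Rightarrow> real" and T :: "real set" and C L :: real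
  assumes stat: "strictly_stationary M (\<lambda>i \<omega>. (X i \<omega>, Z i \<omega>))"
    and f_meas: "\<And>l. 1 \<le> l \<Longrightarrow> f l \<in> borel_measurable (PiM {- int l..int l} (\<lambda>_. borel))"
    and approx0: "\<And>l. 1 \<le> l \<Longrightarrow>
      prob {\<omega> \<in> space M. 1 / real l ^ 6 < \<bar>X 0 \<omega> - f l (\<lambda>i\<in>{- int l..int l}. Z i \<omega>)\<bar>} \<le> C / real l ^ 6"
    and g_sym: "\<And>x y. g x y = g y x"
    and g_meas: "(\<lambda>(x, y). g x y) \<in> borel_measurable borel"
    and variation: "\<And>t \<epsilon>. t \<in> T \<Longrightarrow> 0 < \<epsilon> \<Longrightarrow> measure (pair_law M X) (unstable g t \<epsilon>) \<le> L * \<epsilon>"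
    and C_nonneg: "0 \<le> C" and L_nonneg: "0 \<le> L"
    and beta_summable: "summable (\<lambda>k. real k * beta_coeff M Z k)"
begin

section \<open>Consequences of stationarity\<close>

lemma X_meas [measurable]: "X i \<in> borel_measurable M"
  and Z_meas [measurable]: "Z i \<in> borel_measurable M"
proof -
  have "(\<lambda>\<omega>. (X i \<omega>, Z i \<omega>)) \<in> borel_measurable M" using stat by (auto simp: strictly_stationary_def)
  then have *: "(\<lambda>\<omega>. (X i \<omega>, Z i \<omega>)) \<in> measurable M (borel \<Otimes>\<^sub>M borel)" by (simp add: borel_prod)
  show "X i \<in> borel_measurable M" using measurable_compose[OF * measurable_fst] by simp
  show "Z i \<in> borel_measurable M" using measurable_compose[OF * measurable_snd] by simp
qed

abbreviation XZ :: "int \<Rightarrow> 'a \<Rightarrow> real \<times> real" where "XZ i \<omega> \<equiv> (X i \<omega>, Z i \<omega>)"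

text \<open>Stationarity is used for the pairs \<open>XZ\<close>, since a shift of indices must move
  the kernel, built from \<open>X\<close>, and its approximants, built from \<open>Z\<close>,
  together.\<close>

lemma expectation_shift:
  fixes \<Phi> :: "(int \<Rightarrow> real \<times> real) \<Rightarrow> real"
  assumes "\<Phi> \<in> borel_measurable (PiM UNIV (\<lambda>_. borel))"
  shows "expectation (\<lambda>\<omega>. \<Phi> (\<lambda>i. XZ (i + k) \<omega>)) = expectation (\<lambda>\<omega>. \<Phi> (\<lambda>i. XZ i \<omega>))"
proof -
  have m: "(\<lambda>\<omega> i. XZ (i + k) \<omega>) \<in> measurable M (PiM UNIV (\<lambda>_. borel))" for k
    by (rule measurable_PiM_single') (auto simp: borel_prod[symmetric] space_pair_measure)
  from m[of 0] have m0: "(\<lambda>\<omega> i. XZ i \<omega>) \<in> measurable M (PiM UNIV (\<lambda>_. borel))" by simp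
  have "expectation (\<lambda>\<omega>. \<Phi> (\<lambda>i. XZ (i + k) \<omega>)) = integral\<^sup>L (distr M (PiM UNIV (\<lambda>_. borel)) (\<lambda>\<omega> i. XZ (i + k) \<omega>)) \<Phi>"
    using assms m by (simp add: integral_distr)
  also have "\<dots> = integral\<^sup>L (distr M (PiM UNIV (\<lambda>_. borel)) (\<lambda>\<omega> i. XZ i \<omega>)) \<Phi>"
    using stat by (simp add: strictly_stationary_def)
  also have "\<dots> = expectation (\<lambda>\<omega>. \<Phi> (\<lambda>i. XZ i \<omega>))"
    using assms m0 by (simp add: integral_distr)
  finally show ?thesis .
qed

lemma coord_meas [measurable]:
  "(\<lambda>v. fst (v i)) \<in> borel_measurable (PiM UNIV (\<lambda>_::int. borel :: (real \<times> real) measure))"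
  "(\<lambda>v. snd (v i)) \<in> borel_measurable (PiM UNIV (\<lambda>_::int. borel :: (real \<times> real) measure))"
proof -
  have "(\<lambda>v. v i) \<in> measurable (PiM UNIV (\<lambda>_::int. borel :: (real \<times> real) measure)) borel" by measurable
  then have "(\<lambda>v. v i) \<in> measurable (PiM UNIV (\<lambda>_::int. borel :: (real \<times> real) measure)) (borel \<Otimes>\<^sub>M borel)"
    by (simp add: borel_prod)
  from measurable_compose[OF this measurable_fst] measurable_compose[OF this measurable_snd]
  show "(\<lambda>v. fst (v i)) \<in> borel_measurable (PiM UNIV (\<lambda>_::int. borel :: (real \<times> real) measure))"
    "(\<lambda>v. snd (v i)) \<in> borel_measurable (PiM UNIV (\<lambda>_::int. borel :: (real \<times> real) measure))" by auto
qed

lemma h_ker_meas [measurable (raw)]: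
  assumes "u \<in> borel_measurable N" "v \<in> borel_measurable N" "w \<in> borel_measurable N"
  shows "(\<lambda>x. h_ker g (u x) (v x) (w x)) \<in> borel_measurable N"
proof -
  have "(\<lambda>x. (u x, v x)) \<in> measurable N borel"
    using measurable_Pair[OF assms(1,2)] by (simp add: borel_prod)
  from measurable_compose[OF this g_meas] assms(3) have "{x \<in> space N. g (u x) (v x) \<le> w x} \<in> sets N"
    by (simp add: borel_measurable_le)
  then show ?thesis unfolding h_ker_if by measurable
qed

lemma g_meas' [measurable (raw)]:
  assumes "u \<in> borel_measurable N" "v \<in> borel_measurable N"
  shows "(\<lambda>x. g (u x) (v x)) \<in> borel_measurable N"
proof -
  have "(\<lambda>x. (u x, v x)) \<in> measurable N borel"
    using measurable_Pair[OF assms(1,2)] by (simp add: borel_prod)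
  from measurable_compose[OF this g_meas] show ?thesis by simp
qed

definition Y :: "nat \<Rightarrow> int \<Rightarrow> 'a \<Rightarrow> real" where
  "Y l i \<omega> = f l (\<lambda>j\<in>{- int l..int l}. Z (i + j) \<omega>)"

lemma Y_generated:
  assumes "1 \<le> l" "{i - int l..i + int l} \<subseteq> I"
  shows "Y l i \<in> borel_measurable (generated_algebra M Z I)"
  unfolding Y_def[abs_def]
proof (rule measurable_compose[OF _ f_meas[OF assms(1)]], rule measurable_restrict)
  fix j assume "j \<in> {- int l..int l}"
  then show "Z (i + j) \<in> borel_measurable (generated_algebra M Z I)"
    by (intro generated_algebra_measurable) (use assms(2) in \<open>auto simp: subset_iff\<close>)
qed

lemma subalg: "subalgebra M (generated_algebra M Z I)"
  by (rule subalgebra_generated_algebra) simp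

lemma Y_meas: "1 \<le> l \<Longrightarrow> Y l i \<in> borel_measurable M"
  by (rule measurable_from_subalg[OF subalg[of UNIV] Y_generated]) auto

lemma f_coord_meas [measurable (raw)]:
  assumes "1 \<le> l"
  shows "(\<lambda>v. f l (\<lambda>j\<in>{- int l..int l}. snd (v (i + j)))) \<in> borel_measurable (PiM UNIV (\<lambda>_::int. borel :: (real \<times> real) measure))"
  by (rule measurable_compose[OF _ f_meas[OF assms]], rule measurable_restrict) measurable

lemma expectation_shift_XY:
  fixes F :: "real \<times> real \<times> real \<times> real \<Rightarrow> real"
  assumes l: "1 \<le> l" and F: "F \<in> borel_measurable (borel \<Otimes>\<^sub>M borel \<Otimes>\<^sub>M borel \<Otimes>\<^sub>M borel)"
  shows "expectation (\<lambda>\<omega>. F (X (i + c) \<omega>, X (j + c) \<omega>, Y l (i + c) \<omega>, Y l (j + c) \<omega>))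
       = expectation (\<lambda>\<omega>. F (X i \<omega>, X j \<omega>, Y l i \<omega>, Y l j \<omega>))"
proof -
  note F [measurable] f_coord_meas[OF l, measurable]
  let ?\<Phi> = "\<lambda>v. F (fst (v i), fst (v j), f l (\<lambda>k\<in>{- int l..int l}. snd (v (i + k))), f l (\<lambda>k\<in>{- int l..int l}. snd (v (j + k))))"
  have "?\<Phi> \<in> borel_measurable (PiM UNIV (\<lambda>_::int. borel :: (real \<times> real) measure))" by measurable
  from expectation_shift[OF this, of c] show ?thesis by (simp add: Y_def ac_simps)
qed

lemma expectation_shift_X3:
  fixes F :: "real \<Rightarrow> real \<Rightarrow> real \<Rightarrow> real"
  assumes [measurable]: "(\<lambda>(x, y, z). F x y z) \<in> borel_measurable (borel \<Otimes>\<^sub>M borel \<Otimes>\<^sub>M borel)"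
  shows "expectation (\<lambda>\<omega>. F (X (i + c) \<omega>) (X (j + c) \<omega>) (X (k + c) \<omega>)) = expectation (\<lambda>\<omega>. F (X i \<omega>) (X j \<omega>) (X k \<omega>))"
proof -
  let ?\<Phi> = "\<lambda>v. (\<lambda>(x, y, z). F x y z) (fst (v i), fst (v j), fst (v k))"
  have "?\<Phi> \<in> borel_measurable (PiM UNIV (\<lambda>_::int. borel :: (real \<times> real) measure))" by measurable
  from expectation_shift[OF this, of c] show ?thesis by simp
qed

lemma law_X: "distr M borel (X i) = distr M borel (X 0)"
proof (rule measure_eqI)
  fix A assume "A \<in> sets (distr M borel (X i))"
  then have A [measurable]: "A \<in> sets borel" by simp
  have "expectation (\<lambda>\<omega>. indicator A (X (0 + i) \<omega>)) = expectation (\<lambda>\<omega>. indicator A (X 0 \<omega>) :: real)"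
    by (rule expectation_shift_X3[where F = "\<lambda>x y z. indicator A x" and j = 0 and k = 0]) measurable
  moreover have "expectation (\<lambda>\<omega>. indicator A (X k \<omega>)) = prob (X k -` A \<inter> space M)" for k
    using expectation_indicator_eq[of "\<lambda>\<omega>. X k \<omega> \<in> A"]
    by (simp add: indicator_def vimage_def Int_def conj_commute)
  ultimately show "emeasure (distr M borel (X i)) A = emeasure (distr M borel (X 0)) A"
    by (simp add: emeasure_distr emeasure_eq_measure)
qed simp

lemma prob_far:
  assumes l: "1 \<le> l"
  shows "prob {\<omega> \<in> space M. 1 / real l ^ 6 < \<bar>X i \<omega> - Y l i \<omega>\<bar>} \<le> C / real l ^ 6"
proof -
  note [measurable] = Y_meas[OF l]
  let ?F = "\<lambda>(x, x', y, y'). indicator {z. 1 / real l ^ 6 < \<bar>z\<bar>} (x - y) :: real"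
  have [measurable]: "{z :: real. 1 / real l ^ 6 < \<bar>z\<bar>} \<in> sets borel" by measurable
  have "expectation (\<lambda>\<omega>. ?F (X (0 + i) \<omega>, X (0 + i) \<omega>, Y l (0 + i) \<omega>, Y l (0 + i) \<omega>)) = expectation (\<lambda>\<omega>. ?F (X 0 \<omega>, X 0 \<omega>, Y l 0 \<omega>, Y l 0 \<omega>))"
    by (rule expectation_shift_XY[OF l]) measurable
  moreover have "expectation (\<lambda>\<omega>. ?F (X k \<omega>, X k \<omega>, Y l k \<omega>, Y l k \<omega>)) = prob {\<omega> \<in> space M. 1 / real l ^ 6 < \<bar>X k \<omega> - Y l k \<omega>\<bar>}" for k
    using expectation_indicator_eq[of "\<lambda>\<omega>. 1 / real l ^ 6 < \<bar>X k \<omega> - Y l k \<omega>\<bar>"]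
    by (simp add: indicator_def)
  moreover have "prob {\<omega> \<in> space M. 1 / real l ^ 6 < \<bar>X 0 \<omega> - Y l 0 \<omega>\<bar>} \<le> C / real l ^ 6"
    using approx0[OF l] by (simp add: Y_def)
  ultimately show ?thesis by simp
qed

section \<open>Independent copies and the replacement of \<open>X\<close> by
  \<open>Y\<close>\<close>

sublocale MM: pair_prob_space M M ..

text \<open>An independent copy is realised on \<open>M \<Otimes>\<^sub>M M\<close> by evaluating
  \<open>X i\<close> and \<open>X k\<close> at different coordinates; as all marginals have the same
  law, the result does not depend on the indices.\<close>

lemma pair_law_prob:
  assumes [measurable]: "S \<in> sets borel"
  shows "measure (M \<Otimes>\<^sub>M M) {z \<in> space (M \<Otimes>\<^sub>M M). (X i (fst z), X k (snd z)) \<in> S} = measure (pair_law M X) S"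
proof -
  interpret X0: prob_space "distr M borel (X 0)" by (rule prob_space_distr) simp
  have "pair_law M X = distr M borel (X i) \<Otimes>\<^sub>M distr M borel (X k)"
    unfolding pair_law_def law_X[of i] law_X[of k] ..
  also have "\<dots> = distr (M \<Otimes>\<^sub>M M) (borel \<Otimes>\<^sub>M borel) (\<lambda>(x, y). (X i x, X k y))"
    by (rule pair_measure_distr) (auto simp: law_X[of k] intro: X0.sigma_finite_measure_axioms)
  finally have "pair_law M X = distr (M \<Otimes>\<^sub>M M) (borel \<Otimes>\<^sub>M borel) (\<lambda>(x, y). (X i x, X k y))" .
  moreover have "S \<in> sets (borel \<Otimes>\<^sub>M borel)" unfolding borel_prod by (rule assms)
  ultimately show ?thesis
    by (simp add: measure_distr vimage_def Int_def case_prod_beta' conj_commute)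
qed

lemma measure_fst_snd:
  assumes [measurable]: "A \<in> sets M"
  shows "measure (M \<Otimes>\<^sub>M M) {z \<in> space (M \<Otimes>\<^sub>M M). fst z \<in> A} = prob A"
    "measure (M \<Otimes>\<^sub>M M) {z \<in> space (M \<Otimes>\<^sub>M M). snd z \<in> A} = prob A"
proof -
  have "{z \<in> space (M \<Otimes>\<^sub>M M). fst z \<in> A} = A \<times> space M" "{z \<in> space (M \<Otimes>\<^sub>M M). snd z \<in> A} = space M \<times> A"
    using sets.sets_into_space[OF assms] by (auto simp: space_pair_measure)
  then show "measure (M \<Otimes>\<^sub>M M) {z \<in> space (M \<Otimes>\<^sub>M M). fst z \<in> A} = prob A"
    "measure (M \<Otimes>\<^sub>M M) {z \<in> space (M \<Otimes>\<^sub>M M). snd z \<in> A} = prob A"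
    by (simp_all add: measure_def emeasure_pair_measure_Times emeasure_space_1)
qed

text \<open>The first-order projection of the kernel before centring: \<open>h1\<close> is
  \<open>H\<close> minus the constant \<open>U_fun\<close>.\<close>

definition H :: "real \<Rightarrow> real \<Rightarrow> real" where
  "H t x = (LINT \<omega>|M. h_ker g x (X 0 \<omega>) t)"

lemma H_meas [measurable]: "H t \<in> borel_measurable borel"
  unfolding H_def[abs_def] by measurable

lemma integrable_h_ker [simp]:
  assumes [measurable]: "u \<in> borel_measurable M" "v \<in> borel_measurable M"
  shows "integrable M (\<lambda>\<omega>. h_ker g (u \<omega>) (v \<omega>) t)"
  by (rule integrable_const_bound[where B = 1]) auto

lemma H_bounds [simp]: "0 \<le> H t x" "H t x \<le> 1"
proof -
  show "0 \<le> H t x" unfolding H_def by (rule integral_nonneg_AE) simp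
  show "H t x \<le> 1" unfolding H_def by (rule integral_le_const) auto
qed

lemma H_eq: "H t x = (LINT \<omega>|M. h_ker g x (X k \<omega>) t)"
  unfolding H_def
  using expectation_shift_X3[where F = "\<lambda>y _ _. h_ker g x y t" and i = 0 and j = 0 and k = 0 and c = k]
  by simp

text \<open>Two far events cost \<open>C / l ^ 6\<close> each, and instability at radius
  \<open>3 / l ^ 6\<close> costs \<open>3 * L / l ^ 6\<close>.\<close>

abbreviation \<eta> :: "nat \<Rightarrow> real" where "\<eta> l \<equiv> (2 * C + 3 * L) / real l ^ 6"

lemma pair_measurable:
  assumes "u \<in> borel_measurable N" "v \<in> borel_measurable N"
  shows "{z \<in> space N. (u z, v z) \<in> unstable g t \<epsilon>} \<in> sets N"
proof -
  have "(\<lambda>x. (u x, v x)) \<in> measurable N borel"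
    using measurable_Pair[OF assms] by (simp add: borel_prod)
  from measurable_sets[OF this unstable_borel[OF g_meas]] show ?thesis
    by (simp add: vimage_def Int_def conj_commute)
qed

definition far :: "nat \<Rightarrow> int \<Rightarrow> 'a set" where
  "far l i = {\<omega> \<in> space M. 1 / real l ^ 6 < \<bar>X i \<omega> - Y l i \<omega>\<bar>}"

text \<open>Off this set either coordinate of the pair may be switched from \<open>X\<close> to
  \<open>Y\<close> without changing the kernel. The two switches move the point by at most
  \<open>2 / l ^ 6\<close>; radius 3 provides the strict inequality in
  \<open>unstable\<close>.\<close>

definition Bad :: "real \<Rightarrow> nat \<Rightarrow> int \<Rightarrow> int \<Rightarrow> ('a \<times> 'a) set" where
  "Bad t l i k = {z \<in> space (M \<Otimes>\<^sub>M M). fst z \<in> far l i} \<union> {z \<in> space (M \<Otimes>\<^sub>M M). snd z \<in> far l k}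
     \<union> {z \<in> space (M \<Otimes>\<^sub>M M). (X i (fst z), X k (snd z)) \<in> unstable g t (3 / real l ^ 6)}"

context
  fixes l :: nat and t :: real
  assumes l: "1 \<le> l" and t: "t \<in> T"
begin

lemma Y_meas_l [measurable]: "Y l i \<in> borel_measurable M"
  by (rule Y_meas[OF l])

lemma far_sets [measurable]: "far l i \<in> events"
  unfolding far_def by measurable

lemma far_prob: "prob (far l i) \<le> C / real l ^ 6"
  unfolding far_def by (rule prob_far[OF l])

lemma notfar: "\<omega> \<in> space M \<Longrightarrow> \<omega> \<notin> far l i \<Longrightarrow> \<bar>X i \<omega> - Y l i \<omega>\<bar> \<le> 1 / real l ^ 6"
  by (simp add: far_def)

lemma lpos: "0 < 1 / real l ^ 6"
  using l by simp

lemma unstable_X_prob: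
  assumes "0 < \<epsilon>"
  shows "measure (M \<Otimes>\<^sub>M M) {z \<in> space (M \<Otimes>\<^sub>M M). (X i (fst z), X k (snd z)) \<in> unstable g t \<epsilon>} \<le> L * \<epsilon>"
  using variation[OF t assms] pair_law_prob[OF unstable_borel[OF g_meas]] by simp

lemma Bad_sets: "Bad t l i k \<in> sets (M \<Otimes>\<^sub>M M)"
  unfolding Bad_def by (intro sets.Un pair_measurable) measurable

lemma Bad_prob: "measure (M \<Otimes>\<^sub>M M) (Bad t l i k) \<le> \<eta> l"
proof -
  let ?N = "M \<Otimes>\<^sub>M M"
  let ?A = "{z \<in> space ?N. fst z \<in> far l i}" and ?B = "{z \<in> space ?N. snd z \<in> far l k}"
    and ?U = "{z \<in> space ?N. (X i (fst z), X k (snd z)) \<in> unstable g t (3 / real l ^ 6)}"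
  have U: "?U \<in> sets ?N" by (intro pair_measurable) measurable
  have "measure ?N (Bad t l i k) \<le> measure ?N (?A \<union> ?B) + measure ?N ?U"
    unfolding Bad_def by (rule measure_Un_le) (use U in measurable)
  also have "measure ?N (?A \<union> ?B) \<le> measure ?N ?A + measure ?N ?B"
    by (rule measure_Un_le) measurable
  also have "measure ?N ?A + measure ?N ?B + measure ?N ?U \<le> C / real l ^ 6 + C / real l ^ 6 + L * (3 / real l ^ 6)"
    by (intro add_mono unstable_X_prob) (use far_prob lpos in \<open>auto simp: measure_fst_snd\<close>)
  also have "\<dots> = \<eta> l" by (simp add: add_divide_distrib)
  finally show ?thesis by simp
qed

lemma stable:
  assumes "(\<omega>, \<omega>') \<in> space (M \<Otimes>\<^sub>M M)" "(\<omega>, \<omega>') \<notin> Bad t l i k"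
    and "x = X i \<omega> \<or> x = Y l i \<omega>" "y = X k \<omega>' \<or> y = Y l k \<omega>'"
  shows "h_ker g x y t = h_ker g (X i \<omega>) (X k \<omega>') t"
proof -
  have sp: "\<omega> \<in> space M" "\<omega>' \<in> space M" using assms(1) by (auto simp: space_pair_measure)
  have nf: "\<bar>X i \<omega> - Y l i \<omega>\<bar> \<le> 1 / real l ^ 6" "\<bar>X k \<omega>' - Y l k \<omega>'\<bar> \<le> 1 / real l ^ 6"
    using notfar sp assms(1,2) by (auto simp: Bad_def)
  have "dist (x, y) (X i \<omega>, X k \<omega>') \<le> \<bar>x - X i \<omega>\<bar> + \<bar>y - X k \<omega>'\<bar>" by (rule dist_prod_le)
  also have "\<dots> \<le> 1 / real l ^ 6 + 1 / real l ^ 6"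
    using assms(3,4) nf lpos by (intro add_mono) (auto simp: abs_minus_commute)
  also have "\<dots> < 3 / real l ^ 6" using lpos by (simp add: divide_strict_right_mono)
  finally have "dist (x, y) (X i \<omega>, X k \<omega>') < 3 / real l ^ 6" .
  moreover have "(X i \<omega>, X k \<omega>') \<notin> unstable g t (3 / real l ^ 6)" using assms(1,2) by (auto simp: Bad_def)
  ultimately show ?thesis unfolding unstable_def by force
qed

lemma nested_integral_Bad:
  assumes [measurable]: "(\<lambda>(x, y). D x y) \<in> borel_measurable (M \<Otimes>\<^sub>M M)"
    and D01: "\<And>x y. 0 \<le> D x y" "\<And>x y. D x y \<le> 1"
    and D0: "\<And>x y. (x, y) \<in> space (M \<Otimes>\<^sub>M M) \<Longrightarrow> (x, y) \<notin> Bad t l i k \<Longrightarrow> D x y = 0"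
  shows "(LINT x|M. LINT y|M. D x y) \<le> \<eta> l" "integrable M (\<lambda>x. LINT y|M. D x y)"
proof -
  have iMM: "integrable (M \<Otimes>\<^sub>M M) (\<lambda>(x, y). D x y)"
    by (rule MM.integrable_const_bound[where B = 1]) (use D01 in auto)
  have "(LINT x|M. LINT y|M. D x y) = (LINT z|(M \<Otimes>\<^sub>M M). (\<lambda>(x, y). D x y) z)"
    using MM.integral_fst'[OF iMM] by simp
  also have "\<dots> \<le> (LINT z|(M \<Otimes>\<^sub>M M). indicator (Bad t l i k) z)"
  proof (rule integral_mono[OF iMM])
    show "integrable (M \<Otimes>\<^sub>M M) (indicator (Bad t l i k) :: _ \<Rightarrow> real)"
      using Bad_sets by (auto intro!: integrable_real_indicator simp: MM.emeasure_eq_measure)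
  qed (use D01 D0 in \<open>auto simp: indicator_def\<close>)
  also have "\<dots> = measure (M \<Otimes>\<^sub>M M) (Bad t l i k)"
    using sets.sets_into_space[OF Bad_sets] by (simp add: Int_absorb2)
  finally show "(LINT x|M. LINT y|M. D x y) \<le> \<eta> l" using Bad_prob[of i k] by linarith
  show "integrable M (\<lambda>x. LINT y|M. D x y)"
    using MM.integrable_fst'[OF iMM] by simp
qed

text \<open>\<open>H\<close> averages over an independent copy, so this comparison takes place under
  the product law and no mixing coefficient appears.\<close>

lemma H_approx:
  "expectation (\<lambda>\<omega>. \<bar>H t (X i \<omega>) - H t (Y l i \<omega>)\<bar>) \<le> \<eta> l"
proof -
  let ?D = "\<lambda>x y. \<bar>h_ker g (X i x) (X i y) t - h_ker g (Y l i x) (X i y) t\<bar>"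
  have m: "(\<lambda>(x, y). ?D x y) \<in> borel_measurable (M \<Otimes>\<^sub>M M)" by measurable
  have b: "?D x y \<le> 1" for x y
    using h_ker_bounds[of g "X i x" "X i y" t] h_ker_bounds[of g "Y l i x" "X i y" t] by linarith
  have z: "?D x y = 0" if "(x, y) \<in> space (M \<Otimes>\<^sub>M M)" "(x, y) \<notin> Bad t l i i" for x y
    using stable[OF that, of "Y l i x" "X i y"] by simp
  have *: "\<bar>H t (X i \<omega>) - H t (Y l i \<omega>)\<bar> \<le> (LINT y|M. ?D \<omega> y)" for \<omega>
  proof -
    have "H t (X i \<omega>) - H t (Y l i \<omega>) = (LINT y|M. h_ker g (X i \<omega>) (X i y) t - h_ker g (Y l i \<omega>) (X i y) t)"
      unfolding H_eq[of t _ i] by (subst Bochner_Integration.integral_diff) auto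
    then show ?thesis using integral_abs_bound[of M "\<lambda>y. h_ker g (X i \<omega>) (X i y) t - h_ker g (Y l i \<omega>) (X i y) t"] by simp
  qed
  have "expectation (\<lambda>\<omega>. \<bar>H t (X i \<omega>) - H t (Y l i \<omega>)\<bar>) \<le> (LINT x|M. LINT y|M. ?D x y)"
    using * nested_integral_Bad(2)[OF m _ b z]
    by (intro integral_mono_AE' AE_I2) auto
  also have "\<dots> \<le> \<eta> l" by (rule nested_integral_Bad(1)[OF m _ b z]) auto
  finally show ?thesis .
qed

text \<open>With \<open>X k\<close> in place of \<open>Y l k\<close> the inner integral would vanish
  by the definition of \<open>H\<close>; the approximants are degenerate up to the cost of that
  switch.\<close>

lemma degenerate_approx:
  "(LINT \<omega>|M. \<bar>LINT \<omega>'|M. h_ker g (Y l i \<omega>) (Y l k \<omega>') t - H t (Y l i \<omega>)\<bar>) \<le> \<eta> l"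
proof -
  let ?D = "\<lambda>x y. \<bar>h_ker g (Y l i x) (Y l k y) t - h_ker g (Y l i x) (X k y) t\<bar>"
  have m: "(\<lambda>(x, y). ?D x y) \<in> borel_measurable (M \<Otimes>\<^sub>M M)" by measurable
  have b: "?D x y \<le> 1" for x y
    using h_ker_bounds[of g "Y l i x" "Y l k y" t] h_ker_bounds[of g "Y l i x" "X k y" t] by linarith
  have z: "?D x y = 0" if "(x, y) \<in> space (M \<Otimes>\<^sub>M M)" "(x, y) \<notin> Bad t l i k" for x y
    using stable[OF that, of "Y l i x" "X k y"] stable[OF that, of "Y l i x" "Y l k y"] by simp
  have *: "\<bar>LINT \<omega>'|M. h_ker g (Y l i \<omega>) (Y l k \<omega>') t - H t (Y l i \<omega>)\<bar> \<le> (LINT y|M. ?D \<omega> y)" for \<omega>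
  proof -
    have "(LINT \<omega>'|M. h_ker g (Y l i \<omega>) (Y l k \<omega>') t - H t (Y l i \<omega>)) = (LINT y|M. h_ker g (Y l i \<omega>) (Y l k y) t - h_ker g (Y l i \<omega>) (X k y) t)"
      unfolding H_eq[of t _ k] by (subst (1 2) Bochner_Integration.integral_diff) (auto simp: prob_space)
    then show ?thesis using integral_abs_bound[of M "\<lambda>y. h_ker g (Y l i \<omega>) (Y l k y) t - h_ker g (Y l i \<omega>) (X k y) t"] by simp
  qed
  have "(LINT \<omega>|M. \<bar>LINT \<omega>'|M. h_ker g (Y l i \<omega>) (Y l k \<omega>') t - H t (Y l i \<omega>)\<bar>) \<le> (LINT x|M. LINT y|M. ?D x y)"
    using * nested_integral_Bad(2)[OF m _ b z]
    by (intro integral_mono_AE' AE_I2) auto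
  also have "\<dots> \<le> \<eta> l" by (rule nested_integral_Bad(1)[OF m _ b z]) auto
  finally show ?thesis .
qed

text \<open>When neither coordinate is far, the pair of \<open>Y\<close> lies within
  \<open>2 / l ^ 6\<close> of the pair of \<open>X\<close>. A change of value between the pair of
  \<open>Y\<close> and a point within \<open>3 / l ^ 6\<close> of it then shows, at one of these two
  points, as a change within \<open>6 / l ^ 6\<close> of the pair of \<open>X\<close>.\<close>

lemma unstable_Y_prob:
  "measure (M \<Otimes>\<^sub>M M) {z \<in> space (M \<Otimes>\<^sub>M M). (Y l i (fst z), Y l k (snd z)) \<in> unstable g t (3 / real l ^ 6)}
     \<le> (2 * C + 6 * L) / real l ^ 6"
proof -
  let ?N = "M \<Otimes>\<^sub>M M"
  let ?A = "{z \<in> space ?N. fst z \<in> far l i}" and ?B = "{z \<in> space ?N. snd z \<in> far l k}"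
    and ?U = "{z \<in> space ?N. (X i (fst z), X k (snd z)) \<in> unstable g t (6 / real l ^ 6)}"
    and ?V = "{z \<in> space ?N. (Y l i (fst z), Y l k (snd z)) \<in> unstable g t (3 / real l ^ 6)}"
  have U: "?U \<in> sets ?N" by (intro pair_measurable) measurable
  have "?V \<subseteq> ?A \<union> ?B \<union> ?U"
  proof
    fix z assume z: "z \<in> ?V"
    show "z \<in> ?A \<union> ?B \<union> ?U"
    proof (rule ccontr)
      assume n: "z \<notin> ?A \<union> ?B \<union> ?U"
      have sp: "fst z \<in> space M" "snd z \<in> space M" using z by (auto simp: space_pair_measure)
      have nf: "\<bar>X i (fst z) - Y l i (fst z)\<bar> \<le> 1 / real l ^ 6" "\<bar>X k (snd z) - Y l k (snd z)\<bar> \<le> 1 / real l ^ 6"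
        using notfar sp z n by auto
      let ?x = "(X i (fst z), X k (snd z))" and ?y = "(Y l i (fst z), Y l k (snd z))"
      obtain w where w: "dist w ?y < 3 / real l ^ 6" "h_ker g (fst w) (snd w) t \<noteq> h_ker g (fst ?y) (snd ?y) t"
        using z by (auto simp: unstable_def)
      have yx: "dist ?y ?x \<le> 2 / real l ^ 6"
        using dist_prod_le[of "Y l i (fst z)" "Y l k (snd z)" "X i (fst z)" "X k (snd z)"] nf
        by (simp add: abs_minus_commute)
      moreover have "2 / real l ^ 6 < 6 / real l ^ 6" "3 / real l ^ 6 + 2 / real l ^ 6 < 6 / real l ^ 6"
        using lpos by (simp_all add: add_divide_distrib[symmetric] divide_strict_right_mono)
      ultimately have "dist ?y ?x < 6 / real l ^ 6" "dist w ?x < 6 / real l ^ 6"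
        using dist_triangle[of w ?x ?y] w(1) by linarith+
      moreover have "?x \<notin> unstable g t (6 / real l ^ 6)" using n z by auto
      ultimately have "h_ker g (fst w) (snd w) t = h_ker g (fst ?x) (snd ?x) t"
        "h_ker g (fst ?y) (snd ?y) t = h_ker g (fst ?x) (snd ?x) t"
        unfolding unstable_def by blast+
      then show False using w(2) by simp
    qed
  qed
  then have "measure ?N ?V \<le> measure ?N (?A \<union> ?B \<union> ?U)"
    by (rule MM.finite_measure_mono) (use U in measurable)
  also have "\<dots> \<le> measure ?N (?A \<union> ?B) + measure ?N ?U"
    by (rule measure_Un_le) (use U in measurable)
  also have "measure ?N (?A \<union> ?B) \<le> measure ?N ?A + measure ?N ?B"
    by (rule measure_Un_le) measurable
  also have "measure ?N ?A + measure ?N ?B + measure ?N ?U \<le> C / real l ^ 6 + C / real l ^ 6 + L * (6 / real l ^ 6)"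
    by (intro add_mono unstable_X_prob) (use far_prob lpos in \<open>auto simp: measure_fst_snd\<close>)
  also have "\<dots> = (2 * C + 6 * L) / real l ^ 6" by (simp add: add_divide_distrib)
  finally show ?thesis by simp
qed

end

section \<open>Decoupling and kernels of dependent pairs\<close>

abbreviation \<beta> :: "nat \<Rightarrow> real" where "\<beta> \<equiv> beta_coeff M Z"

lemma beta_nonneg: "0 \<le> \<beta> k"
  unfolding beta_coeff_def by (rule beta_mixing_nonneg[OF subalg subalg])

lemma decouple:
  fixes \<Phi> :: "'b \<Rightarrow> 'c \<Rightarrow> real"
  assumes "U \<in> measurable (generated_algebra M Z {..0}) N1" "V \<in> measurable (generated_algebra M Z {int k..}) N2"
    and "(\<lambda>(u, v). \<Phi> u v) \<in> borel_measurable (N1 \<Otimes>\<^sub>M N2)" "\<And>u v. \<bar>\<Phi> u v\<bar> \<le> 1"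
  shows "\<bar>expectation (\<lambda>\<omega>. \<Phi> (U \<omega>) (V \<omega>)) - (LINT \<omega>|M. LINT \<omega>'|M. \<Phi> (U \<omega>) (V \<omega>'))\<bar> \<le> 2 * \<beta> k"
    and "\<bar>expectation (\<lambda>\<omega>. \<Phi> (U \<omega>) (V \<omega>)) - (LINT \<omega>'|M. LINT \<omega>|M. \<Phi> (U \<omega>) (V \<omega>'))\<bar> \<le> 2 * \<beta> k"
  unfolding beta_coeff_def
  by (rule joint_law_integral[OF subalg subalg assms])+

text \<open>Away from the far events the kernel at \<open>X\<close> and at \<open>Y\<close> can
  differ only if the pair of \<open>Y\<close> is unstable. That is an event about two windows of
  \<open>Z\<close> separated by \<open>m - 2 * l\<close>, so decoupling reduces its probability to
  the product law.\<close>

lemma kernel_approx_less: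
  assumes m: "3 \<le> m" and t: "t \<in> T" and ij: "i + int m \<le> j"
  defines "l \<equiv> m div 3"
  shows "expectation (\<lambda>\<omega>. \<bar>h_ker g (X i \<omega>) (X j \<omega>) t - h_ker g (Y l i \<omega>) (Y l j \<omega>) t\<bar>)
    \<le> (4 * C + 6 * L) / real l ^ 6 + 2 * \<beta> (m - 2 * l)"
proof -
  have l: "1 \<le> l" using m by (simp add: l_def)
  have gap: "2 * l \<le> m" by (simp add: l_def)
  note [measurable] = Y_meas_l[OF l t] far_sets[OF l t]
  define c where "c = - i - int l"
  define k where "k = j + c"
  have i': "i + c = - int l" by (simp add: c_def)
  have k: "int (m - 2 * l) \<le> k - int l" using ij gap by (simp add: k_def c_def of_nat_diff)
  let ?F = "\<lambda>(x, x', y, y'). \<bar>h_ker g x x' t - h_ker g y y' t\<bar>"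
  have "expectation (\<lambda>\<omega>. ?F (X (i + c) \<omega>, X (j + c) \<omega>, Y l (i + c) \<omega>, Y l (j + c) \<omega>))
      = expectation (\<lambda>\<omega>. ?F (X i \<omega>, X j \<omega>, Y l i \<omega>, Y l j \<omega>))"
    by (rule expectation_shift_XY[OF l]) measurable
  then have eq: "expectation (\<lambda>\<omega>. \<bar>h_ker g (X i \<omega>) (X j \<omega>) t - h_ker g (Y l i \<omega>) (Y l j \<omega>) t\<bar>)
    = expectation (\<lambda>\<omega>. \<bar>h_ker g (X (- int l) \<omega>) (X k \<omega>) t - h_ker g (Y l (- int l) \<omega>) (Y l k \<omega>) t\<bar>)"
    by (simp add: i' k_def)
  let ?i = "- int l"
  let ?S = "unstable g t (3 / real l ^ 6)"
  have US: "(\<lambda>(u, v). indicator ?S (u, v) :: real) \<in> borel_measurable (borel \<Otimes>\<^sub>M borel)"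
    using unstable_borel[OF g_meas] by (simp add: borel_prod)
  have "Y l ?i \<in> borel_measurable (generated_algebra M Z {..0})" by (rule Y_generated[OF l]) auto
  moreover have "Y l k \<in> borel_measurable (generated_algebra M Z {int (m - 2 * l)..})"
    by (rule Y_generated[OF l]) (use k in auto)
  ultimately have D: "\<bar>expectation (\<lambda>\<omega>. indicator ?S (Y l ?i \<omega>, Y l k \<omega>)) - (LINT \<omega>|M. LINT \<omega>'|M. indicator ?S (Y l ?i \<omega>, Y l k \<omega>'))\<bar> \<le> 2 * \<beta> (m - 2 * l)"
    by (rule decouple(1)[where \<Phi> = "\<lambda>u v. indicator ?S (u, v)", OF _ _ US]) (auto simp: indicator_def)
  have SY: "{z \<in> space (M \<Otimes>\<^sub>M M). (Y l ?i (fst z), Y l k (snd z)) \<in> ?S} \<in> sets (M \<Otimes>\<^sub>M M)"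
    by (rule pair_measurable) measurable
  have SY1: "{\<omega> \<in> space M. (Y l ?i \<omega>, Y l k \<omega>) \<in> ?S} \<in> sets M"
    by (rule pair_measurable) measurable
  have "(LINT \<omega>|M. LINT \<omega>'|M. indicator ?S (Y l ?i \<omega>, Y l k \<omega>') :: real) = (LINT z|(M \<Otimes>\<^sub>M M). indicator ?S (Y l ?i (fst z), Y l k (snd z)))"
  proof -
    have "integrable (M \<Otimes>\<^sub>M M) (\<lambda>z. indicator ?S (Y l ?i (fst z), Y l k (snd z)) :: real)"
    proof (rule MM.integrable_const_bound[where B = 1])
      have "(\<lambda>z. indicator ?S (Y l ?i (fst z), Y l k (snd z)) :: real) = (\<lambda>z. (\<lambda>(u, v). indicator ?S (u, v)) (Y l ?i (fst z), Y l k (snd z)))" by simp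
      also have "\<dots> \<in> borel_measurable (M \<Otimes>\<^sub>M M)" using US by measurable
      finally show "(\<lambda>z. indicator ?S (Y l ?i (fst z), Y l k (snd z)) :: real) \<in> borel_measurable (M \<Otimes>\<^sub>M M)" .
    qed (auto simp: indicator_def)
    from MM.integral_fst'[OF this] show ?thesis by simp
  qed
  also have "\<dots> = measure (M \<Otimes>\<^sub>M M) {z \<in> space (M \<Otimes>\<^sub>M M). (Y l ?i (fst z), Y l k (snd z)) \<in> ?S}"
    using MM.expectation_indicator_eq[OF SY] by (simp add: indicator_def)
  also have "\<dots> \<le> (2 * C + 6 * L) / real l ^ 6" by (rule unstable_Y_prob[OF l t])
  finally have S1: "expectation (\<lambda>\<omega>. indicator ?S (Y l ?i \<omega>, Y l k \<omega>)) \<le> (2 * C + 6 * L) / real l ^ 6 + 2 * \<beta> (m - 2 * l)"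
    using D by linarith
  have iS: "integrable M (\<lambda>\<omega>. indicator ?S (Y l ?i \<omega>, Y l k \<omega>) :: real)"
  proof -
    have "integrable M (\<lambda>\<omega>. indicator {\<omega> \<in> space M. (Y l ?i \<omega>, Y l k \<omega>) \<in> ?S} \<omega> :: real)"
      using SY1 by (auto intro!: integrable_real_indicator simp: emeasure_eq_measure)
    then show ?thesis
      by (rule Bochner_Integration.integrable_cong[THEN iffD1, rotated -1]) (auto simp: indicator_def)
  qed
  have iF: "integrable M (indicator (far l i) :: 'a \<Rightarrow> real)" for i
    by (auto intro!: integrable_real_indicator simp: emeasure_eq_measure)
  have "expectation (\<lambda>\<omega>. \<bar>h_ker g (X ?i \<omega>) (X k \<omega>) t - h_ker g (Y l ?i \<omega>) (Y l k \<omega>) t\<bar>)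
    \<le> expectation (\<lambda>\<omega>. indicator (far l ?i) \<omega> + indicator (far l k) \<omega> + indicator ?S (Y l ?i \<omega>, Y l k \<omega>))"
  proof (rule integral_mono_AE')
    show "integrable M (\<lambda>\<omega>. indicator (far l ?i) \<omega> + indicator (far l k) \<omega> + indicator ?S (Y l ?i \<omega>, Y l k \<omega>) :: real)"
      using iS iF by simp
    show "AE \<omega> in M. \<bar>h_ker g (X ?i \<omega>) (X k \<omega>) t - h_ker g (Y l ?i \<omega>) (Y l k \<omega>) t\<bar>
       \<le> indicator (far l ?i) \<omega> + indicator (far l k) \<omega> + indicator ?S (Y l ?i \<omega>, Y l k \<omega>)"
    proof (rule AE_I2)
      fix \<omega> assume sp: "\<omega> \<in> space M"
      have b: "\<bar>h_ker g (X ?i \<omega>) (X k \<omega>) t - h_ker g (Y l ?i \<omega>) (Y l k \<omega>) t\<bar> \<le> 1"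
        using h_ker_bounds[of g "X ?i \<omega>" "X k \<omega>" t] h_ker_bounds[of g "Y l ?i \<omega>" "Y l k \<omega>" t] by linarith
      show "\<bar>h_ker g (X ?i \<omega>) (X k \<omega>) t - h_ker g (Y l ?i \<omega>) (Y l k \<omega>) t\<bar>
       \<le> indicator (far l ?i) \<omega> + indicator (far l k) \<omega> + indicator ?S (Y l ?i \<omega>, Y l k \<omega>)"
      proof (cases "\<omega> \<in> far l ?i \<or> \<omega> \<in> far l k \<or> (Y l ?i \<omega>, Y l k \<omega>) \<in> ?S")
        case True
        then show ?thesis using b by (auto simp: indicator_def)
      next
        case False
        have "dist (X ?i \<omega>, X k \<omega>) (Y l ?i \<omega>, Y l k \<omega>) \<le> 1 / real l ^ 6 + 1 / real l ^ 6"
          using dist_prod_le notfar[OF l t sp] False by (intro order_trans[OF dist_prod_le] add_mono) auto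
        also have "\<dots> < 3 / real l ^ 6" using lpos[OF l t] by (simp add: divide_strict_right_mono)
        finally have "h_ker g (X ?i \<omega>) (X k \<omega>) t = h_ker g (Y l ?i \<omega>) (Y l k \<omega>) t"
          using False unfolding unstable_def by force
        then show ?thesis by simp
      qed
    qed
  qed auto
  also have "\<dots> = prob (far l ?i) + prob (far l k) + expectation (\<lambda>\<omega>. indicator ?S (Y l ?i \<omega>, Y l k \<omega>))"
    using iS iF sets.sets_into_space[OF far_sets[OF l t]] by (simp add: Int_absorb2)
  also have "\<dots> \<le> C / real l ^ 6 + C / real l ^ 6 + ((2 * C + 6 * L) / real l ^ 6 + 2 * \<beta> (m - 2 * l))"
    by (intro add_mono far_prob[OF l t] S1)
  also have "\<dots> = (4 * C + 6 * L) / real l ^ 6 + 2 * \<beta> (m - 2 * l)" by (simp add: add_divide_distrib)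
  finally show ?thesis unfolding eq .
qed

lemma kernel_approx:
  assumes m: "3 \<le> m" and t: "t \<in> T" and ij: "int m \<le> \<bar>i - j\<bar>"
  defines "l \<equiv> m div 3"
  shows "expectation (\<lambda>\<omega>. \<bar>h_ker g (X i \<omega>) (X j \<omega>) t - h_ker g (Y l i \<omega>) (Y l j \<omega>) t\<bar>)
    \<le> (4 * C + 6 * L) / real l ^ 6 + 2 * \<beta> (m - 2 * l)"
proof (cases "i \<le> j")
  case True
  then show ?thesis using kernel_approx_less[OF m t, of i j] ij unfolding l_def by simp
next
  case False
  have "h_ker g x y t = h_ker g y x t" for x y using g_sym by (simp add: h_ker_def)
  then show ?thesis using kernel_approx_less[OF m t, of j i] ij False unfolding l_def by simp
qed

end

section \<open>Covariance inequalities\<close>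

context ned_kernel
begin

text \<open>One sequence serves all covariance bounds. The constants \<open>16 * C + 24 * L\<close>
  are \<open>2 * 4 * \<eta> l\<close> from \<open>pa_cov\<close> with four factors, and the factor 6
  of \<open>\<beta>\<close> is that of \<open>\<Psi>_decoupled\<close>; each bound is enlarged to
  the common form. For \<open>m < 3\<close> there is no window with \<open>1 \<le> l\<close>, and 2
  dominates every covariance of variables bounded by 1.\<close>

definition \<gamma> :: "nat \<Rightarrow> real" where
  "\<gamma> m = (if m < 3 then 2 else (16 * C + 24 * L) / real (m div 3) ^ 6 + 6 * \<beta> (m - 2 * (m div 3)))"

lemma gamma_nonneg: "0 \<le> \<gamma> m"
  using C_nonneg L_nonneg beta_nonneg by (auto simp: \<gamma>_def)

lemma gamma_ge2: "m < 3 \<Longrightarrow> \<gamma> m = 2"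
  by (simp add: \<gamma>_def)

text \<open>Writing \<open>m = 3 * n + r\<close> with \<open>r < 3\<close>, the argument of
  \<open>\<beta>\<close> is \<open>n + r\<close> and \<open>m \<le> 3 * (n + r)\<close>, so each
  residue class is dominated by a shift of the assumed series.\<close>

lemma summable_beta_gap: "summable (\<lambda>m. real m * \<beta> (m - 2 * (m div 3)))"
proof (rule summable_split3)
  have s0: "summable (\<lambda>n. 3 * (real n * \<beta> n))" by (intro summable_mult beta_summable)
  show "summable (\<lambda>n. real (3 * n) * \<beta> (3 * n - 2 * (3 * n div 3)))"
    using s0 by (simp add: ac_simps)
  have sh: "summable (\<lambda>n. 3 * (real (n + k) * \<beta> (n + k)))" for k
    using summable_iff_shift[of "\<lambda>n. 3 * (real n * \<beta> n)" k] s0 by simp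
  have le: "real (3 * n + r) * \<beta> (n + r) \<le> 3 * (real (n + r) * \<beta> (n + r))" for n r
    using mult_right_mono[OF _ beta_nonneg, of "real (3 * n + r)" "3 * real (n + r)" "n + r"] by (simp add: algebra_simps)
  have e: "3 * n + 1 - 2 * ((3 * n + 1) div 3) = n + 1" "3 * n + 2 - 2 * ((3 * n + 2) div 3) = n + 2" for n :: nat
  proof -
    have "(3 * n + 1) div 3 = n" "(3 * n + 2) div 3 = n" by (rule div_nat_eqI; simp)+
    then show "3 * n + 1 - 2 * ((3 * n + 1) div 3) = n + 1" "3 * n + 2 - 2 * ((3 * n + 2) div 3) = n + 2" by linarith+
  qed
  show "summable (\<lambda>n. real (3 * n + 1) * \<beta> (3 * n + 1 - 2 * ((3 * n + 1) div 3)))"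
    unfolding e by (rule summable_comparison_test[OF _ sh[of 1]]) (use le[of _ 1] beta_nonneg in \<open>auto intro!: exI[of _ 0]\<close>)
  show "summable (\<lambda>n. real (3 * n + 2) * \<beta> (3 * n + 2 - 2 * ((3 * n + 2) div 3)))"
    unfolding e by (rule summable_comparison_test[OF _ sh[of 2]]) (use le[of _ 2] beta_nonneg in \<open>auto intro!: exI[of _ 0]\<close>)
qed (use beta_nonneg in auto)

lemma summable_gamma_weighted: "summable (\<lambda>m. real m * \<gamma> m)"
proof -
  have "summable (\<lambda>m. (16 * C + 24 * L) * (real m / real (m div 3) ^ 6) + 6 * (real m * \<beta> (m - 2 * (m div 3))))"
    by (intro summable_add summable_mult summable_power_gap summable_beta_gap)
  moreover have "\<forall>\<^sub>F m in sequentially. real m * \<gamma> m = (16 * C + 24 * L) * (real m / real (m div 3) ^ 6) + 6 * (real m * \<beta> (m - 2 * (m div 3)))"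
    using eventually_ge_at_top[of 3] by eventually_elim (simp add: \<gamma>_def algebra_simps add_divide_distrib)
  ultimately show ?thesis by (simp add: summable_cong)
qed

lemma summable_gamma: "summable \<gamma>"
proof (rule summable_comparison_test[OF _ summable_gamma_weighted])
  have "norm (\<gamma> n) \<le> real n * \<gamma> n" if "1 \<le> n" for n
  proof -
    have "1 * \<gamma> n \<le> real n * \<gamma> n" using that by (intro mult_right_mono gamma_nonneg) simp
    then show ?thesis using gamma_nonneg[of n] by simp
  qed
  then show "\<exists>N. \<forall>n\<ge>N. norm (\<gamma> n) \<le> real n * \<gamma> n" by blast
qed

definition \<Gamma> :: real where "\<Gamma> = suminf \<gamma>"

lemma sum_gamma_le: "finite A \<Longrightarrow> (\<Sum>k\<in>A. \<gamma> k) \<le> \<Gamma>"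
  unfolding \<Gamma>_def by (rule sum_le_suminf[OF summable_gamma]) (auto simp: gamma_nonneg)

lemma Gamma_ge: "2 \<le> \<Gamma>"
  using sum_gamma_le[of "{0}"] by (simp add: \<gamma>_def)

text \<open>Each distance from \<open>i\<close> occurs at most once on either side of
  \<open>i\<close>.\<close>

lemma sum_gamma_int_le:
  assumes "finite A"
  shows "(\<Sum>j\<in>A. \<gamma> (nat \<bar>i - j\<bar>)) \<le> 2 * \<Gamma>"
proof -
  have half: "(\<Sum>j\<in>B. \<gamma> (nat \<bar>i - j\<bar>)) \<le> \<Gamma>" if "finite B" "inj_on (\<lambda>j. nat \<bar>i - j\<bar>) B" for B
  proof -
    have "(\<Sum>j\<in>B. \<gamma> (nat \<bar>i - j\<bar>)) = (\<Sum>k\<in>(\<lambda>j. nat \<bar>i - j\<bar>) ` B. \<gamma> k)"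
      using that(2) by (simp add: sum.reindex)
    also have "\<dots> \<le> \<Gamma>" using that(1) by (intro sum_gamma_le) simp
    finally show ?thesis .
  qed
  have "(\<Sum>j\<in>A. \<gamma> (nat \<bar>i - j\<bar>)) = (\<Sum>j\<in>{j\<in>A. j \<le> i}. \<gamma> (nat \<bar>i - j\<bar>)) + (\<Sum>j\<in>{j\<in>A. \<not> j \<le> i}. \<gamma> (nat \<bar>i - j\<bar>))"
    by (subst sum.union_disjoint[symmetric]) (auto simp: assms intro: sum.cong)
  also have "\<dots> \<le> \<Gamma> + \<Gamma>" by (intro add_mono half) (auto simp: assms inj_on_def)
  finally show ?thesis by simp
qed

text \<open>The summand in the square of the row remainder \<open>R\<close>. Averaging
  \<open>y\<close> or \<open>z\<close> alone over an independent copy of \<open>X 0\<close> gives 0;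
  in \<open>x\<close> there is no such cancellation.\<close>

definition \<Psi> :: "real \<Rightarrow> real \<Rightarrow> real \<Rightarrow> real \<Rightarrow> real" where
  "\<Psi> t x y z = (h_ker g x y t - H t x) * (h_ker g x z t - H t x)"

lemma diff_h_H_bound: "\<bar>h_ker g x y t - H t x\<bar> \<le> 1"
  using h_ker_bounds[of g x y t] H_bounds[of t x] by linarith

lemma \<Psi>_bound: "\<bar>\<Psi> t x y z\<bar> \<le> 1"
  unfolding \<Psi>_def abs_mult
  using mult_mono[OF diff_h_H_bound[of x y t] diff_h_H_bound[of x z t]] by simp

lemma \<Psi>_sym: "\<Psi> t x y z = \<Psi> t x z y"
  by (simp add: \<Psi>_def mult.commute)

lemma \<Psi>_meas [measurable (raw)]:
  assumes [measurable]: "u \<in> borel_measurable N" "v \<in> borel_measurable N" "w \<in> borel_measurable N"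
  shows "(\<lambda>x. \<Psi> t (u x) (v x) (w x)) \<in> borel_measurable N"
  unfolding \<Psi>_def by measurable

lemma \<Psi>_diff: "\<bar>\<Psi> t x y z - \<Psi> t x' y' z'\<bar> \<le> \<bar>h_ker g x y t - h_ker g x' y' t\<bar> + \<bar>h_ker g x z t - h_ker g x' z' t\<bar> + 2 * \<bar>H t x - H t x'\<bar>"
proof -
  have "\<bar>(y1 - h) - (y2 - h')\<bar> \<le> \<bar>y1 - y2\<bar> + \<bar>h - h'\<bar>" for y1 y2 h h' :: real by linarith
  from add_mono[OF this[of "h_ker g x y t" "H t x" "h_ker g x' y' t" "H t x'"] this[of "h_ker g x z t" "H t x" "h_ker g x' z' t" "H t x'"]]
  show ?thesis unfolding \<Psi>_def
    by (intro order_trans[OF prod_diff_le[OF diff_h_H_bound[of x z t] diff_h_H_bound[of x' y' t]]]) simp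
qed

lemma \<Psi>_approx:
  assumes m: "3 \<le> m" and t: "t \<in> T" and ij: "int m \<le> \<bar>i - j\<bar>" and ik: "int m \<le> \<bar>i - k\<bar>"
  defines "l \<equiv> m div 3"
  shows "\<bar>expectation (\<lambda>\<omega>. \<Psi> t (X i \<omega>) (X j \<omega>) (X k \<omega>)) - expectation (\<lambda>\<omega>. \<Psi> t (Y l i \<omega>) (Y l j \<omega>) (Y l k \<omega>))\<bar>
    \<le> (12 * C + 18 * L) / real l ^ 6 + 4 * \<beta> (m - 2 * l)"
proof -
  have l: "1 \<le> l" using m by (simp add: l_def)
  note [measurable] = Y_meas_l[OF l t]
  let ?hd = "\<lambda>i j \<omega>. \<bar>h_ker g (X i \<omega>) (X j \<omega>) t - h_ker g (Y l i \<omega>) (Y l j \<omega>) t\<bar>"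
  let ?Hd = "\<lambda>\<omega>. \<bar>H t (X i \<omega>) - H t (Y l i \<omega>)\<bar>"
  have ih: "integrable M (?hd i j)" for i j
    by (rule integrable_bounded[where B = 1]) (auto intro!: abs_diff_le_one)
  have iH: "integrable M ?Hd"
    by (rule integrable_bounded[where B = 1]) (auto intro!: abs_diff_le_one)
  have iP: "integrable M (\<lambda>\<omega>. \<Psi> t (X i \<omega>) (X j \<omega>) (X k \<omega>))" "integrable M (\<lambda>\<omega>. \<Psi> t (Y l i \<omega>) (Y l j \<omega>) (Y l k \<omega>))"
    by (rule integrable_bounded[where B = 1]; use \<Psi>_bound in measurable)+
  have "\<bar>expectation (\<lambda>\<omega>. \<Psi> t (X i \<omega>) (X j \<omega>) (X k \<omega>)) - expectation (\<lambda>\<omega>. \<Psi> t (Y l i \<omega>) (Y l j \<omega>) (Y l k \<omega>))\<bar>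
    = \<bar>expectation (\<lambda>\<omega>. \<Psi> t (X i \<omega>) (X j \<omega>) (X k \<omega>) - \<Psi> t (Y l i \<omega>) (Y l j \<omega>) (Y l k \<omega>))\<bar>"
    using iP by simp
  also have "\<dots> \<le> expectation (\<lambda>\<omega>. \<bar>\<Psi> t (X i \<omega>) (X j \<omega>) (X k \<omega>) - \<Psi> t (Y l i \<omega>) (Y l j \<omega>) (Y l k \<omega>)\<bar>)"
    by (rule integral_abs_bound)
  also have "\<dots> \<le> expectation (\<lambda>\<omega>. ?hd i j \<omega> + ?hd i k \<omega> + 2 * ?Hd \<omega>)"
    by (rule integral_mono) (use ih iH iP \<Psi>_diff in auto)
  also have "\<dots> = expectation (?hd i j) + expectation (?hd i k) + 2 * expectation ?Hd"
    using ih iH by simp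
  also have "\<dots> \<le> ((4 * C + 6 * L) / real l ^ 6 + 2 * \<beta> (m - 2 * l)) + ((4 * C + 6 * L) / real l ^ 6 + 2 * \<beta> (m - 2 * l)) + 2 * \<eta> l"
    by (intro add_mono mult_left_mono kernel_approx[OF m t ij, folded l_def] kernel_approx[OF m t ik, folded l_def] H_approx[OF l t]) simp
  also have "\<dots> = (12 * C + 18 * L) / real l ^ 6 + 4 * \<beta> (m - 2 * l)"
    by (simp add: add_divide_distrib algebra_simps)
  finally show ?thesis .
qed

text \<open>The factor with \<open>j\<close> is bounded by 1 and comes out of the inner integral,
  leaving the near degeneracy of \<open>degenerate_approx\<close>.\<close>

lemma \<Psi>_integrate_out:
  assumes l: "1 \<le> l" and t: "t \<in> T"
  shows "\<bar>LINT \<omega>|M. LINT \<omega>'|M. \<Psi> t (Y l i \<omega>) (Y l j \<omega>) (Y l k \<omega>')\<bar> \<le> \<eta> l"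
proof -
  note [measurable] = Y_meas_l[OF l t]
  let ?D = "\<lambda>\<omega>. LINT \<omega>'|M. h_ker g (Y l i \<omega>) (Y l k \<omega>') t - H t (Y l i \<omega>)"
  have D1: "\<bar>?D \<omega>\<bar> \<le> 1" for \<omega>
  proof -
    have "\<bar>?D \<omega>\<bar> \<le> (LINT \<omega>'|M. \<bar>h_ker g (Y l i \<omega>) (Y l k \<omega>') t - H t (Y l i \<omega>)\<bar>)" by (rule integral_abs_bound)
    also have "\<dots> \<le> 1"
      by (rule integral_le_const) (auto intro!: integrable_bounded[where B = 1] simp: diff_h_H_bound)
    finally show ?thesis .
  qed
  have iD: "integrable M (\<lambda>\<omega>. \<bar>?D \<omega>\<bar>)"
    by (rule integrable_bounded[where B = 1]) (use D1 in auto)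
  have "\<bar>LINT \<omega>|M. LINT \<omega>'|M. \<Psi> t (Y l i \<omega>) (Y l j \<omega>) (Y l k \<omega>')\<bar> \<le> (LINT \<omega>|M. \<bar>LINT \<omega>'|M. \<Psi> t (Y l i \<omega>) (Y l j \<omega>) (Y l k \<omega>')\<bar>)"
    by (rule integral_abs_bound)
  also have "\<dots> \<le> (LINT \<omega>|M. \<bar>?D \<omega>\<bar>)"
  proof (rule integral_mono_AE')
    show "AE \<omega> in M. \<bar>LINT \<omega>'|M. \<Psi> t (Y l i \<omega>) (Y l j \<omega>) (Y l k \<omega>')\<bar> \<le> \<bar>?D \<omega>\<bar>"
    proof (rule AE_I2)
      fix \<omega>
      have "(LINT \<omega>'|M. \<Psi> t (Y l i \<omega>) (Y l j \<omega>) (Y l k \<omega>')) = (h_ker g (Y l i \<omega>) (Y l j \<omega>) t - H t (Y l i \<omega>)) * ?D \<omega>"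
        unfolding \<Psi>_def by (rule integral_mult_right_zero)
      then show "\<bar>LINT \<omega>'|M. \<Psi> t (Y l i \<omega>) (Y l j \<omega>) (Y l k \<omega>')\<bar> \<le> \<bar>?D \<omega>\<bar>"
        using diff_h_H_bound[of "Y l i \<omega>" "Y l j \<omega>" t] by (simp add: abs_mult mult_left_le_one_le)
    qed
  qed (use iD in auto)
  also have "\<dots> \<le> \<eta> l" by (rule degenerate_approx[OF l t])
  finally show ?thesis .
qed

lemma \<Psi>_shift:
  "expectation (\<lambda>\<omega>. \<Psi> t (X (i + c) \<omega>) (X (j + c) \<omega>) (X (k + c) \<omega>)) = expectation (\<lambda>\<omega>. \<Psi> t (X i \<omega>) (X j \<omega>) (X k \<omega>))"
  by (rule expectation_shift_X3) measurable

text \<open>The extremal one of the three indices is decoupled from the other two.\<close>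

lemma \<Psi>_decoupled:
  assumes m: "3 \<le> m" and t: "t \<in> T" and ij: "int m \<le> \<bar>i - j\<bar>" and ik: "int m \<le> \<bar>i - k\<bar>"
    and l: "l = m div 3"
    and D: "\<bar>expectation (\<lambda>\<omega>. \<Psi> t (Y l (i + c) \<omega>) (Y l (j + c) \<omega>) (Y l (k + c) \<omega>))
      - (LINT \<omega>|M. LINT \<omega>'|M. \<Psi> t (Y l (i + c) \<omega>) (Y l (j + c) \<omega>) (Y l (k + c) \<omega>'))\<bar> \<le> 2 * \<beta> (m - 2 * l)"
  shows "\<bar>expectation (\<lambda>\<omega>. \<Psi> t (X i \<omega>) (X j \<omega>) (X k \<omega>))\<bar> \<le> \<gamma> m"
proof -
  have l1: "1 \<le> l" using m by (simp add: l)
  let ?i = "i + c" and ?j = "j + c" and ?k = "k + c"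
  have "\<bar>expectation (\<lambda>\<omega>. \<Psi> t (X ?i \<omega>) (X ?j \<omega>) (X ?k \<omega>)) - expectation (\<lambda>\<omega>. \<Psi> t (Y l ?i \<omega>) (Y l ?j \<omega>) (Y l ?k \<omega>))\<bar>
    \<le> (12 * C + 18 * L) / real l ^ 6 + 4 * \<beta> (m - 2 * l)"
    unfolding l by (rule \<Psi>_approx[OF m t]) (use ij ik in auto)
  with D \<Psi>_integrate_out[OF l1 t, of ?i ?j ?k]
  have "\<bar>expectation (\<lambda>\<omega>. \<Psi> t (X ?i \<omega>) (X ?j \<omega>) (X ?k \<omega>))\<bar> \<le> (12 * C + 18 * L) / real l ^ 6 + \<eta> l + 6 * \<beta> (m - 2 * l)"
    by linarith
  also have "(12 * C + 18 * L) / real l ^ 6 + \<eta> l = (14 * C + 21 * L) / real l ^ 6" by (simp add: add_divide_distrib algebra_simps)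
  also have "\<dots> \<le> (16 * C + 24 * L) / real l ^ 6" using C_nonneg L_nonneg by (intro divide_right_mono) auto
  finally show ?thesis unfolding \<Psi>_shift using m by (simp add: \<gamma>_def l)
qed

lemma \<Psi>_last:
  assumes m: "3 \<le> m" and t: "t \<in> T" and ij: "int m \<le> \<bar>i - j\<bar>" and ik: "i + int m \<le> k" and jk: "j + int m \<le> k"
  shows "\<bar>expectation (\<lambda>\<omega>. \<Psi> t (X i \<omega>) (X j \<omega>) (X k \<omega>))\<bar> \<le> \<gamma> m"
proof -
  define l where "l = m div 3"
  have l: "1 \<le> l" using m by (simp add: l_def)
  \<comment> \<open>Makes the later of the two windows around \<open>i\<close> and \<open>j\<close>
    end at time 0.\<close>
  define c where "c = - max i j - int l"
  let ?i = "i + c" and ?j = "j + c" and ?k = "k + c"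
  have U: "(\<lambda>\<omega>. (Y l ?i \<omega>, Y l ?j \<omega>)) \<in> measurable (generated_algebra M Z {..0}) (borel \<Otimes>\<^sub>M borel)"
    by (intro measurable_Pair Y_generated[OF l]) (auto simp: c_def)
  have "int (m - 2 * l) = int m - 2 * int l" by (simp add: l_def of_nat_diff)
  then have V: "Y l ?k \<in> borel_measurable (generated_algebra M Z {int (m - 2 * l)..})"
    by (intro Y_generated[OF l]) (use ik jk in \<open>auto simp: c_def\<close>)
  have "(\<lambda>(u, v). \<Psi> t (fst u) (snd u) v) \<in> borel_measurable ((borel \<Otimes>\<^sub>M borel) \<Otimes>\<^sub>M borel)" by measurable
  from decouple(1)[where \<Phi> = "\<lambda>u v. \<Psi> t (fst u) (snd u) v", OF U V this] \<Psi>_bound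
  show ?thesis
    by (intro \<Psi>_decoupled[OF m t ij _ l_def, where c = c]) (use ik in simp_all)
qed

lemma \<Psi>_first:
  assumes m: "3 \<le> m" and t: "t \<in> T" and ij: "int m \<le> \<bar>i - j\<bar>" and ik: "k + int m \<le> i" and jk: "k + int m \<le> j"
  shows "\<bar>expectation (\<lambda>\<omega>. \<Psi> t (X i \<omega>) (X j \<omega>) (X k \<omega>))\<bar> \<le> \<gamma> m"
proof -
  define l where "l = m div 3"
  have l: "1 \<le> l" using m by (simp add: l_def)
  define c where "c = - k - int l"
  let ?i = "i + c" and ?j = "j + c" and ?k = "k + c"
  have U: "Y l ?k \<in> borel_measurable (generated_algebra M Z {..0})"
    by (intro Y_generated[OF l]) (auto simp: c_def)
  have "int (m - 2 * l) = int m - 2 * int l" by (simp add: l_def of_nat_diff)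
  then have V: "(\<lambda>\<omega>. (Y l ?i \<omega>, Y l ?j \<omega>)) \<in> measurable (generated_algebra M Z {int (m - 2 * l)..}) (borel \<Otimes>\<^sub>M borel)"
    by (intro measurable_Pair Y_generated[OF l]) (use ik jk in \<open>auto simp: c_def\<close>)
  have "(\<lambda>(v, u). \<Psi> t (fst u) (snd u) v) \<in> borel_measurable (borel \<Otimes>\<^sub>M (borel \<Otimes>\<^sub>M borel))" by measurable
  \<comment> \<open>Here the variable of the inner integral belongs to the past, hence the other
    order of integration.\<close>
  from decouple(2)[where \<Phi> = "\<lambda>v u. \<Psi> t (fst u) (snd u) v", OF U V this] \<Psi>_bound
  show ?thesis
    by (intro \<Psi>_decoupled[OF m t ij _ l_def, where c = c]) (use ik in simp_all)
qed

lemma \<Psi>_expectation_bound: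
  assumes t: "t \<in> T"
  shows "\<bar>expectation (\<lambda>\<omega>. \<Psi> t (X i \<omega>) (X j \<omega>) (X k \<omega>))\<bar> \<le> \<gamma> (nat \<bar>i - j\<bar>) + \<gamma> (nat \<bar>i - k\<bar>) + \<gamma> (nat \<bar>j - k\<bar>)"
proof -
  define m where "m = min (nat \<bar>i - j\<bar>) (min (nat \<bar>i - k\<bar>) (nat \<bar>j - k\<bar>))"
  have "\<bar>expectation (\<lambda>\<omega>. \<Psi> t (X i \<omega>) (X j \<omega>) (X k \<omega>))\<bar> \<le> \<gamma> m"
  proof (cases "m < 3")
    case True
    have "\<bar>expectation (\<lambda>\<omega>. \<Psi> t (X i \<omega>) (X j \<omega>) (X k \<omega>))\<bar> \<le> expectation (\<lambda>\<omega>. \<bar>\<Psi> t (X i \<omega>) (X j \<omega>) (X k \<omega>)\<bar>)"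
      by (rule integral_abs_bound)
    also have "\<dots> \<le> 1"
      by (rule integral_le_const) (auto intro!: integrable_bounded[where B = 1] simp: \<Psi>_bound)
    finally show ?thesis using True by (simp add: gamma_ge2)
  next
    case False
    then have m: "3 \<le> m" by simp
    have d: "int m \<le> \<bar>i - j\<bar>" "int m \<le> \<bar>i - k\<bar>" "int m \<le> \<bar>j - k\<bar>"
      by (simp_all add: m_def of_nat_min min.coboundedI1 min.coboundedI2)
    then have ne: "i \<noteq> j" "i \<noteq> k" "j \<noteq> k" using m by auto
    \<comment> \<open>Among three distinct indices one of \<open>j\<close> and \<open>k\<close> is
      always extremal, and these two may be exchanged. So the isolated index is never forced to be
      \<open>i\<close>, in which \<open>\<Psi>\<close> is not degenerate.\<close>
    consider "i < k \<and> j < k" | "i < j \<and> k < j" | "k < i \<and> k < j" | "j < i \<and> j < k"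
      using ne by linarith
    then show ?thesis
    proof cases
      case 1 then show ?thesis using d by (intro \<Psi>_last[OF m t]) auto
    next
      case 2
      then show ?thesis unfolding \<Psi>_sym[of t "X i _" "X j _"] using d by (intro \<Psi>_last[OF m t]) auto
    next
      case 3 then show ?thesis using d by (intro \<Psi>_first[OF m t]) auto
    next
      case 4
      then show ?thesis unfolding \<Psi>_sym[of t "X i _" "X j _"] using d by (intro \<Psi>_first[OF m t]) auto
    qed
  qed
  also have "\<dots> \<le> \<gamma> (nat \<bar>i - j\<bar>) + \<gamma> (nat \<bar>i - k\<bar>) + \<gamma> (nat \<bar>j - k\<bar>)"
  proof -
    have "m = nat \<bar>i - j\<bar> \<or> m = nat \<bar>i - k\<bar> \<or> m = nat \<bar>j - k\<bar>" by (simp only: m_def min_def) presburger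
    then show ?thesis
      using gamma_nonneg[of "nat \<bar>i - j\<bar>"] gamma_nonneg[of "nat \<bar>i - k\<bar>"] gamma_nonneg[of "nat \<bar>j - k\<bar>"]
      by (elim disjE) simp_all
  qed
  finally show ?thesis .
qed

section \<open>Covariances of products of the projections\<close>

lemma U_fun_eq: "U_fun M X g t = expectation (\<lambda>\<omega>. H t (X i \<omega>))"
proof -
  interpret X0: prob_space "distr M borel (X 0)" by (rule prob_space_distr) simp
  have "pair_law M X = distr M borel (X i) \<Otimes>\<^sub>M distr M borel (X 0)"
    unfolding pair_law_def law_X[of i] ..
  also have "\<dots> = distr (M \<Otimes>\<^sub>M M) (borel \<Otimes>\<^sub>M borel) (\<lambda>(x, y). (X i x, X 0 y))"
    by (rule pair_measure_distr) (auto intro: X0.sigma_finite_measure_axioms)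
  finally have *: "pair_law M X = distr (M \<Otimes>\<^sub>M M) (borel \<Otimes>\<^sub>M borel) (\<lambda>(x, y). (X i x, X 0 y))" .
  have "integrable (M \<Otimes>\<^sub>M M) (\<lambda>z. h_ker g (X i (fst z)) (X 0 (snd z)) t)"
    by (rule MM.integrable_const_bound[where B = 1]) auto
  from MM.integral_fst'[OF this] show ?thesis
    unfolding U_fun_def * by (subst integral_distr) (auto simp: H_def case_prod_beta')
qed

lemma U_bounds: "0 \<le> U_fun M X g t" "U_fun M X g t \<le> 1"
proof -
  show "0 \<le> U_fun M X g t" unfolding U_fun_eq[of t 0] by (rule integral_nonneg_AE) simp
  show "U_fun M X g t \<le> 1" unfolding U_fun_eq[of t 0] by (rule integral_le_const) (auto intro!: integrable_bounded[where B = 1])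
qed

definition a :: "real \<Rightarrow> int \<Rightarrow> 'a \<Rightarrow> real" where
  "a t i \<omega> = h1 M X g (X i \<omega>) t"

lemma a_eq: "a t i \<omega> = H t (X i \<omega>) - U_fun M X g t"
  by (simp add: a_def h1_def H_def)

lemma a_meas [measurable]: "a t i \<in> borel_measurable M"
  unfolding a_eq[abs_def] by measurable

lemma a_bound: "\<bar>a t i \<omega>\<bar> \<le> 1"
  unfolding a_eq using U_bounds[of t] by (intro abs_diff_le_one) auto

lemma a_mean: "expectation (a t i) = 0"
  unfolding a_eq[abs_def] using U_fun_eq[of t i]
  by (subst Bochner_Integration.integral_diff) (auto simp: prob_space intro!: integrable_bounded[where B = 1])

text \<open>Closeness in mean to a bounded function of the \<open>Z\<close> with index in
  \<open>I\<close>. As all variables are bounded by 1, the errors simply add under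
  multiplication.\<close>

definition apx :: "int set \<Rightarrow> real \<Rightarrow> ('a \<Rightarrow> real) \<Rightarrow> bool" where
  "apx I \<delta> F \<longleftrightarrow> F \<in> borel_measurable M \<and> (\<forall>\<omega>. \<bar>F \<omega>\<bar> \<le> 1) \<and>
     (\<exists>F'\<in>borel_measurable (generated_algebra M Z I). (\<forall>\<omega>. \<bar>F' \<omega>\<bar> \<le> 1) \<and> expectation (\<lambda>\<omega>. \<bar>F \<omega> - F' \<omega>\<bar>) \<le> \<delta>)"

lemma generated_meas: "F \<in> borel_measurable (generated_algebra M Z I) \<Longrightarrow> F \<in> borel_measurable M"
  by (rule measurable_from_subalg[OF subalg])

lemma apx_mult:
  assumes "apx I \<delta> F" "apx I \<delta>' G"
  shows "apx I (\<delta> + \<delta>') (\<lambda>\<omega>. F \<omega> * G \<omega>)"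
proof -
  obtain F' where F: "F \<in> borel_measurable M" "\<And>\<omega>. \<bar>F \<omega>\<bar> \<le> 1" "F' \<in> borel_measurable (generated_algebra M Z I)"
    "\<And>\<omega>. \<bar>F' \<omega>\<bar> \<le> 1" "expectation (\<lambda>\<omega>. \<bar>F \<omega> - F' \<omega>\<bar>) \<le> \<delta>"
    using assms(1) by (auto simp: apx_def)
  obtain G' where G: "G \<in> borel_measurable M" "\<And>\<omega>. \<bar>G \<omega>\<bar> \<le> 1" "G' \<in> borel_measurable (generated_algebra M Z I)"
    "\<And>\<omega>. \<bar>G' \<omega>\<bar> \<le> 1" "expectation (\<lambda>\<omega>. \<bar>G \<omega> - G' \<omega>\<bar>) \<le> \<delta>'"
    using assms(2) by (auto simp: apx_def)
  show ?thesis
    unfolding apx_def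
    using expectation_prod_diff[OF F(1) G(1) generated_meas[OF F(3)] generated_meas[OF G(3)] F(2) G(2) F(4) G(4) F(5) G(5)]
      F G
    by (intro conjI allI bexI[of _ "\<lambda>\<omega>. F' \<omega> * G' \<omega>"] abs_mult_le_one borel_measurable_times) auto
qed

lemma apx_a:
  assumes l: "1 \<le> l" and t: "t \<in> T" and I: "{i - int l..i + int l} \<subseteq> I"
  shows "apx I (\<eta> l) (a t i)"
proof -
  have [measurable]: "Y l i \<in> borel_measurable (generated_algebra M Z I)" by (rule Y_generated[OF l I])
  have "\<bar>H t (Y l i \<omega>) - U_fun M X g t\<bar> \<le> 1" for \<omega>
    using U_bounds[of t] by (intro abs_diff_le_one) auto
  then show ?thesis unfolding apx_def
    using H_approx[OF l t, of i] a_bound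
    by (intro conjI allI bexI[of _ "\<lambda>\<omega>. H t (Y l i \<omega>) - U_fun M X g t"]) (auto simp: a_eq)
qed

definition pa :: "real \<Rightarrow> int list \<Rightarrow> 'a \<Rightarrow> real" where
  "pa t is \<omega> = (\<Prod>i\<leftarrow>is. a t i \<omega>)"

lemma pa_simps [simp]: "pa t [] \<omega> = 1" "pa t (i # is) \<omega> = a t i \<omega> * pa t is \<omega>"
  by (simp_all add: pa_def)

lemma pa_meas [measurable]: "pa t is \<in> borel_measurable M"
  by (induction "is") simp_all

lemma pa_bound: "\<bar>pa t is \<omega>\<bar> \<le> 1"
  by (induction "is") (auto intro!: abs_mult_le_one a_bound)

lemma apx_pa:
  assumes l: "1 \<le> l" and t: "t \<in> T" and "\<And>i. i \<in> set is \<Longrightarrow> {i - int l..i + int l} \<subseteq> I"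
  shows "apx I (real (length is) * \<eta> l) (pa t is)"
  using assms(3)
proof (induction "is")
  case Nil
  then show ?case by (auto simp: apx_def intro!: bexI[of _ "\<lambda>_. 1"])
next
  case (Cons i "is")
  have "apx I (\<eta> l + real (length is) * \<eta> l) (\<lambda>\<omega>. a t i \<omega> * pa t is \<omega>)"
    by (rule apx_mult[OF apx_a[OF l t] Cons.IH]) (use Cons.prems in auto)
  moreover have "pa t (i # is) = (\<lambda>\<omega>. a t i \<omega> * pa t is \<omega>)" by auto
  ultimately show ?case by (simp add: add_divide_distrib distrib_right)
qed

lemma cov_apx:
  assumes "apx {..0} \<delta> F" "apx {int k..} \<delta>' G"
  shows "\<bar>expectation (\<lambda>\<omega>. F \<omega> * G \<omega>) - expectation F * expectation G\<bar> \<le> 2 * \<delta> + 2 * \<delta>' + 2 * \<beta> k"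
proof -
  obtain F' where F: "F \<in> borel_measurable M" "\<And>\<omega>. \<bar>F \<omega>\<bar> \<le> 1" "F' \<in> borel_measurable (generated_algebra M Z {..0})"
    "\<And>\<omega>. \<bar>F' \<omega>\<bar> \<le> 1" "expectation (\<lambda>\<omega>. \<bar>F \<omega> - F' \<omega>\<bar>) \<le> \<delta>"
    using assms(1) by (auto simp: apx_def)
  obtain G' where G: "G \<in> borel_measurable M" "\<And>\<omega>. \<bar>G \<omega>\<bar> \<le> 1" "G' \<in> borel_measurable (generated_algebra M Z {int k..})"
    "\<And>\<omega>. \<bar>G' \<omega>\<bar> \<le> 1" "expectation (\<lambda>\<omega>. \<bar>G \<omega> - G' \<omega>\<bar>) \<le> \<delta>'"
    using assms(2) by (auto simp: apx_def)
  note [measurable] = F(1) G(1) generated_meas[OF F(3)] generated_meas[OF G(3)]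
  have i: "integrable M F" "integrable M G" "integrable M F'" "integrable M G'"
    by (rule integrable_bounded[where B = 1], measurable, rule F G)+
  have ip: "integrable M (\<lambda>\<omega>. F \<omega> * G \<omega>)" "integrable M (\<lambda>\<omega>. F' \<omega> * G' \<omega>)"
    by (rule integrable_bounded[where B = 1], measurable, intro abs_mult_le_one F G)+
  have 1: "\<bar>expectation (\<lambda>\<omega>. F \<omega> * G \<omega>) - expectation (\<lambda>\<omega>. F' \<omega> * G' \<omega>)\<bar> \<le> \<delta> + \<delta>'"
  proof -
    have "\<bar>expectation (\<lambda>\<omega>. F \<omega> * G \<omega>) - expectation (\<lambda>\<omega>. F' \<omega> * G' \<omega>)\<bar> = \<bar>expectation (\<lambda>\<omega>. F \<omega> * G \<omega> - F' \<omega> * G' \<omega>)\<bar>"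
      using ip by simp
    also have "\<dots> \<le> expectation (\<lambda>\<omega>. \<bar>F \<omega> * G \<omega> - F' \<omega> * G' \<omega>\<bar>)" by (rule integral_abs_bound)
    also have "\<dots> \<le> \<delta> + \<delta>'"
      by (rule expectation_prod_diff) (use F G in auto)
    finally show ?thesis .
  qed
  have e: "\<bar>expectation A - expectation B\<bar> \<le> e" if "expectation (\<lambda>\<omega>. \<bar>A \<omega> - B \<omega>\<bar>) \<le> e" "integrable M A" "integrable M B" for A B :: "'a \<Rightarrow> real" and e
    using that integral_abs_bound[of M "\<lambda>\<omega>. A \<omega> - B \<omega>"] by simp
  have b1: "\<bar>expectation A\<bar> \<le> 1" if "integrable M A" "\<And>\<omega>. \<bar>A \<omega>\<bar> \<le> 1" for A :: "'a \<Rightarrow> real"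
    by (rule order_trans[OF integral_abs_bound integral_le_const]) (use that in auto)
  have 2: "\<bar>expectation F * expectation G - expectation F' * expectation G'\<bar> \<le> \<delta> + \<delta>'"
    using prod_diff_le[of "expectation G" "expectation F'" "expectation F" "expectation G'"]
      e[OF F(5) i(1) i(3)] e[OF G(5) i(2) i(4)] b1[OF i(2) G(2)] b1[OF i(3) F(4)] by linarith
  \<comment> \<open>\<open>decouple\<close> asks for a bound on \<open>\<Phi>\<close> at all real
    arguments; clipping provides it and does not change \<open>F'\<close> and \<open>G'\<close>,
    which take values in \<open>[-1, 1]\<close>.\<close>
  define cl where "cl x = max (-1) (min 1 x)" for x :: real
  have clm [measurable]: "cl \<in> borel_measurable borel" unfolding cl_def[abs_def] by measurable
  have cl1: "\<bar>cl x\<bar> \<le> 1" for x by (auto simp: cl_def)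
  have cle: "cl x = x" if "\<bar>x\<bar> \<le> 1" for x using that by (auto simp: cl_def)
  have "\<bar>expectation (\<lambda>\<omega>. cl (F' \<omega>) * cl (G' \<omega>)) - (LINT \<omega>|M. LINT \<omega>'|M. cl (F' \<omega>) * cl (G' \<omega>'))\<bar> \<le> 2 * \<beta> k"
    by (rule decouple(1)[where \<Phi> = "\<lambda>u v. cl u * cl v", OF F(3) G(3)]) (measurable, intro abs_mult_le_one cl1)
  then have 3: "\<bar>expectation (\<lambda>\<omega>. F' \<omega> * G' \<omega>) - expectation F' * expectation G'\<bar> \<le> 2 * \<beta> k"
    by (simp add: cle F(4) G(4))
  from 1 2 3 show ?thesis by linarith
qed

lemma pa_shift: "expectation (pa t (map (\<lambda>i. i + c) is)) = expectation (pa t is)"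
proof -
  let ?\<Phi> = "\<lambda>v :: int \<Rightarrow> real \<times> real. \<Prod>i\<leftarrow>is. H t (fst (v i)) - U_fun M X g t"
  have "?\<Phi> \<in> borel_measurable (PiM UNIV (\<lambda>_. borel))"
    by (induction "is") simp_all
  from expectation_shift[OF this, of c] show ?thesis
    by (simp add: pa_def[abs_def] a_eq comp_def)
qed

lemma pa_append: "pa t (is @ js) \<omega> = pa t is \<omega> * pa t js \<omega>"
  by (simp add: pa_def)

lemma pa_cov:
  assumes t: "t \<in> T" and ne: "is \<noteq> []" and len: "length is + length js \<le> 4"
    and gap: "\<And>i j. i \<in> set is \<Longrightarrow> j \<in> set js \<Longrightarrow> i + int m \<le> j"
  shows "\<bar>expectation (pa t (is @ js)) - expectation (pa t is) * expectation (pa t js)\<bar> \<le> \<gamma> m"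
proof (cases "m < 3")
  case True
  have b: "\<bar>expectation (pa t ks)\<bar> \<le> 1" for ks
    by (rule order_trans[OF integral_abs_bound integral_le_const])
       (auto intro!: integrable_abs integrable_bounded[where B = 1] simp: pa_bound)
  have "\<bar>expectation (pa t (is @ js)) - expectation (pa t is) * expectation (pa t js)\<bar> \<le> 1 + 1"
    using abs_mult_le_one[OF b b, of "is" js] b[of "is @ js"] by linarith
  then show ?thesis using True by (simp add: gamma_ge2)
next
  case False
  define l where "l = m div 3"
  have l: "1 \<le> l" using False by (simp add: l_def)
  \<comment> \<open>The latest window of the first block is made to end at time 0; those of the
    second block then start at \<open>m - 2 * l\<close> or later.\<close>
  define c where "c = - Max (set is) - int l"
  define is' js' where "is' = map (\<lambda>i. i + c) is" "js' = map (\<lambda>i. i + c) js"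
  have MaxI: "Max (set is) \<in> set is" using ne by (intro Max_in) auto
  have "int (m - 2 * l) = int m - 2 * int l" by (simp add: l_def of_nat_diff)
  note intm = this
  have g2: "{j - int l..j + int l} \<subseteq> {int (m - 2 * l)..}" if "j \<in> set js'" for j
  proof -
    from that obtain j0 where "j0 \<in> set js" "j = j0 + c" by (auto simp: is'_js'_def)
    with gap[OF MaxI] have "int (m - 2 * l) \<le> j - int l" unfolding intm c_def by force
    then show ?thesis by auto
  qed
  have g1: "{j - int l..j + int l} \<subseteq> {..0}" if "j \<in> set is'" for j
  proof -
    from that obtain j0 where "j0 \<in> set is" "j = j0 + c" by (auto simp: is'_js'_def)
    with Max_ge[of "set is" j0] have "j + int l \<le> 0" unfolding c_def by simp
    then show ?thesis by auto
  qed
  have e: "is' @ js' = map (\<lambda>i. i + c) (is @ js)" by (simp add: is'_js'_def)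
  have "\<bar>expectation (\<lambda>\<omega>. pa t is' \<omega> * pa t js' \<omega>) - expectation (pa t is') * expectation (pa t js')\<bar>
     \<le> 2 * (real (length is') * \<eta> l) + 2 * (real (length js') * \<eta> l) + 2 * \<beta> (m - 2 * l)"
    by (rule cov_apx[OF apx_pa[OF l t g1] apx_pa[OF l t g2]])
  also have "(\<lambda>\<omega>. pa t is' \<omega> * pa t js' \<omega>) = pa t (is' @ js')" by (auto simp: pa_append)
  also have "2 * (real (length is') * \<eta> l) + 2 * (real (length js') * \<eta> l) + 2 * \<beta> (m - 2 * l) = 2 * (real (length is + length js) * \<eta> l) + 2 * \<beta> (m - 2 * l)"
  proof -
    have "2 * (real p * x) + 2 * (real q * x) + y = 2 * (real (p + q) * x) + y" for p q x y by (simp add: algebra_simps)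
    then show ?thesis by (simp only: is'_js'_def length_map)
  qed
  also have "\<dots> \<le> 2 * (4 * \<eta> l) + 6 * \<beta> (m - 2 * l)"
  proof (intro add_mono mult_left_mono mult_right_mono)
    show "real (length is + length js) \<le> 4" using len by (metis of_nat_le_iff of_nat_numeral)
  qed (use C_nonneg L_nonneg beta_nonneg[of "m - 2 * l"] in auto)
  also have "2 * (4 * \<eta> l) = (16 * C + 24 * L) / real l ^ 6" by simp
  also have "(16 * C + 24 * L) / real l ^ 6 + 6 * \<beta> (m - 2 * l) = \<gamma> m" using False by (simp add: \<gamma>_def l_def)
  finally show ?thesis unfolding e unfolding is'_js'_def pa_shift .
qed

lemma cov_a:
  assumes t: "t \<in> T"
  shows "\<bar>expectation (\<lambda>\<omega>. a t i \<omega> * a t j \<omega>)\<bar> \<le> \<gamma> (nat \<bar>i - j\<bar>)"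
proof -
  have *: "\<bar>expectation (\<lambda>\<omega>. a t i \<omega> * a t j \<omega>)\<bar> \<le> \<gamma> (nat \<bar>i - j\<bar>)" if "i \<le> j" for i j
    using pa_cov[OF t, of "[i]" "[j]" "nat \<bar>i - j\<bar>"] that a_mean[of t] by (simp add: pa_simps[abs_def])
  show ?thesis
  proof (cases "i \<le> j")
    case False
    then show ?thesis using *[of j i] by (simp add: mult.commute abs_minus_commute)
  qed (rule *)
qed

text \<open>One of the two weights is dropped because it is at most 1, the other is kept while
  \<open>\<gamma>\<close> is summed. This makes the bound linear in the total weight, which for the
  HAC weights means the order \<open>b n\<close> instead of its square.\<close>

lemma weighted_sum_a:
  assumes t: "t \<in> T" and A: "finite A" and w: "\<And>i. i \<in> A \<Longrightarrow> 0 \<le> w i" "\<And>i. i \<in> A \<Longrightarrow> w i \<le> 1"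
  shows "expectation (\<lambda>\<omega>. (\<Sum>i\<in>A. w i * a t i \<omega>)\<^sup>2) \<le> 2 * \<Gamma> * (\<Sum>i\<in>A. w i)"
proof -
  have ii: "integrable M (\<lambda>\<omega>. (w i * w j) * (a t i \<omega> * a t j \<omega>))" for i j
    by (intro integrable_mult_right integrable_bounded[where B = 1]) (auto intro!: abs_mult_le_one a_bound)
  have "expectation (\<lambda>\<omega>. (\<Sum>i\<in>A. w i * a t i \<omega>)\<^sup>2) = expectation (\<lambda>\<omega>. \<Sum>i\<in>A. \<Sum>j\<in>A. (w i * w j) * (a t i \<omega> * a t j \<omega>))"
    by (simp add: power2_eq_square sum_product ac_simps)
  also have "\<dots> = (\<Sum>i\<in>A. \<Sum>j\<in>A. (w i * w j) * expectation (\<lambda>\<omega>. a t i \<omega> * a t j \<omega>))"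
    using ii by (simp add: Bochner_Integration.integral_sum integrable_sum)
  also have "\<dots> \<le> (\<Sum>i\<in>A. \<Sum>j\<in>A. w i * \<gamma> (nat \<bar>i - j\<bar>))"
  proof (intro sum_mono)
    fix i j assume ij: "i \<in> A" "j \<in> A"
    have "(w i * w j) * expectation (\<lambda>\<omega>. a t i \<omega> * a t j \<omega>) \<le> (w i * w j) * \<gamma> (nat \<bar>i - j\<bar>)"
      using cov_a[OF t, of i j] w ij by (intro mult_left_mono) auto
    also have "\<dots> \<le> (w i * 1) * \<gamma> (nat \<bar>i - j\<bar>)"
      using w ij by (intro mult_right_mono mult_left_mono gamma_nonneg) auto
    finally show "(w i * w j) * expectation (\<lambda>\<omega>. a t i \<omega> * a t j \<omega>) \<le> w i * \<gamma> (nat \<bar>i - j\<bar>)" by simp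
  qed
  also have "\<dots> = (\<Sum>i\<in>A. w i * (\<Sum>j\<in>A. \<gamma> (nat \<bar>i - j\<bar>)))" by (simp add: sum_distrib_left)
  also have "\<dots> \<le> (\<Sum>i\<in>A. w i * (2 * \<Gamma>))" by (intro sum_mono mult_left_mono sum_gamma_int_le A w)
  also have "\<dots> = 2 * \<Gamma> * (\<Sum>i\<in>A. w i)" by (subst sum_distrib_right[symmetric]) (simp add: mult.commute)
  finally show ?thesis .
qed

definition acov :: "real \<Rightarrow> nat \<Rightarrow> real" where
  "acov t r = expectation (\<lambda>\<omega>. a t 0 \<omega> * a t (int r) \<omega>)"

lemma acov_eq: "expectation (\<lambda>\<omega>. a t i \<omega> * a t (i + int r) \<omega>) = acov t r"
  using pa_shift[of t i "[0, int r]"] by (simp add: acov_def pa_simps[abs_def] add.commute)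

lemma acov_bound: "t \<in> T \<Longrightarrow> \<bar>acov t r\<bar> \<le> \<gamma> r"
  using cov_a[of t 0 "int r"] by (simp add: acov_def)

text \<open>Four factors, two patterns. If the stretches \<open>i..i + r\<close> and
  \<open>k..k + r\<close> are disjoint, the two products are decoupled from each other. If they
  overlap, the leftmost factor, of mean zero, is decoupled from the other three; then nothing
  cancels the squared autocovariance, whence the term \<open>(\<gamma> r)\<^sup>2\<close>.\<close>

lemma product_cov:
  assumes t: "t \<in> T"
  shows "\<bar>expectation (\<lambda>\<omega>. (a t i \<omega> * a t (i + int r) \<omega> - acov t r) * (a t k \<omega> * a t (k + int r) \<omega> - acov t r))\<bar>
    \<le> \<gamma> (nat \<bar>i + int r - k\<bar>) + \<gamma> (nat \<bar>i - int r - k\<bar>) + \<gamma> (nat \<bar>i - k\<bar>) + (if \<bar>i - k\<bar> \<le> int r then (\<gamma> r)\<^sup>2 else 0)"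
proof -
  let ?b = "\<lambda>i \<omega>. a t i \<omega> * a t (i + int r) \<omega>"
  have b1: "\<bar>?b i \<omega>\<bar> \<le> 1" for i \<omega> by (intro abs_mult_le_one a_bound)
  have ib: "integrable M (?b i)" for i by (rule integrable_bounded[where B = 1]) (use b1 in auto)
  have ibb: "integrable M (\<lambda>\<omega>. ?b i \<omega> * ?b k \<omega>)" for i k
    by (rule integrable_bounded[where B = 1]) (use b1 abs_mult_le_one in auto)
  have ex: "expectation (\<lambda>\<omega>. (?b i \<omega> - acov t r) * (?b k \<omega> - acov t r)) = expectation (\<lambda>\<omega>. ?b i \<omega> * ?b k \<omega>) - (acov t r)\<^sup>2" for i k
  proof -
    have "(\<lambda>\<omega>. (?b i \<omega> - acov t r) * (?b k \<omega> - acov t r)) = (\<lambda>\<omega>. ?b i \<omega> * ?b k \<omega> - acov t r * ?b i \<omega> - acov t r * ?b k \<omega> + (acov t r)\<^sup>2)"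
      by (auto simp: algebra_simps power2_eq_square)
    then show ?thesis using ib ibb by (simp add: acov_eq prob_space power2_eq_square)
  qed
  have main: "\<bar>expectation (\<lambda>\<omega>. ?b i \<omega> * ?b k \<omega>) - (acov t r)\<^sup>2\<bar>
     \<le> \<gamma> (nat \<bar>i + int r - k\<bar>) + \<gamma> (nat \<bar>i - k\<bar>) + (if \<bar>i - k\<bar> \<le> int r then (\<gamma> r)\<^sup>2 else 0)" if ik: "i \<le> k" for i k
  proof (cases "k - i \<le> int r")
    case True
    have "expectation (pa t ([i] @ [i + int r, k, k + int r])) = expectation (\<lambda>\<omega>. ?b i \<omega> * ?b k \<omega>)"
      by (simp add: pa_simps[abs_def] mult.assoc)
    moreover have "\<bar>expectation (pa t ([i] @ [i + int r, k, k + int r])) - expectation (pa t [i]) * expectation (pa t [i + int r, k, k + int r])\<bar> \<le> \<gamma> (nat \<bar>i - k\<bar>)"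
      by (rule pa_cov[OF t]) (use ik True in auto)
    moreover have "expectation (pa t [i]) = 0" using a_mean[of t i] by (simp add: pa_simps[abs_def])
    ultimately have "\<bar>expectation (\<lambda>\<omega>. ?b i \<omega> * ?b k \<omega>)\<bar> \<le> \<gamma> (nat \<bar>i - k\<bar>)" by simp
    moreover have "(acov t r)\<^sup>2 \<le> (\<gamma> r)\<^sup>2"
      using acov_bound[OF t, of r] gamma_nonneg[of r] by (intro abs_le_square_iff[THEN iffD1]) simp
    moreover have "(if \<bar>i - k\<bar> \<le> int r then (\<gamma> r)\<^sup>2 else 0) = (\<gamma> r)\<^sup>2" using True ik by simp
    ultimately show ?thesis using gamma_nonneg[of "nat \<bar>i + int r - k\<bar>"] zero_le_power2[of "acov t r"] by linarith
  next
    case False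
    have "expectation (pa t ([i, i + int r] @ [k, k + int r])) = expectation (\<lambda>\<omega>. ?b i \<omega> * ?b k \<omega>)"
      by (simp add: pa_simps[abs_def] mult.assoc)
    moreover have "\<bar>expectation (pa t ([i, i + int r] @ [k, k + int r])) - expectation (pa t [i, i + int r]) * expectation (pa t [k, k + int r])\<bar> \<le> \<gamma> (nat \<bar>i + int r - k\<bar>)"
      by (rule pa_cov[OF t]) (use False in auto)
    moreover have "expectation (pa t [i, i + int r]) = acov t r" for i using acov_eq[of t i r] by (simp add: pa_simps[abs_def])
    ultimately have "\<bar>expectation (\<lambda>\<omega>. ?b i \<omega> * ?b k \<omega>) - (acov t r)\<^sup>2\<bar> \<le> \<gamma> (nat \<bar>i + int r - k\<bar>)" by (simp add: power2_eq_square)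
    then show ?thesis using gamma_nonneg[of "nat \<bar>i - k\<bar>"] False by simp
  qed
  show ?thesis
  proof (cases "i \<le> k")
    case True
    then show ?thesis unfolding ex using main[OF True] gamma_nonneg[of "nat \<bar>i - int r - k\<bar>"] by linarith
  next
    case False
    then have ki: "k \<le> i" by simp
    have e: "\<bar>k + int r - i\<bar> = \<bar>i - int r - k\<bar>" "\<bar>k - i\<bar> = \<bar>i - k\<bar>" by linarith+
    have "expectation (\<lambda>\<omega>. ?b k \<omega> * ?b i \<omega>) = expectation (\<lambda>\<omega>. ?b i \<omega> * ?b k \<omega>)" by (simp add: mult.commute)
    then show ?thesis unfolding ex using main[OF ki, unfolded e] gamma_nonneg[of "nat \<bar>i + int r - k\<bar>"] by linarith
  qed
qed

definition \<Gamma>1 :: real where "\<Gamma>1 = suminf (\<lambda>m. real m * \<gamma> m)"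

text \<open>Three row sums of \<open>\<gamma>\<close> give \<open>6 * \<Gamma>\<close>. At most
  \<open>2 * r + 1\<close> indices overlap, and \<open>(2 * r + 1) * (\<gamma> r)\<^sup>2\<close> is
  at most \<open>(2 * \<Gamma>1 + \<Gamma>) * \<Gamma>\<close> whatever \<open>r\<close> is, so the
  variance bound is uniform in the lag.\<close>

definition \<Lambda> :: real where "\<Lambda> = 6 * \<Gamma> + (2 * \<Gamma>1 + \<Gamma>) * \<Gamma>"

lemma gamma_le: "\<gamma> r \<le> \<Gamma>" "real r * \<gamma> r \<le> \<Gamma>1"
proof -
  show "\<gamma> r \<le> \<Gamma>" using sum_gamma_le[of "{r}"] by simp
  show "real r * \<gamma> r \<le> \<Gamma>1" unfolding \<Gamma>1_def
    using sum_le_suminf[OF summable_gamma_weighted, of "{r}"] gamma_nonneg by simp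
qed

lemma acov_sum_variance:
  assumes t: "t \<in> T" and A: "finite A"
  shows "expectation (\<lambda>\<omega>. (\<Sum>i\<in>A. a t i \<omega> * a t (i + int r) \<omega> - acov t r)\<^sup>2) \<le> real (card A) * \<Lambda>"
proof -
  let ?b = "\<lambda>i \<omega>. a t i \<omega> * a t (i + int r) \<omega> - acov t r"
  have b1: "\<bar>a t i \<omega> * a t (i + int r) \<omega>\<bar> \<le> 1" for i \<omega> by (intro abs_mult_le_one a_bound)
  have b2: "\<bar>?b i \<omega>\<bar> \<le> 1 + \<bar>acov t r\<bar>" for i \<omega> using b1[of i \<omega>] by linarith
  have ii: "integrable M (\<lambda>\<omega>. ?b i \<omega> * ?b j \<omega>)" for i j
    by (rule integrable_bounded[where B = "(1 + \<bar>acov t r\<bar>) * (1 + \<bar>acov t r\<bar>)"])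
       (simp, unfold abs_mult, intro mult_mono b2, auto)
  have "expectation (\<lambda>\<omega>. (\<Sum>i\<in>A. ?b i \<omega>)\<^sup>2) = expectation (\<lambda>\<omega>. \<Sum>i\<in>A. \<Sum>j\<in>A. ?b i \<omega> * ?b j \<omega>)"
    by (simp add: power2_eq_square sum_product)
  also have "\<dots> = (\<Sum>i\<in>A. \<Sum>j\<in>A. expectation (\<lambda>\<omega>. ?b i \<omega> * ?b j \<omega>))"
    using ii by (subst Bochner_Integration.integral_sum, intro Bochner_Integration.integrable_sum, assumption) (intro sum.cong refl Bochner_Integration.integral_sum)
  also have "\<dots> \<le> (\<Sum>i\<in>A. \<Sum>j\<in>A. \<gamma> (nat \<bar>i + int r - j\<bar>) + \<gamma> (nat \<bar>i - int r - j\<bar>) + \<gamma> (nat \<bar>i - j\<bar>) + (if \<bar>i - j\<bar> \<le> int r then (\<gamma> r)\<^sup>2 else 0))"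
    by (intro sum_mono) (rule order_trans[OF abs_ge_self product_cov[OF t]])
  also have "\<dots> \<le> (\<Sum>i\<in>A. \<Lambda>)"
  proof (rule sum_mono)
    fix i assume "i \<in> A"
    have "(\<Sum>j\<in>A. if \<bar>i - j\<bar> \<le> int r then (\<gamma> r)\<^sup>2 else 0) = (\<Sum>j\<in>{j\<in>A. \<bar>i - j\<bar> \<le> int r}. (\<gamma> r)\<^sup>2)"
      by (rule sum.inter_filter[OF A, symmetric])
    also have "\<dots> = real (card {j\<in>A. \<bar>i - j\<bar> \<le> int r}) * (\<gamma> r)\<^sup>2" by simp
    also have "\<dots> \<le> real (card {i - int r..i + int r}) * (\<gamma> r)\<^sup>2"
      by (intro mult_right_mono of_nat_mono card_mono) auto
    also have "\<dots> = (2 * (real r * \<gamma> r) + \<gamma> r) * \<gamma> r" by (simp add: power2_eq_square algebra_simps of_nat_nat)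
    also have "\<dots> \<le> (2 * \<Gamma>1 + \<Gamma>) * \<Gamma>"
      using gamma_le[of r] gamma_nonneg[of r] Gamma_ge mult_nonneg_nonneg[of "real r" "\<gamma> r"]
      by (intro mult_mono add_mono) linarith+
    finally show "(\<Sum>j\<in>A. \<gamma> (nat \<bar>i + int r - j\<bar>) + \<gamma> (nat \<bar>i - int r - j\<bar>) + \<gamma> (nat \<bar>i - j\<bar>) + (if \<bar>i - j\<bar> \<le> int r then (\<gamma> r)\<^sup>2 else 0)) \<le> \<Lambda>"
      using sum_gamma_int_le[OF A, of "i + int r"] sum_gamma_int_le[OF A, of "i - int r"] sum_gamma_int_le[OF A, of i]
      unfolding sum.distrib \<Lambda>_def by linarith
  qed
  finally show ?thesis by simp
qed

text \<open>The cost of estimating the projection \<open>H t (X i)\<close> by a row average of the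
  kernel matrix.\<close>

definition R :: "real \<Rightarrow> nat \<Rightarrow> int \<Rightarrow> 'a \<Rightarrow> real" where
  "R t n i \<omega> = (\<Sum>j\<in>{1..int n}. h_ker g (X i \<omega>) (X j \<omega>) t) / real n - H t (X i \<omega>)"

lemma R_meas [measurable]: "R t n i \<in> borel_measurable M"
  unfolding R_def by measurable

text \<open>Each squared remainder is a double average of \<open>\<Psi>\<close> over
  \<open>j\<close> and \<open>k\<close>. Every gap term involves only two of the three indices, so
  the triple sum is of order \<open>n\<^sup>2\<close>, and all \<open>n\<close> squares together
  stay bounded.\<close>

lemma R_second_moment:
  assumes t: "t \<in> T" and n: "1 \<le> n"
  shows "expectation (\<lambda>\<omega>. \<Sum>i\<in>{1..int n}. (R t n i \<omega>)\<^sup>2) \<le> 6 * \<Gamma>"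
proof -
  let ?I = "{1..int n}"
  have R: "R t n i \<omega> = (\<Sum>j\<in>?I. h_ker g (X i \<omega>) (X j \<omega>) t - H t (X i \<omega>)) / real n" for i \<omega>
    using n by (simp add: R_def sum_subtractf diff_divide_distrib)
  have iP: "integrable M (\<lambda>\<omega>. \<Psi> t (X i \<omega>) (X j \<omega>) (X k \<omega>))" for i j k
    by (rule integrable_bounded[where B = 1]) (use \<Psi>_bound in auto)
  have "(\<lambda>\<omega>. \<Sum>i\<in>?I. (R t n i \<omega>)\<^sup>2) = (\<lambda>\<omega>. (\<Sum>i\<in>?I. \<Sum>j\<in>?I. \<Sum>k\<in>?I. \<Psi> t (X i \<omega>) (X j \<omega>) (X k \<omega>)) / (real n)\<^sup>2)"
    by (simp add: R power_divide sum_divide_distrib[symmetric] power2_eq_square sum_product \<Psi>_def)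
  then have "expectation (\<lambda>\<omega>. \<Sum>i\<in>?I. (R t n i \<omega>)\<^sup>2) = (\<Sum>i\<in>?I. \<Sum>j\<in>?I. \<Sum>k\<in>?I. expectation (\<lambda>\<omega>. \<Psi> t (X i \<omega>) (X j \<omega>) (X k \<omega>))) / (real n)\<^sup>2"
    using iP by (simp add: Bochner_Integration.integral_sum Bochner_Integration.integrable_sum)
  also have "\<dots> \<le> (\<Sum>i\<in>?I. \<Sum>j\<in>?I. \<Sum>k\<in>?I. \<gamma> (nat \<bar>i - j\<bar>) + \<gamma> (nat \<bar>i - k\<bar>) + \<gamma> (nat \<bar>j - k\<bar>)) / (real n)\<^sup>2"
    by (intro divide_right_mono sum_mono) (rule order_trans[OF abs_ge_self \<Psi>_expectation_bound[OF t]], simp)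
  also have "\<dots> \<le> (6 * \<Gamma> * (real n)\<^sup>2) / (real n)\<^sup>2"
  proof (rule divide_right_mono)
    have s: "(\<Sum>i\<in>?I. \<Sum>j\<in>?I. \<gamma> (nat \<bar>i - j\<bar>)) \<le> real n * (2 * \<Gamma>)"
      using sum_mono[of ?I "\<lambda>i. \<Sum>j\<in>?I. \<gamma> (nat \<bar>i - j\<bar>)" "\<lambda>_. 2 * \<Gamma>"] sum_gamma_int_le[of ?I] by simp
    have "(\<Sum>i\<in>?I. \<Sum>j\<in>?I. \<Sum>k\<in>?I. \<gamma> (nat \<bar>i - j\<bar>)) = real n * (\<Sum>i\<in>?I. \<Sum>j\<in>?I. \<gamma> (nat \<bar>i - j\<bar>))"
      by (simp add: sum_distrib_left)
    moreover have "(\<Sum>i\<in>?I. \<Sum>j\<in>?I. \<Sum>k\<in>?I. \<gamma> (nat \<bar>i - k\<bar>)) = real n * (\<Sum>i\<in>?I. \<Sum>k\<in>?I. \<gamma> (nat \<bar>i - k\<bar>))"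
      by (simp add: sum_distrib_left)
    moreover have "(\<Sum>i\<in>?I. \<Sum>j\<in>?I. \<Sum>k\<in>?I. \<gamma> (nat \<bar>j - k\<bar>)) = real n * (\<Sum>j\<in>?I. \<Sum>k\<in>?I. \<gamma> (nat \<bar>j - k\<bar>))"
      by simp
    ultimately have "(\<Sum>i\<in>?I. \<Sum>j\<in>?I. \<Sum>k\<in>?I. \<gamma> (nat \<bar>i - j\<bar>) + \<gamma> (nat \<bar>i - k\<bar>) + \<gamma> (nat \<bar>j - k\<bar>)) = 3 * (real n * (\<Sum>i\<in>?I. \<Sum>j\<in>?I. \<gamma> (nat \<bar>i - j\<bar>)))"
      unfolding sum.distrib by linarith
    also have "\<dots> \<le> 3 * (real n * (real n * (2 * \<Gamma>)))" by (intro mult_left_mono s) auto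
    also have "\<dots> = 6 * \<Gamma> * (real n)\<^sup>2" by (simp add: power2_eq_square)
    finally show "(\<Sum>i\<in>?I. \<Sum>j\<in>?I. \<Sum>k\<in>?I. \<gamma> (nat \<bar>i - j\<bar>) + \<gamma> (nat \<bar>i - k\<bar>) + \<gamma> (nat \<bar>j - k\<bar>)) \<le> 6 * \<Gamma> * (real n)\<^sup>2" .
  qed simp
  also have "\<dots> = 6 * \<Gamma>" using n by simp
  finally show ?thesis .
qed

end

section \<open>Convergence in probability\<close>

context prob_space
begin

text \<open>Exceptional events: estimates are proved pointwise off them, and the events of several
  estimates are collected by unions.\<close>

definition vanishing :: "(nat \<Rightarrow> 'a set) \<Rightarrow> bool" where
  "vanishing B \<longleftrightarrow> (\<forall>n. B n \<in> events) \<and> (\<lambda>n. prob (B n)) \<longlonglongrightarrow> 0"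

lemma vanishing_subset:
  assumes B: "vanishing B" and A: "\<And>n. A n \<in> events" and sub: "\<forall>\<^sub>F n in sequentially. A n \<subseteq> B n"
  shows "vanishing A"
proof -
  have "(\<lambda>n. prob (A n)) \<longlonglongrightarrow> 0"
  proof (rule tendsto_sandwich[OF _ _ tendsto_const])
    show "(\<lambda>n. prob (B n)) \<longlonglongrightarrow> 0" using B by (simp add: vanishing_def)
    show "\<forall>\<^sub>F n in sequentially. prob (A n) \<le> prob (B n)"
      using sub by eventually_elim (use B in \<open>auto intro!: finite_measure_mono simp: vanishing_def\<close>)
  qed auto
  then show ?thesis using A by (simp add: vanishing_def)
qed

lemma vanishing_Un:
  assumes A: "vanishing A" and B: "vanishing B"
  shows "vanishing (\<lambda>n. A n \<union> B n)"
proof -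
  have m: "A n \<in> events" "B n \<in> events" for n using A B by (auto simp: vanishing_def)
  have "(\<lambda>n. prob (A n \<union> B n)) \<longlonglongrightarrow> 0"
  proof (rule tendsto_sandwich[OF _ _ tendsto_const])
    show "(\<lambda>n. prob (A n) + prob (B n)) \<longlonglongrightarrow> 0"
      using tendsto_add[of "\<lambda>n. prob (A n)" 0 sequentially "\<lambda>n. prob (B n)" 0] A B by (simp add: vanishing_def)
    show "\<forall>\<^sub>F n in sequentially. prob (A n \<union> B n) \<le> prob (A n) + prob (B n)"
      using m by (intro always_eventually allI measure_Un_le) auto
  qed auto
  then show ?thesis using m by (simp add: vanishing_def)
qed

lemma tendsto_in_prob_iff:
  "tendsto_in_prob M Y c \<longleftrightarrow> (\<forall>n. Y n \<in> borel_measurable M) \<and> (\<forall>\<epsilon>>0. vanishing (\<lambda>n. {\<omega> \<in> space M. \<epsilon> < \<bar>Y n \<omega> - c\<bar>}))"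
proof -
  have "{\<omega> \<in> space M. \<epsilon> < \<bar>Y n \<omega> - c\<bar>} \<in> events" if "\<forall>n. Y n \<in> borel_measurable M" for n \<epsilon>
  proof -
    have [measurable]: "Y n \<in> borel_measurable M" using that by blast
    show ?thesis by measurable
  qed
  then show ?thesis unfolding tendsto_in_prob_def vanishing_def by blast
qed

lemma tendsto_in_probD:
  assumes "tendsto_in_prob M Y c" "0 < \<epsilon>"
  shows "vanishing (\<lambda>n. {\<omega> \<in> space M. \<epsilon> < \<bar>Y n \<omega> - c\<bar>})"
  using assms by (simp add: tendsto_in_prob_iff)

lemma tendsto_in_prob_meas: "tendsto_in_prob M Y c \<Longrightarrow> Y n \<in> borel_measurable M"
  by (simp add: tendsto_in_prob_def)

lemma tendsto_in_probI:
  assumes m: "\<And>n. Y n \<in> borel_measurable M"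
    and *: "\<And>\<epsilon>. 0 < \<epsilon> \<Longrightarrow> \<exists>B. vanishing B \<and> (\<forall>\<^sub>F n in sequentially. \<forall>\<omega>\<in>space M - B n. \<bar>Y n \<omega> - c\<bar> \<le> \<epsilon>)"
  shows "tendsto_in_prob M Y c"
  unfolding tendsto_in_prob_iff
proof (intro conjI allI impI m)
  fix \<epsilon> :: real assume "0 < \<epsilon>"
  from *[OF this] obtain B where B: "vanishing B" "\<forall>\<^sub>F n in sequentially. \<forall>\<omega>\<in>space M - B n. \<bar>Y n \<omega> - c\<bar> \<le> \<epsilon>" by blast
  have [measurable]: "Y n \<in> borel_measurable M" for n by (rule m)
  show "vanishing (\<lambda>n. {\<omega> \<in> space M. \<epsilon> < \<bar>Y n \<omega> - c\<bar>})"
  proof (rule vanishing_subset[OF B(1)])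
    show "\<forall>\<^sub>F n in sequentially. {\<omega> \<in> space M. \<epsilon> < \<bar>Y n \<omega> - c\<bar>} \<subseteq> B n"
      using B(2) by eventually_elim force
  qed measurable
qed

lemma tendsto_in_prob_L1:
  assumes m: "\<And>n. Y n \<in> borel_measurable M"
    and int: "\<forall>\<^sub>F n in sequentially. integrable M (Y n) \<and> expectation (\<lambda>\<omega>. \<bar>Y n \<omega> - c\<bar>) \<le> e n" and e: "e \<longlonglongrightarrow> 0"
  shows "tendsto_in_prob M Y c"
  unfolding tendsto_in_prob_def
proof (intro conjI allI impI m)
  fix \<epsilon> :: real assume \<epsilon>: "0 < \<epsilon>"
  have [measurable]: "Y n \<in> borel_measurable M" for n by (rule m)
  show "(\<lambda>n. prob {\<omega> \<in> space M. \<epsilon> < \<bar>Y n \<omega> - c\<bar>}) \<longlonglongrightarrow> 0"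
  proof (rule tendsto_sandwich[OF _ _ tendsto_const])
    show "(\<lambda>n. e n / \<epsilon>) \<longlonglongrightarrow> 0" using tendsto_divide[OF e tendsto_const, of \<epsilon>] \<epsilon> by simp
    show "\<forall>\<^sub>F n in sequentially. prob {\<omega> \<in> space M. \<epsilon> < \<bar>Y n \<omega> - c\<bar>} \<le> e n / \<epsilon>"
      using int
    proof eventually_elim
      case (elim n)
      have "prob {\<omega> \<in> space M. \<epsilon> < \<bar>Y n \<omega> - c\<bar>} \<le> prob {\<omega> \<in> space M. \<epsilon> \<le> \<bar>Y n \<omega> - c\<bar>}"
        by (rule finite_measure_mono) auto
      also have "\<dots> \<le> expectation (\<lambda>\<omega>. \<bar>Y n \<omega> - c\<bar>) / \<epsilon>"
        by (rule integral_Markov_inequality_measure[where A = "{}"]) (use elim \<epsilon> in auto)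
      also have "\<dots> \<le> e n / \<epsilon>" using elim \<epsilon> by (intro divide_right_mono) auto
      finally show ?case .
    qed
  qed auto
qed

lemma tendsto_in_prob_cont2:
  fixes F :: "real \<times> real \<Rightarrow> real"
  assumes X: "tendsto_in_prob M X x" and Y: "tendsto_in_prob M Y y"
    and F: "isCont F (x, y)" and m: "\<And>n. (\<lambda>\<omega>. F (X n \<omega>, Y n \<omega>)) \<in> borel_measurable M"
  shows "tendsto_in_prob M (\<lambda>n \<omega>. F (X n \<omega>, Y n \<omega>)) (F (x, y))"
proof (rule tendsto_in_probI[OF m])
  fix \<epsilon> :: real assume "0 < \<epsilon>"
  then obtain \<delta> where \<delta>: "0 < \<delta>" "\<And>z. dist z (x, y) < \<delta> \<Longrightarrow> dist (F z) (F (x, y)) < \<epsilon>"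
    using F unfolding continuous_at_eps_delta by (auto simp: continuous_at_eps_delta)
  let ?A = "\<lambda>n. {\<omega> \<in> space M. \<delta>/3 < \<bar>X n \<omega> - x\<bar>}" and ?B = "\<lambda>n. {\<omega> \<in> space M. \<delta>/3 < \<bar>Y n \<omega> - y\<bar>}"
  show "\<exists>B. vanishing B \<and> (\<forall>\<^sub>F n in sequentially. \<forall>\<omega>\<in>space M - B n. \<bar>F (X n \<omega>, Y n \<omega>) - F (x, y)\<bar> \<le> \<epsilon>)"
  proof (intro exI[of _ "\<lambda>n. ?A n \<union> ?B n"] conjI always_eventually allI ballI)
    show "vanishing (\<lambda>n. ?A n \<union> ?B n)"
      using \<delta> by (intro vanishing_Un tendsto_in_probD X Y) auto
    fix n \<omega> assume w: "\<omega> \<in> space M - (?A n \<union> ?B n)"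
    then have "\<bar>X n \<omega> - x\<bar> \<le> \<delta>/3" "\<bar>Y n \<omega> - y\<bar> \<le> \<delta>/3" by auto
    moreover have "dist (X n \<omega>, Y n \<omega>) (x, y) \<le> \<bar>X n \<omega> - x\<bar> + \<bar>Y n \<omega> - y\<bar>"
      by (rule dist_prod_le)
    ultimately have "dist (X n \<omega>, Y n \<omega>) (x, y) < \<delta>" using \<delta>(1) by linarith
    from \<delta>(2)[OF this] show "\<bar>F (X n \<omega>, Y n \<omega>) - F (x, y)\<bar> \<le> \<epsilon>" by (simp add: dist_real_def)
  qed
qed

lemma tendsto_in_prob_add:
  assumes X: "tendsto_in_prob M X x" and Y: "tendsto_in_prob M Y y"
  shows "tendsto_in_prob M (\<lambda>n \<omega>. X n \<omega> + Y n \<omega>) (x + y)"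
  using tendsto_in_prob_cont2[OF X Y, of "\<lambda>z. fst z + snd z"] tendsto_in_prob_meas[OF X] tendsto_in_prob_meas[OF Y]
  by (simp add: continuous_intros)

lemma tendsto_in_prob_const: "tendsto_in_prob M (\<lambda>n \<omega>. c) c"
  by (rule tendsto_in_prob_L1[where e = "\<lambda>_. 0"]) auto

lemma tendsto_in_prob_cmult:
  assumes X: "tendsto_in_prob M X x"
  shows "tendsto_in_prob M (\<lambda>n \<omega>. c * X n \<omega>) (c * x)"
  using tendsto_in_prob_cont2[OF X X, of "\<lambda>z. c * fst z"] tendsto_in_prob_meas[OF X]
  by (simp add: continuous_intros)

lemma tendsto_in_prob_sum:
  assumes "finite A" "\<And>i. i \<in> A \<Longrightarrow> tendsto_in_prob M (X i) (x i)"
  shows "tendsto_in_prob M (\<lambda>n \<omega>. \<Sum>i\<in>A. X i n \<omega>) (\<Sum>i\<in>A. x i)"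
  using assms
proof (induction A rule: finite_induct)
  case empty
  then show ?case using tendsto_in_prob_const[of 0] by simp
next
  case (insert i A)
  then show ?case using tendsto_in_prob_add[of "X i" "x i"] by simp
qed

text \<open>\<open>y\<close> is bounded in mean, hence tight: off an event of small probability it
  stays below a constant \<open>K\<close>, and there the convergence of \<open>x\<close> to 0 forces
  \<open>z\<close> to be small.\<close>

lemma tendsto_in_prob_product_bound:
  assumes x: "tendsto_in_prob M x 0"
    and y: "\<And>n. y n \<in> borel_measurable M" "\<And>n \<omega>. 0 \<le> y n \<omega>"
      "\<forall>\<^sub>F n in sequentially. integrable M (y n) \<and> expectation (y n) \<le> C"
    and z: "\<And>n. z n \<in> borel_measurable M"
    and le: "\<forall>\<^sub>F n in sequentially. \<forall>\<omega>\<in>space M. (z n \<omega>)\<^sup>2 \<le> x n \<omega> * y n \<omega>"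
  shows "tendsto_in_prob M z 0"
  unfolding tendsto_in_prob_def
proof (intro conjI allI impI z)
  fix \<epsilon> :: real assume \<epsilon>: "0 < \<epsilon>"
  note [measurable] = y(1) z tendsto_in_prob_meas[OF x]
  have C: "0 < \<bar>C\<bar> + 1" by simp
  show "(\<lambda>n. prob {\<omega> \<in> space M. \<epsilon> < \<bar>z n \<omega> - 0\<bar>}) \<longlonglongrightarrow> 0"
    unfolding tendsto_iff
  proof (intro allI impI)
    fix \<rho> :: real assume \<rho>: "0 < \<rho>"
    \<comment> \<open>Markov's inequality then gives \<open>K \<le> y n\<close> probability at most
      \<open>\<rho> / 2\<close>, while \<open>\<tau> * K = \<epsilon>\<^sup>2\<close>.\<close>
    define K where "K = 2 * (\<bar>C\<bar> + 1) / \<rho>"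
    define \<tau> where "\<tau> = \<epsilon>\<^sup>2 / K"
    have K: "0 < K" using \<rho> by (simp add: K_def)
    have \<tau>: "0 < \<tau>" using \<epsilon> K by (simp add: \<tau>_def)
    have "(\<lambda>n. prob {\<omega> \<in> space M. \<tau> < \<bar>x n \<omega> - 0\<bar>}) \<longlonglongrightarrow> 0"
      using tendsto_in_probD[OF x \<tau>] unfolding vanishing_def by blast
    from order_tendstoD(2)[OF this, of "\<rho> / 2"] \<rho>
    have "\<forall>\<^sub>F n in sequentially. prob {\<omega> \<in> space M. \<tau> < \<bar>x n \<omega> - 0\<bar>} < \<rho> / 2"
      by linarith
    with y(3) le show "\<forall>\<^sub>F n in sequentially. dist (prob {\<omega> \<in> space M. \<epsilon> < \<bar>z n \<omega> - 0\<bar>}) 0 < \<rho>"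
    proof eventually_elim
      case (elim n)
      have "prob {\<omega> \<in> space M. K \<le> y n \<omega>} \<le> expectation (y n) / K"
        by (rule integral_Markov_inequality_measure[where A = "{}"]) (use elim K y(2) in auto)
      also have "\<dots> \<le> (\<bar>C\<bar> + 1) / K" using elim K by (intro divide_right_mono) auto
      also have "c / (2 * c / \<rho>) = \<rho> / 2" if "0 < c" for c using that by simp
      from this[OF C] have "(\<bar>C\<bar> + 1) / K = \<rho> / 2" by (simp only: K_def)
      finally have 1: "prob {\<omega> \<in> space M. K \<le> y n \<omega>} \<le> \<rho> / 2" .
      have "{\<omega> \<in> space M. \<epsilon> < \<bar>z n \<omega> - 0\<bar>} \<subseteq> {\<omega> \<in> space M. \<tau> < \<bar>x n \<omega> - 0\<bar>} \<union> {\<omega> \<in> space M. K \<le> y n \<omega>}"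
      proof (rule subsetI, rule ccontr)
        fix \<omega> assume w: "\<omega> \<in> {\<omega> \<in> space M. \<epsilon> < \<bar>z n \<omega> - 0\<bar>}"
          and n: "\<omega> \<notin> {\<omega> \<in> space M. \<tau> < \<bar>x n \<omega> - 0\<bar>} \<union> {\<omega> \<in> space M. K \<le> y n \<omega>}"
        then have xy: "\<bar>x n \<omega>\<bar> \<le> \<tau>" "y n \<omega> \<le> K" by auto
        have "\<epsilon>\<^sup>2 < (z n \<omega>)\<^sup>2" using w \<epsilon> abs_le_square_iff[of "z n \<omega>" \<epsilon>] by (auto simp: not_le)
        also have "\<dots> \<le> x n \<omega> * y n \<omega>" using elim w by auto
        also have "\<dots> \<le> \<bar>x n \<omega>\<bar> * y n \<omega>" by (intro mult_right_mono y) auto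
        also have "\<dots> \<le> \<tau> * K" using xy y(2) \<tau> by (intro mult_mono) auto
        also have "\<dots> = \<epsilon>\<^sup>2" using K by (simp add: \<tau>_def)
        finally show False by simp
      qed
      then have "prob {\<omega> \<in> space M. \<epsilon> < \<bar>z n \<omega> - 0\<bar>} \<le> prob ({\<omega> \<in> space M. \<tau> < \<bar>x n \<omega> - 0\<bar>} \<union> {\<omega> \<in> space M. K \<le> y n \<omega>})"
        by (rule finite_measure_mono) measurable
      also have "\<dots> \<le> prob {\<omega> \<in> space M. \<tau> < \<bar>x n \<omega> - 0\<bar>} + prob {\<omega> \<in> space M. K \<le> y n \<omega>}"
        by (rule measure_Un_le) measurable
      finally show ?case using 1 elim by simp
    qed
  qed
qed

text \<open>The pointwise bound \<open>|Y| \<le> 1 / s + s * Y\<^sup>2\<close> with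
  \<open>s = sqrt n\<close> balances both terms; it stands in for Cauchy-Schwarz and yields the
  constant \<open>1 + K\<close>.\<close>

lemma L1_le_L2:
  assumes [measurable]: "Y \<in> borel_measurable M" and i: "integrable M (\<lambda>\<omega>. (Y \<omega>)\<^sup>2)"
    and le: "expectation (\<lambda>\<omega>. (Y \<omega>)\<^sup>2) \<le> K / real n" and n: "1 \<le> n"
  shows "integrable M Y" "expectation (\<lambda>\<omega>. \<bar>Y \<omega>\<bar>) \<le> (1 + K) / sqrt (real n)"
proof -
  define s where "s = sqrt (real n)"
  have s: "0 < s" "s\<^sup>2 = real n" using n by (auto simp: s_def)
  have pt: "\<bar>Y \<omega>\<bar> \<le> 1 / s + s * (Y \<omega>)\<^sup>2" for \<omega>
  proof (cases "\<bar>Y \<omega>\<bar> \<le> 1 / s")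
    case True
    have "0 \<le> s * (Y \<omega>)\<^sup>2" using s by simp
    with True show ?thesis by linarith
  next
    case False
    then have "1 \<le> s * \<bar>Y \<omega>\<bar>" using s by (simp add: not_le pos_divide_less_eq mult.commute less_imp_le)
    then have "\<bar>Y \<omega>\<bar> * 1 \<le> \<bar>Y \<omega>\<bar> * (s * \<bar>Y \<omega>\<bar>)" by (rule mult_left_mono) simp
    also have "\<dots> = s * (Y \<omega>)\<^sup>2" by (simp add: power2_eq_square)
    finally show ?thesis using s by (simp add: add_increasing)
  qed
  have ib: "integrable M (\<lambda>\<omega>. 1 / s + s * (Y \<omega>)\<^sup>2)" using i by auto
  show iY: "integrable M Y"
    by (rule Bochner_Integration.integrable_bound[OF ib]) (use pt in \<open>auto intro!: AE_I2 intro: order_trans[OF _ abs_ge_self]\<close>)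
  have "expectation (\<lambda>\<omega>. \<bar>Y \<omega>\<bar>) \<le> expectation (\<lambda>\<omega>. 1 / s + s * (Y \<omega>)\<^sup>2)"
    by (rule integral_mono) (use iY ib pt in auto)
  also have "\<dots> = 1 / s + s * expectation (\<lambda>\<omega>. (Y \<omega>)\<^sup>2)" using i by (simp add: prob_space)
  also have "\<dots> \<le> 1 / s + s * (K / real n)" using le s by (intro add_left_mono mult_left_mono) auto
  also have "\<dots> = (1 + K) / s" using s by (simp add: s(2)[symmetric] power2_eq_square add_divide_distrib)
  finally show "expectation (\<lambda>\<omega>. \<bar>Y \<omega>\<bar>) \<le> (1 + K) / sqrt (real n)" by (simp add: s_def)
qed

end

section \<open>Rates for V-statistics and U-statistics\<close>

context ned_kernel
begin

text \<open>The diagonal is included: this is the mean of the row averages and exactly the centring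
  term of \<open>h1_hat\<close>.\<close>

definition V :: "nat \<Rightarrow> 'a \<Rightarrow> real \<Rightarrow> real" where
  "V n \<omega> t = (\<Sum>i\<in>{1..int n}. \<Sum>j\<in>{1..int n}. h_ker g (X i \<omega>) (X j \<omega>) t) / (real n)\<^sup>2"

definition abar :: "real \<Rightarrow> nat \<Rightarrow> 'a \<Rightarrow> real" where
  "abar t n \<omega> = (\<Sum>i\<in>{1..int n}. a t i \<omega>) / real n"

lemma V_meas [measurable]: "(\<lambda>\<omega>. V n \<omega> t) \<in> borel_measurable M"
  unfolding V_def by measurable

lemma abar_meas [measurable]: "abar t n \<in> borel_measurable M"
  unfolding abar_def by measurable

text \<open>Only the projection on the first argument is split off; the fluctuation in the second
  argument stays inside \<open>R\<close>.\<close>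

lemma V_decomp:
  assumes "1 \<le> n"
  shows "V n \<omega> t - U_fun M X g t = (\<Sum>i\<in>{1..int n}. R t n i \<omega>) / real n + abar t n \<omega>"
  using assms unfolding V_def R_def abar_def a_eq
  by (simp add: sum_subtractf sum_divide_distrib[symmetric] diff_divide_distrib power2_eq_square)

lemma R_bound: "\<bar>R t n i \<omega>\<bar> \<le> 1"
proof (cases "n = 0")
  case True
  then show ?thesis by (simp add: R_def)
next
  case False
  have "(\<Sum>j\<in>{1..int n}. h_ker g (X i \<omega>) (X j \<omega>) t) \<le> (\<Sum>j\<in>{1..int n}. 1)" by (intro sum_mono) simp
  then have "(\<Sum>j\<in>{1..int n}. h_ker g (X i \<omega>) (X j \<omega>) t) / real n \<le> 1" using False by (simp add: divide_le_eq)
  moreover have "0 \<le> (\<Sum>j\<in>{1..int n}. h_ker g (X i \<omega>) (X j \<omega>) t) / real n" by (intro divide_nonneg_nonneg sum_nonneg) auto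
  ultimately show ?thesis unfolding R_def by (intro abs_diff_le_one) auto
qed

lemma R_sq_integrable: "integrable M (\<lambda>\<omega>. (R t n i \<omega>)\<^sup>2)"
  by (rule integrable_bounded[where B = 1]) (use sq_le_one[OF R_bound] in auto)

lemma abar_bound: "\<bar>abar t n \<omega>\<bar> \<le> 1"
proof (cases "n = 0")
  case True
  then show ?thesis by (simp add: abar_def)
next
  case False
  have "\<bar>\<Sum>i\<in>{1..int n}. a t i \<omega>\<bar> \<le> (\<Sum>i\<in>{1..int n}. \<bar>a t i \<omega>\<bar>)" by (rule sum_abs)
  also have "\<dots> \<le> (\<Sum>i\<in>{1..int n}. 1)" by (intro sum_mono a_bound)
  finally show ?thesis using False by (simp add: abar_def abs_divide divide_le_eq)
qed

lemma abar_sq: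
  assumes "t \<in> T" "1 \<le> n"
  shows "integrable M (\<lambda>\<omega>. (abar t n \<omega>)\<^sup>2)" "expectation (\<lambda>\<omega>. (abar t n \<omega>)\<^sup>2) \<le> 2 * \<Gamma> / real n"
proof -
  show "integrable M (\<lambda>\<omega>. (abar t n \<omega>)\<^sup>2)"
    by (rule integrable_bounded[where B = 1]) (use sq_le_one[OF abar_bound] in auto)
  have "expectation (\<lambda>\<omega>. (abar t n \<omega>)\<^sup>2) = expectation (\<lambda>\<omega>. (\<Sum>i\<in>{1..int n}. 1 * a t i \<omega>)\<^sup>2) / (real n)\<^sup>2"
    by (simp add: abar_def power_divide)
  also have "\<dots> \<le> (2 * \<Gamma> * (\<Sum>i\<in>{1..int n}. 1)) / (real n)\<^sup>2"
    by (intro divide_right_mono weighted_sum_a assms) auto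
  also have "\<dots> = 2 * \<Gamma> / real n" by (simp add: power2_eq_square)
  finally show "expectation (\<lambda>\<omega>. (abar t n \<omega>)\<^sup>2) \<le> 2 * \<Gamma> / real n" .
qed

lemma mean_R_sq:
  assumes "t \<in> T" "1 \<le> n"
  shows "integrable M (\<lambda>\<omega>. (\<Sum>i\<in>{1..int n}. (R t n i \<omega>)\<^sup>2) / real n)"
    "expectation (\<lambda>\<omega>. (\<Sum>i\<in>{1..int n}. (R t n i \<omega>)\<^sup>2) / real n) \<le> 6 * \<Gamma> / real n"
proof -
  show "integrable M (\<lambda>\<omega>. (\<Sum>i\<in>{1..int n}. (R t n i \<omega>)\<^sup>2) / real n)"
    by (intro Bochner_Integration.integrable_divide Bochner_Integration.integrable_sum R_sq_integrable)
  show "expectation (\<lambda>\<omega>. (\<Sum>i\<in>{1..int n}. (R t n i \<omega>)\<^sup>2) / real n) \<le> 6 * \<Gamma> / real n"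
    using divide_right_mono[OF R_second_moment[OF assms], of "real n"] by simp
qed

lemma V_sq:
  assumes t: "t \<in> T" and n: "1 \<le> n"
  shows "integrable M (\<lambda>\<omega>. (V n \<omega> t - U_fun M X g t)\<^sup>2)"
    "expectation (\<lambda>\<omega>. (V n \<omega> t - U_fun M X g t)\<^sup>2) \<le> 16 * \<Gamma> / real n"
proof -
  have le: "(V n \<omega> t - U_fun M X g t)\<^sup>2 \<le> 2 * ((\<Sum>i\<in>{1..int n}. (R t n i \<omega>)\<^sup>2) / real n) + 2 * (abar t n \<omega>)\<^sup>2" for \<omega>
  proof -
    have "(x + y)\<^sup>2 \<le> 2 * x\<^sup>2 + 2 * y\<^sup>2" for x y :: real
      using zero_le_power2[of "x - y"] by (simp add: power2_sum power2_diff)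
    from this[of "(\<Sum>i\<in>{1..int n}. R t n i \<omega>) / real n" "abar t n \<omega>"]
    have "(V n \<omega> t - U_fun M X g t)\<^sup>2 \<le> 2 * ((\<Sum>i\<in>{1..int n}. R t n i \<omega>) / real n)\<^sup>2 + 2 * (abar t n \<omega>)\<^sup>2"
      by (simp add: V_decomp[OF n])
    moreover have "((\<Sum>i\<in>{1..int n}. R t n i \<omega>) / real n)\<^sup>2 \<le> (real n * (\<Sum>i\<in>{1..int n}. (R t n i \<omega>)\<^sup>2)) / (real n)\<^sup>2"
      using sum_sq_le[of "{1..int n}" "\<lambda>i. R t n i \<omega>"] unfolding power_divide by (intro divide_right_mono) auto
    moreover have "(real n * (\<Sum>i\<in>{1..int n}. (R t n i \<omega>)\<^sup>2)) / (real n)\<^sup>2 = (\<Sum>i\<in>{1..int n}. (R t n i \<omega>)\<^sup>2) / real n"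
      using n by (simp add: power2_eq_square)
    ultimately show ?thesis by linarith
  qed
  have i: "integrable M (\<lambda>\<omega>. 2 * ((\<Sum>i\<in>{1..int n}. (R t n i \<omega>)\<^sup>2) / real n) + 2 * (abar t n \<omega>)\<^sup>2)"
    by (intro Bochner_Integration.integrable_add integrable_mult_right mean_R_sq abar_sq t n)
  show iV: "integrable M (\<lambda>\<omega>. (V n \<omega> t - U_fun M X g t)\<^sup>2)"
    by (rule Bochner_Integration.integrable_bound[OF i]) (use le in \<open>auto intro!: AE_I2 intro: order_trans[OF _ abs_ge_self]\<close>)
  have "expectation (\<lambda>\<omega>. (V n \<omega> t - U_fun M X g t)\<^sup>2) \<le> expectation (\<lambda>\<omega>. 2 * ((\<Sum>i\<in>{1..int n}. (R t n i \<omega>)\<^sup>2) / real n) + 2 * (abar t n \<omega>)\<^sup>2)"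
    by (rule integral_mono[OF iV i le])
  also have "\<dots> = 2 * expectation (\<lambda>\<omega>. (\<Sum>i\<in>{1..int n}. (R t n i \<omega>)\<^sup>2) / real n) + 2 * expectation (\<lambda>\<omega>. (abar t n \<omega>)\<^sup>2)"
    by (subst Bochner_Integration.integral_add, intro integrable_mult_right mean_R_sq t n, intro integrable_mult_right abar_sq t n)
       (simp only: integral_mult_right_zero)
  also have "\<dots> \<le> 2 * (6 * \<Gamma> / real n) + 2 * (2 * \<Gamma> / real n)"
    by (intro add_mono mult_left_mono mean_R_sq abar_sq t n) auto
  also have "\<dots> = 16 * \<Gamma> / real n" by simp
  finally show "expectation (\<lambda>\<omega>. (V n \<omega> t - U_fun M X g t)\<^sup>2) \<le> 16 * \<Gamma> / real n" .
qed

lemma V_L1: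
  assumes t: "t \<in> T" and n: "1 \<le> n"
  shows "integrable M (\<lambda>\<omega>. V n \<omega> t - U_fun M X g t)"
    "expectation (\<lambda>\<omega>. \<bar>V n \<omega> t - U_fun M X g t\<bar>) \<le> (1 + 16 * \<Gamma>) / sqrt (real n)"
  by (rule L1_le_L2[OF _ V_sq[OF t n] n], measurable)+

lemma h_ker_sym: "h_ker g x y t = h_ker g y x t"
  using g_sym by (simp add: h_ker_def)

text \<open>Removing the diagonal and changing the normalisation costs at most
  \<open>1 / (n - 1)\<close>.\<close>

lemma U_stat_V:
  assumes n: "2 \<le> n"
  shows "\<bar>U_stat X g n \<omega> t - V n \<omega> t\<bar> \<le> 2 / real n"
proof -
  let ?S = "\<Sum>i\<in>{1..int n}. \<Sum>j\<in>{1..int n}. h_ker g (X i \<omega>) (X j \<omega>) t"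
  let ?D = "\<Sum>i\<in>{1..int n}. h_ker g (X i \<omega>) (X i \<omega>) t"
  define N where "N = real n"
  have N: "2 \<le> N" using n by (simp add: N_def)
  have D: "0 \<le> ?D" "?D \<le> N" using sum_mono[of "{1..int n}" "\<lambda>i. h_ker g (X i \<omega>) (X i \<omega>) t" "\<lambda>_. 1"]
    by (auto intro: sum_nonneg simp: N_def)
  have S0: "0 \<le> ?S" by (intro sum_nonneg) auto
  have "?S \<le> (\<Sum>i\<in>{1..int n}. \<Sum>j\<in>{1..int n}. 1)" by (intro sum_mono) auto
  then have S1: "?S \<le> N * N" by (simp add: N_def)
  have "?S = 2 * (\<Sum>i\<in>{1..int n}. \<Sum>j\<in>{i<..int n}. h_ker g (X i \<omega>) (X j \<omega>) t) + ?D"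
    by (rule sum_pairs_sym) (rule h_ker_sym)
  then have U: "U_stat X g n \<omega> t = (?S - ?D) / (N * (N - 1))"
    by (simp add: U_stat_def N_def)
  have "U_stat X g n \<omega> t - V n \<omega> t = (?S / N - ?D) / (N * (N - 1))"
    unfolding U V_def N_def[symmetric] power2_eq_square using N by (simp add: field_simps)
  moreover have "?S / N \<le> N" "0 \<le> ?S / N" using S1 S0 N by (auto simp: pos_divide_le_eq)
  then have "\<bar>?S / N - ?D\<bar> \<le> N" using D by linarith
  then have "\<bar>?S / N - ?D\<bar> / (N * (N - 1)) \<le> N / (N * (N - 1))" using N by (intro divide_right_mono) auto
  moreover have "\<bar>N * (N - 1)\<bar> = N * (N - 1)" using N by simp
  ultimately have "\<bar>U_stat X g n \<omega> t - V n \<omega> t\<bar> \<le> N / (N * (N - 1))"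
    by (simp only: abs_divide)
  also have "\<dots> = 1 / (N - 1)" using N by simp
  also have "\<dots> \<le> 2 / N" using N by (simp add: field_simps)
  finally show ?thesis by (simp add: N_def)
qed

lemma U_stat_meas [measurable (raw)]:
  assumes [measurable]: "\<tau> \<in> borel_measurable M"
  shows "(\<lambda>\<omega>. U_stat X g n \<omega> (\<tau> \<omega>)) \<in> borel_measurable M"
  unfolding U_stat_def by measurable

lemma U_stat_L1:
  assumes t: "t \<in> T" and n: "2 \<le> n"
  shows "integrable M (\<lambda>\<omega>. U_stat X g n \<omega> t - U_fun M X g t)"
    "expectation (\<lambda>\<omega>. \<bar>U_stat X g n \<omega> t - U_fun M X g t\<bar>) \<le> (3 + 16 * \<Gamma>) / sqrt (real n)"
proof -
  have n1: "1 \<le> n" using n by simp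
  note V1 = V_L1[OF t n1]
  have le: "\<bar>U_stat X g n \<omega> t - U_fun M X g t\<bar> \<le> \<bar>V n \<omega> t - U_fun M X g t\<bar> + 2 / real n" for \<omega>
    using U_stat_V[OF n, of \<omega> t] by linarith
  have i: "integrable M (\<lambda>\<omega>. \<bar>V n \<omega> t - U_fun M X g t\<bar> + 2 / real n)"
    using V1(1) by (intro Bochner_Integration.integrable_add integrable_abs) auto
  show iU: "integrable M (\<lambda>\<omega>. U_stat X g n \<omega> t - U_fun M X g t)"
    by (rule Bochner_Integration.integrable_bound[OF i]) (use le in \<open>auto intro!: AE_I2 intro: order_trans[OF _ abs_ge_self]\<close>)
  have "expectation (\<lambda>\<omega>. \<bar>U_stat X g n \<omega> t - U_fun M X g t\<bar>) \<le> expectation (\<lambda>\<omega>. \<bar>V n \<omega> t - U_fun M X g t\<bar> + 2 / real n)"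
    by (rule integral_mono[OF integrable_abs[OF iU] i le])
  also have "\<dots> = expectation (\<lambda>\<omega>. \<bar>V n \<omega> t - U_fun M X g t\<bar>) + 2 / real n"
    using V1(1) by (subst Bochner_Integration.integral_add) (auto simp: prob_space)
  also have "\<dots> \<le> (1 + 16 * \<Gamma>) / sqrt (real n) + 2 / sqrt (real n)"
  proof (intro add_mono V1(2) divide_left_mono)
    show "sqrt (real n) \<le> real n" using n real_sqrt_le_mono[of "real n" "(real n)\<^sup>2"] by (simp add: power2_eq_square mult_le_cancel_left1)
  qed (use n in auto)
  also have "\<dots> = (3 + 16 * \<Gamma>) / sqrt (real n)" by (simp add: add_divide_distrib)
  finally show "expectation (\<lambda>\<omega>. \<bar>U_stat X g n \<omega> t - U_fun M X g t\<bar>) \<le> (3 + 16 * \<Gamma>) / sqrt (real n)" .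
qed

end

section \<open>Sample quantile and density estimator\<close>

text \<open>Left endpoints sample \<open>K\<close> on \<open>N\<close> cells, with error from the
  Lipschitz bound. The cells are open on the left and closed on the right, so that their counts
  become increments of \<open>U_stat\<close>. The indicator on the error matters: after division by
  the bandwidth only the small share of pairs in the window contributes.\<close>

lemma density_kernel_step:
  assumes K: "density_kernel K"
  obtains c B where "0 < c" "0 \<le> B"
    "\<And>N y. 1 \<le> N \<Longrightarrow> \<bar>K y - (\<Sum>k<N. K (- c + 2 * c * real k / real N) *
        of_bool (- c + 2 * c * real k / real N < y \<and> y \<le> - c + 2 * c * real (Suc k) / real N))\<bar>
      \<le> B / real N * of_bool (- c < y \<and> y \<le> c)"
proof -
  obtain \<Lambda> where Lip: "\<Lambda>-lipschitz_on UNIV K" using K by (auto simp: density_kernel_def)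
  then have \<Lambda>: "0 \<le> \<Lambda>" "\<And>x y. \<bar>K x - K y\<bar> \<le> \<Lambda> * \<bar>x - y\<bar>"
    by (auto simp: lipschitz_on_def dist_real_def)
  obtain c0 where c0: "\<And>x. K x \<noteq> 0 \<Longrightarrow> \<bar>x\<bar> \<le> c0"
    using K by (auto simp: density_kernel_def bounded_iff)
  \<comment> \<open>The margin makes \<open>c\<close> positive and lets \<open>K\<close> vanish from
    \<open>c\<close> outwards.\<close>
  define c where "c = \<bar>c0\<bar> + 1"
  have c: "0 < c" by (simp add: c_def)
  have K0: "K x = 0" if "c \<le> \<bar>x\<bar>" for x using c0[of x] that unfolding c_def by (cases "K x = 0") auto
  show thesis
  proof (rule that[OF c])
    show "0 \<le> 2 * c * \<Lambda>" using c \<Lambda> by simp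
    fix N :: nat and y :: real assume N: "1 \<le> N"
    define v where "v k = - c + 2 * c * real k / real N" for k
    \<comment> \<open>In this coordinate cell \<open>k\<close> runs from \<open>k\<close> to
      \<open>k + 1\<close>, so the cell of \<open>y\<close> is found by a ceiling.\<close>
    define z where "z = (y + c) * real N / (2 * c)"
    have vz: "v k < y \<longleftrightarrow> real k < z" "y \<le> v k \<longleftrightarrow> z \<le> real k" for k
      using N c by (auto simp: v_def z_def field_simps)
    have "\<bar>K y - (\<Sum>k<N. K (v k) * of_bool (v k < y \<and> y \<le> v (Suc k)))\<bar> \<le> 2 * c * \<Lambda> / real N * of_bool (- c < y \<and> y \<le> c)"
    proof (cases "- c < y \<and> y \<le> c")
      case True
      then have z: "0 < z" "z \<le> real N" using vz[of 0] vz[of N] N by (auto simp: v_def)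
      define k0 where "k0 = nat \<lceil>z\<rceil> - 1"
      have k0: "real k0 < z" "z \<le> real (Suc k0)" "k0 < N" using z unfolding k0_def by linarith+
      have "(\<Sum>k<N. K (v k) * of_bool (v k < y \<and> y \<le> v (Suc k))) = (\<Sum>k<N. if k = k0 then K (v k0) else 0)"
      proof (rule sum.cong)
        fix k
        have "real k < z \<and> z \<le> real (Suc k) \<longleftrightarrow> k = k0" using k0 by auto
        then show "K (v k) * of_bool (v k < y \<and> y \<le> v (Suc k)) = (if k = k0 then K (v k0) else 0)"
          by (simp add: vz)
      qed simp
      also have "\<dots> = K (v k0)" using k0 by simp
      finally have s: "(\<Sum>k<N. K (v k) * of_bool (v k < y \<and> y \<le> v (Suc k))) = K (v k0)" .
      have "v k0 < y" "y \<le> v (Suc k0)" using k0 by (simp_all only: vz)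
      moreover have "v (Suc k0) - v k0 = 2 * c / real N" using N by (simp add: v_def field_simps)
      ultimately have "\<bar>y - v k0\<bar> \<le> 2 * c / real N" by linarith
      then have "\<bar>K y - K (v k0)\<bar> \<le> \<Lambda> * (2 * c / real N)"
        using \<Lambda>(2)[of y "v k0"] mult_left_mono[OF _ \<Lambda>(1)] by fastforce
      with True show ?thesis by (simp add: s mult_ac)
    next
      case False
      then have z: "z \<le> 0 \<or> real N < z" using vz[of 0] vz[of N] N by (auto simp: v_def)
      have "(\<Sum>k<N. K (v k) * of_bool (v k < y \<and> y \<le> v (Suc k))) = 0"
        by (rule sum.neutral) (use z in \<open>auto simp: vz\<close>)
      moreover have "K y = 0" using False c by (intro K0) auto
      moreover have "of_bool (- c < y \<and> y \<le> c) = (0 :: real)" using False by simp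
      ultimately show ?thesis by (simp only: diff_0_right abs_zero mult_zero_right order_refl)
    qed
    then show "\<bar>K y - (\<Sum>k<N. K (- c + 2 * c * real k / real N) *
        of_bool (- c + 2 * c * real k / real N < y \<and> y \<le> - c + 2 * c * real (Suc k) / real N))\<bar>
      \<le> 2 * c * \<Lambda> / real N * of_bool (- c < y \<and> y \<le> c)"
      by (simp only: v_def)
  qed
qed

section \<open>The sample quantile\<close>

locale quantile_kernel = ned_kernel +
  fixes p q u :: real
  assumes T_nhds: "\<forall>\<^sub>F t in nhds q. t \<in> T"
    and p01: "0 < p" "p < 1"
    and U_q: "U_fun M X g q = p"
    and U_deriv: "(U_fun M X g has_real_derivative u) (at q)"
    and u_pos: "0 < u"
begin

abbreviation tn :: "nat \<Rightarrow> 'a \<Rightarrow> real" where "tn n \<omega> \<equiv> U_stat_inv X g n \<omega> p"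

text \<open>Integration against the empirical law of the values \<open>g (X i) (X j)\<close> with
  \<open>i < j\<close>. Both \<open>U_stat\<close> and, up to the factor \<open>1 / d n\<close>,
  \<open>u_hat\<close> are values of this positive linear functional.\<close>

definition avg :: "nat \<Rightarrow> 'a \<Rightarrow> (real \<Rightarrow> real) \<Rightarrow> real" where
  "avg n \<omega> \<phi> = 2 / (real n * (real n - 1)) * (\<Sum>i\<in>{1..int n}. \<Sum>j\<in>{i<..int n}. \<phi> (g (X i \<omega>) (X j \<omega>)))"

lemma avg_factor: "0 \<le> 2 / (real n * (real n - 1))"
  by (cases "n = 0") auto

lemma avg_mono: "(\<And>y. \<phi> y \<le> \<psi> y) \<Longrightarrow> avg n \<omega> \<phi> \<le> avg n \<omega> \<psi>"
  unfolding avg_def by (intro mult_left_mono sum_mono avg_factor)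

lemma avg_diff: "avg n \<omega> (\<lambda>y. \<phi> y - \<psi> y) = avg n \<omega> \<phi> - avg n \<omega> \<psi>"
  unfolding avg_def by (simp only: sum_subtractf right_diff_distrib)

lemma avg_cmult: "avg n \<omega> (\<lambda>y. c * \<phi> y) = c * avg n \<omega> \<phi>"
  unfolding avg_def by (simp add: sum_distrib_left mult_ac)

lemma avg_sum: "finite A \<Longrightarrow> avg n \<omega> (\<lambda>y. \<Sum>k\<in>A. \<phi> k y) = (\<Sum>k\<in>A. avg n \<omega> (\<phi> k))"
proof (induction A rule: finite_induct)
  case empty
  then show ?case by (simp add: avg_def)
next
  case (insert k A)
  then show ?case by (simp add: avg_def sum.distrib distrib_left)
qed

lemma avg_abs_le:
  assumes "\<And>y. \<bar>\<phi> y - \<psi> y\<bar> \<le> \<xi> y"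
  shows "\<bar>avg n \<omega> \<phi> - avg n \<omega> \<psi>\<bar> \<le> avg n \<omega> \<xi>"
proof -
  have 1: "\<phi> y - \<psi> y \<le> \<xi> y" "\<psi> y - \<phi> y \<le> \<xi> y" for y using assms[of y] by linarith+
  from avg_mono[of "\<lambda>y. \<phi> y - \<psi> y" \<xi>, OF 1(1)] avg_mono[of "\<lambda>y. \<psi> y - \<phi> y" \<xi>, OF 1(2)]
  show ?thesis unfolding avg_diff by (metis abs_le_iff minus_diff_eq)
qed

lemma avg_one:
  assumes "2 \<le> n"
  shows "avg n \<omega> (\<lambda>_. 1) = 1"
proof -
  have "real n * real n = 2 * (\<Sum>i\<in>{1..int n}. \<Sum>j\<in>{i<..int n}. 1 :: real) + real n"
    using sum_pairs_sym[of "\<lambda>_ _. 1" n] by simp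
  then have "2 * (\<Sum>i\<in>{1..int n}. \<Sum>j\<in>{i<..int n}. 1 :: real) = real n * (real n - 1)" by (simp only: right_diff_distrib)
  moreover have "real n * (real n - 1) \<noteq> 0" using assms by auto
  ultimately show ?thesis unfolding avg_def by (simp add: divide_simps)
qed

lemma U_stat_avg: "U_stat X g n \<omega> t = avg n \<omega> (\<lambda>y. of_bool (y \<le> t))"
  unfolding U_stat_def avg_def h_ker_def indicator_def by simp

lemma u_hat_avg: "u_hat X g K d n \<omega> t = avg n \<omega> (\<lambda>y. K ((y - t) / d n)) / d n"
  unfolding u_hat_def avg_def by (simp add: divide_simps)

lemma U_stat_mono: "s \<le> t \<Longrightarrow> U_stat X g n \<omega> s \<le> U_stat X g n \<omega> t"
  unfolding U_stat_avg by (rule avg_mono) auto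

text \<open>An infimum of reals is informative only for nonempty sets bounded below.
  \<open>U_stat\<close> is 0 below all values of \<open>g\<close> in the sample and 1 above them,
  and \<open>p\<close> lies strictly between.\<close>

lemma U_stat_level:
  assumes n: "2 \<le> n"
  shows "{t. p \<le> U_stat X g n \<omega> t} \<noteq> {}" "bdd_below {t. p \<le> U_stat X g n \<omega> t}"
proof -
  let ?G = "(\<lambda>(i, j). g (X i \<omega>) (X j \<omega>)) ` ({1..int n} \<times> {1..int n})"
  have f: "finite ?G" by simp
  obtain b where b: "\<And>y. y \<in> ?G \<Longrightarrow> y \<le> b" using bdd_above_finite[OF f] by (meson bdd_above.E)
  obtain b' where b': "\<And>y. y \<in> ?G \<Longrightarrow> b' \<le> y" using bdd_below_finite[OF f] by (meson bdd_below.E)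
  have G: "g (X i \<omega>) (X j \<omega>) \<in> ?G" if "i \<in> {1..int n}" "j \<in> {i<..int n}" for i j
    using that by (auto intro!: image_eqI[of _ _ "(i, j)"])
  have "U_stat X g n \<omega> b = avg n \<omega> (\<lambda>_. 1)"
    unfolding U_stat_avg avg_def using b[OF G] by (intro arg_cong2[where f = "(*)"] sum.cong refl) auto
  then have "p \<le> U_stat X g n \<omega> b" using avg_one[OF n] p01 by simp
  then show "{t. p \<le> U_stat X g n \<omega> t} \<noteq> {}" by auto
  show "bdd_below {t. p \<le> U_stat X g n \<omega> t}"
  proof (rule bdd_belowI[of _ b'], rule ccontr)
    fix t assume t: "t \<in> {t. p \<le> U_stat X g n \<omega> t}" and "\<not> b' \<le> t"
    then have *: "\<not> y \<le> t" if "y \<in> ?G" for y using b'[OF that] by linarith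
    have "U_stat X g n \<omega> t = avg n \<omega> (\<lambda>_. 0)"
      unfolding U_stat_avg avg_def using *[OF G] by (intro arg_cong2[where f = "(*)"] sum.cong refl) auto
    then show False using t p01 by (simp add: avg_def)
  qed
qed

lemma tn_le: "2 \<le> n \<Longrightarrow> p \<le> U_stat X g n \<omega> s \<Longrightarrow> tn n \<omega> \<le> s"
  unfolding U_stat_inv_def gen_inv_def by (rule cInf_lower) (auto intro: U_stat_level)

lemma tn_ge: "2 \<le> n \<Longrightarrow> U_stat X g n \<omega> s < p \<Longrightarrow> s \<le> tn n \<omega>"
  unfolding U_stat_inv_def gen_inv_def
proof (rule cInf_greatest)
  fix t assume *: "U_stat X g n \<omega> s < p" "t \<in> {t. p \<le> U_stat X g n \<omega> t}"
  show "s \<le> t" using U_stat_mono[of t s n \<omega>] * by (cases "s \<le> t") auto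
qed (rule U_stat_level)

text \<open>Monotonicity allows rational levels, and the resulting countable union makes the
  quantile measurable.\<close>

lemma tn_less_iff:
  assumes n: "2 \<le> n"
  shows "tn n \<omega> < s \<longleftrightarrow> (\<exists>r\<in>\<rat>. r < s \<and> p \<le> U_stat X g n \<omega> r)"
proof
  assume "tn n \<omega> < s"
  then obtain t where t: "t < s" "p \<le> U_stat X g n \<omega> t"
    unfolding U_stat_inv_def gen_inv_def using cInf_lessD[OF U_stat_level(1)[OF n]] by auto
  obtain r where "r \<in> \<rat>" "t < r" "r < s" using Rats_dense_in_real[OF t(1)] by auto
  then show "\<exists>r\<in>\<rat>. r < s \<and> p \<le> U_stat X g n \<omega> r"
    using t(2) U_stat_mono[of t r n \<omega>] by (intro bexI[of _ r]) auto
next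
  assume "\<exists>r\<in>\<rat>. r < s \<and> p \<le> U_stat X g n \<omega> r"
  then show "tn n \<omega> < s" using tn_le[OF n] by (meson le_less_trans)
qed

lemma tn_meas [measurable]: "tn n \<in> borel_measurable M"
proof (cases "2 \<le> n")
  case True
  have "{\<omega> \<in> space M. tn n \<omega> < s} \<in> events" for s
  proof -
    have "{\<omega> \<in> space M. tn n \<omega> < s} = (\<Union>r\<in>{r\<in>\<rat>. r < s}. {\<omega> \<in> space M. p \<le> U_stat X g n \<omega> r})"
      using tn_less_iff[OF True] by auto
    also have "\<dots> \<in> events"
    proof (rule sets.countable_UN'')
      show "countable {r \<in> \<rat>. r < s}" by (rule countable_subset[OF _ countable_rat]) auto
    qed measurable
    finally show ?thesis .
  qed
  then show ?thesis by (subst borel_measurable_iff_less) auto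
next
  case False
  then have "n = 0 \<or> n = 1" by auto
  then have "U_stat X g n \<omega> t = 0" for \<omega> t by (auto simp: U_stat_def)
  then show ?thesis by (simp add: U_stat_inv_def gen_inv_def)
qed

text \<open>Rates that vanish more slowly than \<open>1 / sqrt n\<close>. Over such distances the
  difference quotients of \<open>U_stat\<close> at \<open>q\<close> still reveal the derivative
  \<open>u\<close>; the bandwidth \<open>d\<close> and the window \<open>rt\<close> are both of this
  kind.\<close>

definition scale :: "(nat \<Rightarrow> real) \<Rightarrow> bool" where
  "scale s \<longleftrightarrow> (\<forall>\<^sub>F n in sequentially. 0 < s n) \<and> s \<longlonglongrightarrow> 0 \<and> filterlim (\<lambda>n. sqrt (real n) * s n) at_top sequentially"

lemma eventually_T:
  assumes "s \<longlonglongrightarrow> 0"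
  shows "\<forall>\<^sub>F n in sequentially. q + s n * y \<in> T"
proof -
  have "(\<lambda>n. q + s n * y) \<longlonglongrightarrow> q + 0 * y" by (intro tendsto_intros assms)
  then have "filterlim (\<lambda>n. q + s n * y) (nhds q) sequentially" by simp
  from filterlim_iff[THEN iffD1, OF this] T_nhds show ?thesis by blast
qed

lemma U_difference_quotient:
  assumes s: "scale s"
  shows "(\<lambda>n. (U_fun M X g (q + s n * y) - p) / s n) \<longlonglongrightarrow> u * y"
proof (cases "y = 0")
  case True
  then show ?thesis by (simp add: U_q)
next
  case False
  have pos: "\<forall>\<^sub>F n in sequentially. 0 < s n" and s0: "s \<longlonglongrightarrow> 0" using s by (auto simp: scale_def)
  have "((\<lambda>h. (U_fun M X g (q + h) - U_fun M X g q) / h) \<longlongrightarrow> u) (at 0)"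
    using U_deriv by (simp add: DERIV_def)
  moreover have "filterlim (\<lambda>n. s n * y) (at 0) sequentially"
    unfolding filterlim_at using pos False tendsto_mult_left_zero[OF s0, of y]
    by (auto elim: eventually_mono)
  ultimately have "(\<lambda>n. (U_fun M X g (q + s n * y) - U_fun M X g q) / (s n * y)) \<longlonglongrightarrow> u"
    by (rule filterlim_compose)
  from tendsto_mult[OF this tendsto_const[of y]]
  have "(\<lambda>n. (U_fun M X g (q + s n * y) - U_fun M X g q) / (s n * y) * y) \<longlonglongrightarrow> u * y" .
  then show ?thesis using False by (simp add: U_q)
qed

lemma U_stat_scaled:
  assumes s: "scale s"
  shows "tendsto_in_prob M (\<lambda>n \<omega>. (U_stat X g n \<omega> (q + s n * y) - p) / s n) (u * y)"
proof (rule tendsto_in_prob_L1)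
  have pos: "\<forall>\<^sub>F n in sequentially. 0 < s n" and s0: "s \<longlonglongrightarrow> 0"
    and inf: "filterlim (\<lambda>n. sqrt (real n) * s n) at_top sequentially" using s by (auto simp: scale_def)
  let ?d = "\<lambda>n. \<bar>(U_fun M X g (q + s n * y) - p) / s n - u * y\<bar>"
  show "(\<lambda>n. (3 + 16 * \<Gamma>) / (sqrt (real n) * s n) + ?d n) \<longlonglongrightarrow> 0"
  proof (rule tendsto_add_zero)
    show "(\<lambda>n. (3 + 16 * \<Gamma>) / (sqrt (real n) * s n)) \<longlonglongrightarrow> 0"
      by (rule tendsto_divide_0[OF tendsto_const filterlim_at_top_imp_at_infinity[OF inf]])
    show "?d \<longlonglongrightarrow> 0"
      using U_difference_quotient[OF s, of y] by (intro tendsto_rabs_zero LIM_zero)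
  qed
  show "\<forall>\<^sub>F n in sequentially. integrable M (\<lambda>\<omega>. (U_stat X g n \<omega> (q + s n * y) - p) / s n) \<and>
     expectation (\<lambda>\<omega>. \<bar>(U_stat X g n \<omega> (q + s n * y) - p) / s n - u * y\<bar>) \<le> (3 + 16 * \<Gamma>) / (sqrt (real n) * s n) + ?d n"
    using pos eventually_T[OF s0, of y] eventually_ge_at_top[of 2]
  proof eventually_elim
    case (elim n)
    let ?t = "q + s n * y"
    note L1 = U_stat_L1[OF elim(2,3)]
    have "integrable M (\<lambda>\<omega>. (U_stat X g n \<omega> ?t - U_fun M X g ?t) / s n + (U_fun M X g ?t - p) / s n)"
      using L1(1) by (intro Bochner_Integration.integrable_add Bochner_Integration.integrable_divide) auto
    then have i: "integrable M (\<lambda>\<omega>. (U_stat X g n \<omega> ?t - p) / s n)" by (simp add: add_divide_distrib[symmetric])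
    have "expectation (\<lambda>\<omega>. \<bar>(U_stat X g n \<omega> ?t - p) / s n - u * y\<bar>) \<le> expectation (\<lambda>\<omega>. \<bar>U_stat X g n \<omega> ?t - U_fun M X g ?t\<bar> / s n + ?d n)"
    proof (rule integral_mono)
      show "integrable M (\<lambda>\<omega>. \<bar>(U_stat X g n \<omega> ?t - p) / s n - u * y\<bar>)" using i by simp
      show "integrable M (\<lambda>\<omega>. \<bar>U_stat X g n \<omega> ?t - U_fun M X g ?t\<bar> / s n + ?d n)"
        using L1(1) by (intro Bochner_Integration.integrable_add Bochner_Integration.integrable_divide integrable_abs) auto
      fix \<omega>
      have "(U_stat X g n \<omega> ?t - p) / s n - u * y = (U_stat X g n \<omega> ?t - U_fun M X g ?t) / s n + ((U_fun M X g ?t - p) / s n - u * y)"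
        by (simp add: diff_divide_distrib)
      moreover have "\<bar>(U_stat X g n \<omega> ?t - U_fun M X g ?t) / s n\<bar> = \<bar>U_stat X g n \<omega> ?t - U_fun M X g ?t\<bar> / s n"
        using elim(1) by (simp add: abs_divide)
      ultimately show "\<bar>(U_stat X g n \<omega> ?t - p) / s n - u * y\<bar> \<le> \<bar>U_stat X g n \<omega> ?t - U_fun M X g ?t\<bar> / s n + ?d n"
        by linarith
    qed
    also have "\<dots> = expectation (\<lambda>\<omega>. \<bar>U_stat X g n \<omega> ?t - U_fun M X g ?t\<bar>) / s n + ?d n"
      using L1(1) by (subst Bochner_Integration.integral_add) (auto simp: prob_space)
    also have "\<dots> \<le> (3 + 16 * \<Gamma>) / sqrt (real n) / s n + ?d n"
      using elim(1) by (intro add_right_mono divide_right_mono L1(2)) auto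
    finally show ?case using i by simp
  qed
qed measurable

text \<open>Off a vanishing event, the scaled deviations at \<open>q + \<theta> * s n\<close> and
  \<open>q - \<theta> * s n\<close> are within \<open>u * \<theta> / 2\<close> of their limits
  \<open>u * \<theta>\<close> and \<open>- u * \<theta>\<close>. They then have the right signs, and
  monotonicity traps the sample quantile in between.\<close>

lemma tn_scaled:
  assumes s: "scale s" and \<theta>: "0 < \<theta>"
  shows "vanishing (\<lambda>n. {\<omega> \<in> space M. \<theta> * s n < \<bar>tn n \<omega> - q\<bar>})"
proof -
  have pos: "\<forall>\<^sub>F n in sequentially. 0 < s n" using s by (auto simp: scale_def)
  let ?A = "\<lambda>y n. {\<omega> \<in> space M. u * \<theta> / 2 < \<bar>(U_stat X g n \<omega> (q + s n * y) - p) / s n - u * y\<bar>}"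
  have e: "0 < u * \<theta> / 2" using u_pos \<theta> by simp
  show ?thesis
  proof (rule vanishing_subset)
    show "vanishing (\<lambda>n. ?A \<theta> n \<union> ?A (- \<theta>) n)"
      by (intro vanishing_Un tendsto_in_probD[OF U_stat_scaled[OF s] e])
    show "\<forall>\<^sub>F n in sequentially. {\<omega> \<in> space M. \<theta> * s n < \<bar>tn n \<omega> - q\<bar>} \<subseteq> ?A \<theta> n \<union> ?A (- \<theta>) n"
      using pos eventually_ge_at_top[of 2]
    proof eventually_elim
      case (elim n)
      show ?case
      proof (rule subsetI, rule ccontr)
        fix \<omega> assume w: "\<omega> \<in> {\<omega> \<in> space M. \<theta> * s n < \<bar>tn n \<omega> - q\<bar>}" and n: "\<omega> \<notin> ?A \<theta> n \<union> ?A (- \<theta>) n"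
        then have "\<bar>(U_stat X g n \<omega> (q + s n * \<theta>) - p) / s n - u * \<theta>\<bar> \<le> u * \<theta> / 2"
          "\<bar>(U_stat X g n \<omega> (q + s n * - \<theta>) - p) / s n - u * - \<theta>\<bar> \<le> u * \<theta> / 2" by auto
        then have "0 < (U_stat X g n \<omega> (q + s n * \<theta>) - p) / s n" "(U_stat X g n \<omega> (q + s n * - \<theta>) - p) / s n < 0"
          using e by linarith+
        then have "p \<le> U_stat X g n \<omega> (q + s n * \<theta>)" "U_stat X g n \<omega> (q + s n * - \<theta>) < p"
          using elim(1) by (auto simp: zero_less_divide_iff divide_less_0_iff)
        then have "tn n \<omega> \<le> q + s n * \<theta>" "q + s n * - \<theta> \<le> tn n \<omega>" using tn_le tn_ge elim(2) by blast+
        then have "\<bar>tn n \<omega> - q\<bar> \<le> \<theta> * s n" by (simp add: abs_le_iff mult.commute)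
        then show False using w by auto
      qed
    qed
  qed measurable
qed

text \<open>Off a vanishing event the random centre is within \<open>\<theta> * s n\<close> of
  \<open>q\<close>, so monotonicity encloses the value between those at the deterministic points
  \<open>q + s n * (v - \<theta>)\<close> and \<open>q + s n * (v + \<theta>)\<close>. The choice of
  \<open>\<theta>\<close> makes the enclosure cost
  \<open>u * \<theta> = \<epsilon> / 2\<close>.\<close>

lemma U_stat_tn_scaled:
  assumes s: "scale s"
  shows "tendsto_in_prob M (\<lambda>n \<omega>. (U_stat X g n \<omega> (tn n \<omega> + s n * v) - p) / s n) (u * v)"
proof (rule tendsto_in_probI)
  fix \<epsilon> :: real assume \<epsilon>: "0 < \<epsilon>"
  have pos: "\<forall>\<^sub>F n in sequentially. 0 < s n" using s by (auto simp: scale_def)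
  define \<theta> where "\<theta> = \<epsilon> / (2 * u)"
  have \<theta>: "0 < \<theta>" "u * \<theta> = \<epsilon> / 2" using \<epsilon> u_pos by (auto simp: \<theta>_def)
  let ?F = "\<lambda>y n \<omega>. (U_stat X g n \<omega> (q + s n * y) - p) / s n"
  let ?A = "\<lambda>y n. {\<omega> \<in> space M. \<epsilon> / 2 < \<bar>?F y n \<omega> - u * y\<bar>}"
  let ?B = "\<lambda>n. {\<omega> \<in> space M. \<theta> * s n < \<bar>tn n \<omega> - q\<bar>}"
  have e: "0 < \<epsilon> / 2" using \<epsilon> by simp
  show "\<exists>B. vanishing B \<and> (\<forall>\<^sub>F n in sequentially. \<forall>\<omega>\<in>space M - B n. \<bar>(U_stat X g n \<omega> (tn n \<omega> + s n * v) - p) / s n - u * v\<bar> \<le> \<epsilon>)"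
  proof (intro exI[of _ "\<lambda>n. ?B n \<union> (?A (v + \<theta>) n \<union> ?A (v - \<theta>) n)"] conjI)
    show "vanishing (\<lambda>n. ?B n \<union> (?A (v + \<theta>) n \<union> ?A (v - \<theta>) n))"
      by (intro vanishing_Un tendsto_in_probD[OF U_stat_scaled[OF s] e] tn_scaled[OF s \<theta>(1)])
    show "\<forall>\<^sub>F n in sequentially. \<forall>\<omega>\<in>space M - (?B n \<union> (?A (v + \<theta>) n \<union> ?A (v - \<theta>) n)). \<bar>(U_stat X g n \<omega> (tn n \<omega> + s n * v) - p) / s n - u * v\<bar> \<le> \<epsilon>"
      using pos
    proof eventually_elim
      case (elim n)
      show ?case
      proof
        fix \<omega> assume "\<omega> \<in> space M - (?B n \<union> (?A (v + \<theta>) n \<union> ?A (v - \<theta>) n))"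
        then have w: "\<bar>tn n \<omega> - q\<bar> \<le> \<theta> * s n" "\<bar>?F (v + \<theta>) n \<omega> - u * (v + \<theta>)\<bar> \<le> \<epsilon> / 2" "\<bar>?F (v - \<theta>) n \<omega> - u * (v - \<theta>)\<bar> \<le> \<epsilon> / 2"
          by auto
        have "q + s n * (v - \<theta>) \<le> tn n \<omega> + s n * v" "tn n \<omega> + s n * v \<le> q + s n * (v + \<theta>)"
          using w(1) by (auto simp: abs_le_iff algebra_simps)
        then have lohi: "?F (v - \<theta>) n \<omega> \<le> (U_stat X g n \<omega> (tn n \<omega> + s n * v) - p) / s n"
          "(U_stat X g n \<omega> (tn n \<omega> + s n * v) - p) / s n \<le> ?F (v + \<theta>) n \<omega>"
          using elim by (auto intro!: divide_right_mono U_stat_mono)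
        have "\<bar>x - u'\<bar> \<le> \<epsilon>" if "lo \<le> x" "x \<le> hi" "\<bar>hi - (u' + \<epsilon> / 2)\<bar> \<le> \<epsilon> / 2" "\<bar>lo - (u' - \<epsilon> / 2)\<bar> \<le> \<epsilon> / 2"
          for lo hi x u' :: real using that unfolding abs_le_iff by linarith
        from this[OF lohi w(2,3)[unfolded distrib_left[of u] right_diff_distrib[of u] \<theta>(2)]]
        show "\<bar>(U_stat X g n \<omega> (tn n \<omega> + s n * v) - p) / s n - u * v\<bar> \<le> \<epsilon>" .
      qed
    qed
  qed
qed measurable

section \<open>The density estimator at the sample quantile\<close>

lemma u_hat_meas:
  assumes [measurable]: "K \<in> borel_measurable borel"
  shows "(\<lambda>\<omega>. u_hat X g K d n \<omega> (tn n \<omega>)) \<in> borel_measurable M"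
  unfolding u_hat_def by measurable

lemma density_kernel_borel:
  assumes "density_kernel K"
  shows "K \<in> borel_measurable borel"
proof -
  obtain \<Lambda> where "\<Lambda>-lipschitz_on UNIV K" using assms by (auto simp: density_kernel_def)
  then have "continuous_on UNIV K" by (rule lipschitz_on_continuous_on)
  then show ?thesis by (rule borel_measurable_continuous_onI)
qed

theorem u_hat_consistent:
  assumes K: "density_kernel K" and d: "scale d"
  shows "tendsto_in_prob M (\<lambda>n \<omega>. u_hat X g K d n \<omega> (tn n \<omega>)) u"
proof (rule tendsto_in_probI)
  show "(\<lambda>\<omega>. u_hat X g K d n \<omega> (tn n \<omega>)) \<in> borel_measurable M" for n
    by (rule u_hat_meas[OF density_kernel_borel[OF K]])
  fix \<epsilon> :: real assume \<epsilon>: "0 < \<epsilon>"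
  have pos: "\<forall>\<^sub>F n in sequentially. 0 < d n" using d by (auto simp: scale_def)
  obtain c B where c: "0 < c" and B: "0 \<le> B" and
    step: "\<And>N y. 1 \<le> N \<Longrightarrow> \<bar>K y - (\<Sum>k<N. K (- c + 2 * c * real k / real N) *
        of_bool (- c + 2 * c * real k / real N < y \<and> y \<le> - c + 2 * c * real (Suc k) / real N))\<bar>
      \<le> B / real N * of_bool (- c < y \<and> y \<le> c)"
    by (rule density_kernel_step[OF K]) blast
  define F where "F v n \<omega> = (U_stat X g n \<omega> (tn n \<omega> + d n * v) - p) / d n" for v n \<omega>
  have F: "tendsto_in_prob M (F v) (u * v)" for v unfolding F_def by (rule U_stat_tn_scaled[OF d])
  have dF2: "d n * (F x n \<omega> + (- 1) * F y n \<omega>) = U_stat X g n \<omega> (tn n \<omega> + d n * x) - U_stat X g n \<omega> (tn n \<omega> + d n * y)"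
    if "0 < d n" for x n \<omega> y
    using that by (simp add: F_def distrib_left)
  \<comment> \<open>\<open>N\<close> is fixed before \<open>n\<close> grows. It pays for the step
    approximation twice: \<open>2 * u * c + 1\<close> bounds \<open>G\<close> in the estimator, and
    \<open>2 * u * c\<close> comes from the integral of \<open>K\<close>.\<close>
  obtain N :: nat where N0: "B * (4 * u * c + 1) / \<epsilon> * 2 < real N" using reals_Archimedean2 by blast
  have "0 \<le> B * (4 * u * c + 1) / \<epsilon> * 2" using B u_pos c \<epsilon> by simp
  then have N: "1 \<le> N" using N0 by (cases N) auto
  have BN: "B / real N * (4 * u * c + 1) \<le> \<epsilon> / 2"
    using N0 N \<epsilon> by (simp add: field_simps)
  define v where "v k = - c + 2 * c * real k / real N" for k
  have v_diff: "v (Suc k) - v k = 2 * c / real N" for k using N by (simp add: v_def field_simps)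
  have v_mono: "v k \<le> v (Suc k)" for k
  proof -
    have "0 < 2 * c / real N" using c N by simp
    then show ?thesis using v_diff[of k] by linarith
  qed
  note step = step[OF N, folded v_def]
  \<comment> \<open>\<open>S\<close> is the estimator with the step function in place of
    \<open>K\<close>, a fixed finite combination of difference quotients; \<open>S0\<close> is its
    limit.\<close>
  define S where "S n \<omega> = (\<Sum>k<N. K (v k) * (F (v (Suc k)) n \<omega> + (- 1) * F (v k) n \<omega>))" for n \<omega>
  define S0 where "S0 = (\<Sum>k<N. K (v k) * (u * v (Suc k) + (- 1) * (u * v k)))"
  have S: "tendsto_in_prob M S S0"
    unfolding S_def[abs_def] S0_def
    by (intro tendsto_in_prob_sum tendsto_in_prob_cmult tendsto_in_prob_add F) simp
  define G where "G n \<omega> = F c n \<omega> + (- 1) * F (- c) n \<omega>" for n \<omega>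
  have G: "tendsto_in_prob M G (u * c + (- 1) * (u * - c))"
    unfolding G_def[abs_def] by (intro tendsto_in_prob_cmult tendsto_in_prob_add F)
  have G0: "u * c + (- 1) * (u * - c) = 2 * u * c" by simp
  \<comment> \<open>\<open>S0 / u\<close> is the integral of the step function, which is compared
    with the integral 1 of \<open>K\<close> by means of the same error bound over the
    support.\<close>
  have S0u: "\<bar>S0 - u\<bar> \<le> B / real N * (2 * u * c)"
  proof -
    have iK: "integrable lborel K" and K1: "(LINT x|lborel. K x) = 1" using K by (auto simp: density_kernel_def)
    let ?st = "\<lambda>y. \<Sum>k<N. K (v k) * indicator {v k<..v (Suc k)} y"
    have ist: "integrable lborel ?st"
      by (intro Bochner_Integration.integrable_sum integrable_mult_right integrable_real_indicator) (auto simp: v_mono)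
    have "(LINT y|lborel. ?st y) = (\<Sum>k<N. K (v k) * (2 * c / real N))"
    proof -
      have "(LINT y|lborel. ?st y) = (\<Sum>k<N. LINT y|lborel. K (v k) * indicator {v k<..v (Suc k)} y)"
        by (rule Bochner_Integration.integral_sum) (intro integrable_mult_right integrable_real_indicator, auto simp: v_mono)
      also have "\<dots> = (\<Sum>k<N. K (v k) * (2 * c / real N))"
        using v_mono v_diff by (intro sum.cong refl) simp
      finally show ?thesis .
    qed
    moreover have "S0 = u * (\<Sum>k<N. K (v k) * (v (Suc k) - v k))"
      unfolding S0_def sum_distrib_left by (intro sum.cong refl) (simp add: algebra_simps)
    then have "S0 = u * (\<Sum>k<N. K (v k) * (2 * c / real N))" unfolding v_diff .
    ultimately have "S0 - u = u * ((LINT y|lborel. ?st y) - (LINT y|lborel. K y))" by (simp add: K1 right_diff_distrib)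
    moreover have "\<bar>(LINT y|lborel. ?st y) - (LINT y|lborel. K y)\<bar> \<le> B / real N * (2 * c)"
    proof -
      have "\<bar>(LINT y|lborel. ?st y) - (LINT y|lborel. K y)\<bar> = \<bar>LINT y|lborel. K y - ?st y\<bar>"
        using iK ist by (subst Bochner_Integration.integral_diff) (auto simp: abs_minus_commute)
      also have "\<dots> \<le> (LINT y|lborel. \<bar>K y - ?st y\<bar>)" by (rule integral_abs_bound)
      also have "\<dots> \<le> (LINT y|lborel. B / real N * indicator {- c<..c} y)"
      proof (rule integral_mono)
        show "integrable lborel (\<lambda>y. \<bar>K y - ?st y\<bar>)" using iK ist by (intro integrable_abs Bochner_Integration.integrable_diff)
        show "integrable lborel (\<lambda>y. B / real N * indicator {- c<..c} y)"
          using c by (intro integrable_mult_right integrable_real_indicator) auto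
        fix y show "\<bar>K y - ?st y\<bar> \<le> B / real N * indicator {- c<..c} y"
          using step[of y] by (simp add: indicator_def)
      qed
      also have "\<dots> = B / real N * (2 * c)" using c by simp
      finally show ?thesis .
    qed
    then have "\<bar>u * ((LINT y|lborel. ?st y) - (LINT y|lborel. K y))\<bar> \<le> u * (B / real N * (2 * c))"
      unfolding abs_mult abs_of_pos[OF u_pos] using u_pos by (intro mult_left_mono) auto
    ultimately have "\<bar>S0 - u\<bar> \<le> u * (B / real N * (2 * c))" by (simp only:)
    then show ?thesis by (simp add: mult_ac)
  qed
  \<comment> \<open>The error is measured by \<open>G\<close>, the share of pairs in the window
    divided by the bandwidth, which converges to \<open>2 * u * c\<close> and so stays
    bounded.\<close>
  have close: "\<bar>u_hat X g K d n \<omega> (tn n \<omega>) - S n \<omega>\<bar> \<le> B / real N * G n \<omega>" if dn: "0 < d n" for n \<omega>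
  proof -
    let ?t = "tn n \<omega>"
    have hb: "of_bool (x < (y - ?t) / d n \<and> (y - ?t) / d n \<le> x') = of_bool (y \<le> ?t + d n * x') - (of_bool (y \<le> ?t + d n * x) :: real)"
      if "x \<le> x'" for x x' y
    proof -
      have "?t + d n * x \<le> ?t + d n * x'" using that dn by simp
      moreover have "x < (y - ?t) / d n \<longleftrightarrow> \<not> y \<le> ?t + d n * x" using dn by (auto simp: pos_less_divide_eq mult.commute)
      moreover have "(y - ?t) / d n \<le> x' \<longleftrightarrow> y \<le> ?t + d n * x'" using dn by (auto simp: pos_divide_le_eq mult.commute)
      ultimately show ?thesis by auto
    qed
    have "\<bar>avg n \<omega> (\<lambda>y. K ((y - ?t) / d n)) - avg n \<omega> (\<lambda>y. \<Sum>k<N. K (v k) * (of_bool (y \<le> ?t + d n * v (Suc k)) - of_bool (y \<le> ?t + d n * v k)))\<bar>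
       \<le> avg n \<omega> (\<lambda>y. B / real N * (of_bool (y \<le> ?t + d n * c) - of_bool (y \<le> ?t + d n * - c)))"
    proof (rule avg_abs_le)
      fix y
      have "- c \<le> c" using c by simp
      note h2 = hb[OF this, of y]
      show "\<bar>K ((y - ?t) / d n) - (\<Sum>k<N. K (v k) * (of_bool (y \<le> ?t + d n * v (Suc k)) - of_bool (y \<le> ?t + d n * v k)))\<bar>
        \<le> B / real N * (of_bool (y \<le> ?t + d n * c) - of_bool (y \<le> ?t + d n * - c))"
        using step[of "(y - ?t) / d n"] unfolding hb[OF v_mono] h2 .
    qed
    also have "\<dots> = B / real N * (d n * G n \<omega>)"
      unfolding avg_cmult avg_diff U_stat_avg[symmetric] dF2[OF dn, of c \<omega> "- c", folded G_def] ..
    also have "avg n \<omega> (\<lambda>y. \<Sum>k<N. K (v k) * (of_bool (y \<le> ?t + d n * v (Suc k)) - of_bool (y \<le> ?t + d n * v k)))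
      = (\<Sum>k<N. K (v k) * (U_stat X g n \<omega> (?t + d n * v (Suc k)) - U_stat X g n \<omega> (?t + d n * v k)))"
      by (simp only: avg_sum[OF finite_lessThan] avg_cmult avg_diff U_stat_avg)
    also have "\<dots> = d n * S n \<omega>"
      unfolding S_def sum_distrib_left mult.left_commute[of "d n"] dF2[OF dn] ..
    also have "avg n \<omega> (\<lambda>y. K ((y - ?t) / d n)) = d n * u_hat X g K d n \<omega> ?t" using dn by (simp add: u_hat_avg)
    finally have "d n * \<bar>u_hat X g K d n \<omega> ?t - S n \<omega>\<bar> \<le> d n * (B / real N * G n \<omega>)"
      using dn by (simp add: right_diff_distrib[symmetric] abs_mult mult_ac)
    then show ?thesis using dn by (rule mult_left_le_imp_le)
  qed
  let ?A = "\<lambda>n. {\<omega> \<in> space M. \<epsilon> / 2 < \<bar>S n \<omega> - S0\<bar>}" and ?B = "\<lambda>n. {\<omega> \<in> space M. 1 < \<bar>G n \<omega> - (u * c + (- 1) * (u * - c))\<bar>}"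
  have e: "0 < \<epsilon> / 2" using \<epsilon> by simp
  show "\<exists>B. vanishing B \<and> (\<forall>\<^sub>F n in sequentially. \<forall>\<omega>\<in>space M - B n. \<bar>u_hat X g K d n \<omega> (tn n \<omega>) - u\<bar> \<le> \<epsilon>)"
  proof (intro exI[of _ "\<lambda>n. ?A n \<union> ?B n"] conjI)
    show "vanishing (\<lambda>n. ?A n \<union> ?B n)"
      by (intro vanishing_Un tendsto_in_probD[OF S e] tendsto_in_probD[OF G]) simp
    show "\<forall>\<^sub>F n in sequentially. \<forall>\<omega>\<in>space M - (?A n \<union> ?B n). \<bar>u_hat X g K d n \<omega> (tn n \<omega>) - u\<bar> \<le> \<epsilon>"
      using pos
    proof eventually_elim
      case (elim n)
      show ?case
      proof
        fix \<omega> assume "\<omega> \<in> space M - (?A n \<union> ?B n)"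
        then have w: "\<bar>S n \<omega> - S0\<bar> \<le> \<epsilon> / 2" "\<bar>G n \<omega> - 2 * u * c\<bar> \<le> 1" by (auto simp: mult_ac not_less)
        have "B / real N * G n \<omega> \<le> B / real N * (2 * u * c + 1)"
          using w(2) B by (intro mult_left_mono) auto
        then have "\<bar>u_hat X g K d n \<omega> (tn n \<omega>) - S n \<omega>\<bar> + \<bar>S0 - u\<bar> \<le> B / real N * (2 * u * c + 1) + B / real N * (2 * u * c)"
          using close[OF elim, of \<omega>] S0u by linarith
        also have "\<dots> = B / real N * (4 * u * c + 1)" by (simp add: algebra_simps add_divide_distrib)
        finally show "\<bar>u_hat X g K d n \<omega> (tn n \<omega>) - u\<bar> \<le> \<epsilon>" using BN w(1) by linarith
      qed
    qed
  qed
qed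

end

section \<open>Long-run variance\<close>

text \<open>Substitute \<open>r = j - i\<close>; the lags \<open>r\<close> and \<open>- r\<close>
  produce the two triangles off the diagonal.\<close>

lemma lag_sum_eq:
  fixes w :: "int \<Rightarrow> real" and y :: "int \<Rightarrow> real"
  shows "(\<Sum>r\<in>{- (int n - 1)..int n - 1}. w \<bar>r\<bar> * (1 / real n * (\<Sum>i\<in>{1..int n - \<bar>r\<bar>}. y i * y (i + \<bar>r\<bar>))))
    = (\<Sum>i\<in>{1..int n}. \<Sum>j\<in>{1..int n}. w \<bar>i - j\<bar> * (y i * y j)) / real n"
proof -
  let ?R = "{- (int n - 1)..int n - 1}"
  have "(\<Sum>(r, i)\<in>Sigma ?R (\<lambda>r. {1..int n - \<bar>r\<bar>}). w \<bar>r\<bar> * (y i * y (i + \<bar>r\<bar>)))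
    = (\<Sum>(i, j)\<in>{1..int n} \<times> {1..int n}. w \<bar>i - j\<bar> * (y i * y j))"
    by (rule sum.reindex_bij_witness[where j = "\<lambda>(r, i). if 0 \<le> r then (i, i + r) else (i - r, i)" and i = "\<lambda>(i, j). (j - i, min i j)"])
       (auto simp: mult.commute min_def split: if_splits)
  then have "(\<Sum>r\<in>?R. \<Sum>i\<in>{1..int n - \<bar>r\<bar>}. w \<bar>r\<bar> * (y i * y (i + \<bar>r\<bar>)))
    = (\<Sum>i\<in>{1..int n}. \<Sum>j\<in>{1..int n}. w \<bar>i - j\<bar> * (y i * y j))"
    by (simp add: sum.Sigma sum.cartesian_product)
  then show ?thesis by (simp add: sum_divide_distrib[symmetric] sum_distrib_left[symmetric])
qed

text \<open>The part quadratic in \<open>e\<close> is bounded as in Schur's test, by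
  \<open>2 * |e i * e j| \<le> (e i)\<^sup>2 + (e j)\<^sup>2\<close> and row sums. The mixed part
  keeps the smoothed sequence intact: bounding it by row sums as well would lose a factor of order
  \<open>sqrt B\<close>.\<close>

lemma quadratic_perturbation:
  fixes w :: "int \<Rightarrow> real" and \<alpha> e :: "int \<Rightarrow> real"
  assumes I: "finite I" and w: "\<And>k. 0 \<le> w k" and B: "\<And>i. i \<in> I \<Longrightarrow> (\<Sum>j\<in>I. w \<bar>i - j\<bar>) \<le> B"
  shows "\<bar>(\<Sum>i\<in>I. \<Sum>j\<in>I. w \<bar>i - j\<bar> * ((\<alpha> i + e i) * (\<alpha> j + e j))) - (\<Sum>i\<in>I. \<Sum>j\<in>I. w \<bar>i - j\<bar> * (\<alpha> i * \<alpha> j))\<bar>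
    \<le> 2 * \<bar>\<Sum>i\<in>I. e i * (\<Sum>j\<in>I. w \<bar>i - j\<bar> * \<alpha> j)\<bar> + B * (\<Sum>i\<in>I. (e i)\<^sup>2)"
proof -
  let ?S = "\<lambda>x y. \<Sum>i\<in>I. \<Sum>j\<in>I. w \<bar>i - j\<bar> * (x i * y j)"
  have sym: "?S x y = ?S y x" for x y :: "int \<Rightarrow> real"
    by (subst sum.swap) (simp add: abs_minus_commute mult.commute)
  have "?S (\<lambda>i. \<alpha> i + e i) (\<lambda>i. \<alpha> i + e i) = ?S \<alpha> \<alpha> + ?S \<alpha> e + ?S e \<alpha> + ?S e e"
    by (simp add: algebra_simps sum.distrib)
  also have "\<dots> = ?S \<alpha> \<alpha> + 2 * ?S e \<alpha> + ?S e e" using sym[of \<alpha> e] by simp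
  finally have 1: "?S (\<lambda>i. \<alpha> i + e i) (\<lambda>i. \<alpha> i + e i) - ?S \<alpha> \<alpha> = 2 * ?S e \<alpha> + ?S e e" by simp
  have 2: "?S e \<alpha> = (\<Sum>i\<in>I. e i * (\<Sum>j\<in>I. w \<bar>i - j\<bar> * \<alpha> j))"
    by (simp add: sum_distrib_left mult_ac)
  have row: "(\<Sum>i\<in>I. \<Sum>j\<in>I. w \<bar>i - j\<bar> * (e i)\<^sup>2) \<le> B * (\<Sum>i\<in>I. (e i)\<^sup>2)"
    unfolding sum_distrib_left sum_distrib_right[symmetric] by (intro sum_mono mult_right_mono B) auto
  have col: "(\<Sum>i\<in>I. \<Sum>j\<in>I. w \<bar>i - j\<bar> * (e j)\<^sup>2) = (\<Sum>i\<in>I. \<Sum>j\<in>I. w \<bar>i - j\<bar> * (e i)\<^sup>2)"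
    by (subst sum.swap) (simp add: abs_minus_commute)
  have "\<bar>?S e e\<bar> \<le> (\<Sum>i\<in>I. \<Sum>j\<in>I. w \<bar>i - j\<bar> * ((e i)\<^sup>2 / 2 + (e j)\<^sup>2 / 2))"
  proof (rule order_trans[OF sum_abs sum_mono])
    fix i assume "i \<in> I"
    have "\<bar>w \<bar>i - j\<bar> * (e i * e j)\<bar> \<le> w \<bar>i - j\<bar> * ((e i)\<^sup>2 / 2 + (e j)\<^sup>2 / 2)" for j
    proof -
      have "\<bar>e i * e j\<bar> \<le> (e i)\<^sup>2 / 2 + (e j)\<^sup>2 / 2"
        using zero_le_power2[of "\<bar>e i\<bar> - \<bar>e j\<bar>"] by (simp add: power2_diff abs_mult)
      then show ?thesis using w[of "\<bar>i - j\<bar>"] by (simp add: abs_mult mult_left_mono)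
    qed
    then show "\<bar>\<Sum>j\<in>I. w \<bar>i - j\<bar> * (e i * e j)\<bar> \<le> (\<Sum>j\<in>I. w \<bar>i - j\<bar> * ((e i)\<^sup>2 / 2 + (e j)\<^sup>2 / 2))"
      by (intro order_trans[OF sum_abs sum_mono])
  qed
  also have "\<dots> = (\<Sum>i\<in>I. \<Sum>j\<in>I. w \<bar>i - j\<bar> * (e i)\<^sup>2) / 2 + (\<Sum>i\<in>I. \<Sum>j\<in>I. w \<bar>i - j\<bar> * (e j)\<^sup>2) / 2"
    by (simp add: distrib_left sum.distrib sum_divide_distrib)
  also have "\<dots> \<le> B * (\<Sum>i\<in>I. (e i)\<^sup>2)" using row col by simp
  finally show ?thesis using 1 2 by linarith
qed

text \<open>A Riemann sum of the decreasing majorant: on the cell to the left of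
  \<open>k / b\<close> the majorant is at least \<open>V (k / b)\<close>, so cells of length
  \<open>1 / b\<close> add up to at most its integral \<open>J\<close>. Index 0 has no such cell
  inside \<open>{0..}\<close> and is treated separately.\<close>

lemma hac_kernel_sum:
  assumes "hac_kernel W"
  obtains J where "0 \<le> J" "\<And>b n. 0 < b \<Longrightarrow> (\<Sum>k\<in>{1..n}. W (real k / b)) \<le> b * J"
proof -
  obtain V where V: "antimono_on {0..} V" "set_integrable lborel {0..} V" "\<And>t. 0 \<le> t \<Longrightarrow> \<bar>W t\<bar> \<le> V t"
    using assms by (auto simp: hac_kernel_def)
  define f where "f x = indicator {0..} x * V x" for x :: real
  have f: "integrable lborel f" using V(2) by (simp add: set_integrable_def f_def[abs_def])
  have V0: "0 \<le> V t" if "0 \<le> t" for t using V(3)[OF that] by linarith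
  have f0: "0 \<le> f x" for x using V0 by (simp add: f_def indicator_def)
  define J where "J = (LINT x|lborel. f x)"
  show thesis
  proof (rule that)
    show "0 \<le> J" unfolding J_def by (rule integral_nonneg_AE) (use f0 in auto)
    fix b :: real and n :: nat assume b: "0 < b"
    let ?A = "\<lambda>k. {real (k - 1) / b<..real k / b}"
    have le: "real (k - 1) / b \<le> real k / b" for k using b by (intro divide_right_mono) auto
    let ?s = "\<lambda>x. \<Sum>k\<in>{1..n}. V (real k / b) * indicator (?A k) x"
    have iind: "integrable lborel (\<lambda>x. V (real k / b) * indicator (?A k) x)" for k
      using le by (intro integrable_mult_right integrable_real_indicator) auto
    have sle: "?s x \<le> f x" for x
    proof (cases "\<exists>k0\<in>{1..n}. x \<in> ?A k0")
      case True
      then obtain k0 where k0: "k0 \<in> {1..n}" "x \<in> ?A k0" by blast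
      have uniq: "k = k0" if "k \<in> {1..n}" "x \<in> ?A k" for k
      proof -
        have "real (k - 1) / b < real k0 / b" "real (k0 - 1) / b < real k / b"
          using that(2) k0(2) by auto
        then have "real (k - 1) < real k0" "real (k0 - 1) < real k"
          using b by (simp_all add: divide_less_cancel)
        then show ?thesis using that(1) k0(1) by auto
      qed
      have "0 \<le> real (k0 - 1) / b" using b by simp
      then have x0: "0 \<le> x" using k0(2) unfolding greaterThanAtMost_iff by linarith
      have "?s x = (\<Sum>k\<in>{1..n}. if k = k0 then V (real k0 / b) else 0)"
      proof (rule sum.cong)
        fix k assume "k \<in> {1..n}"
        then have "x \<in> ?A k \<longleftrightarrow> k = k0" using uniq k0(2) by blast
        then show "V (real k / b) * indicator (?A k) x = (if k = k0 then V (real k0 / b) else 0)"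
          by (simp only: indicator_def of_bool_def) simp
      qed simp
      also have "\<dots> = V (real k0 / b)" using k0(1) by simp
      also have "\<dots> \<le> V x"
      proof (rule monotone_onD[OF V(1)])
        show "x \<in> {0..}" "real k0 / b \<in> {0..}" "x \<le> real k0 / b" using x0 b k0(2) by simp_all
      qed
      also have "V x = f x" using x0 by (simp add: f_def)
      finally show ?thesis .
    next
      case False
      then have "?s x = 0" by (intro sum.neutral) (auto simp: indicator_def)
      then show ?thesis using f0[of x] by simp
    qed
    have "(LINT x|lborel. ?s x) = (\<Sum>k\<in>{1..n}. LINT x|lborel. V (real k / b) * indicator (?A k) x)"
      by (rule Bochner_Integration.integral_sum) (rule iind)
    also have "\<dots> = (\<Sum>k\<in>{1..n}. V (real k / b) * (1 / b))"
    proof (rule sum.cong)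
      fix k assume k: "k \<in> {1..n}"
      then have "real k / b - real (k - 1) / b = 1 / b" by (simp add: of_nat_diff diff_divide_distrib[symmetric])
      then show "(LINT x|lborel. V (real k / b) * indicator (?A k) x) = V (real k / b) * (1 / b)" using le[of k] by simp
    qed simp
    finally have eq: "(LINT x|lborel. ?s x) = (\<Sum>k\<in>{1..n}. V (real k / b) * (1 / b))" .
    have "(LINT x|lborel. ?s x) \<le> J" unfolding J_def
      by (intro integral_mono Bochner_Integration.integrable_sum iind f sle)
    then have "(\<Sum>k\<in>{1..n}. V (real k / b)) / b \<le> J" unfolding eq by (simp add: sum_divide_distrib)
    then have "(\<Sum>k\<in>{1..n}. V (real k / b)) \<le> b * J" using b by (simp add: pos_divide_le_eq mult.commute)
    moreover have "(\<Sum>k\<in>{1..n}. W (real k / b)) \<le> (\<Sum>k\<in>{1..n}. V (real k / b))"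
      using V(3) b by (intro sum_mono) (auto intro: order_trans[OF abs_ge_self])
    ultimately show "(\<Sum>k\<in>{1..n}. W (real k / b)) \<le> b * J" by linarith
  qed
qed

text \<open>The diagonal weight is at most 1, and every positive distance occurs at most once on
  either side.\<close>

lemma symmetric_row_sum:
  fixes w :: "nat \<Rightarrow> real"
  assumes w: "\<And>k. 0 \<le> w k" "w 0 \<le> 1" and B: "(\<Sum>k\<in>{1..m}. w k) \<le> B" and A: "finite A" "\<And>j. j \<in> A \<Longrightarrow> nat \<bar>i - j\<bar> \<le> m"
  shows "(\<Sum>j\<in>A. w (nat \<bar>i - j\<bar>)) \<le> 1 + 2 * B"
proof -
  have part: "(\<Sum>j\<in>D. w (nat \<bar>i - j\<bar>)) \<le> B" if "D \<subseteq> A" "inj_on (\<lambda>j. nat \<bar>i - j\<bar>) D" "i \<notin> D" for D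
  proof -
    have "(\<Sum>j\<in>D. w (nat \<bar>i - j\<bar>)) = (\<Sum>k\<in>(\<lambda>j. nat \<bar>i - j\<bar>) ` D. w k)"
      using that(2) by (simp add: sum.reindex)
    also have "\<dots> \<le> (\<Sum>k\<in>{1..m}. w k)"
    proof (rule sum_mono2)
      show "(\<lambda>j. nat \<bar>i - j\<bar>) ` D \<subseteq> {1..m}"
      proof (rule image_subsetI)
        fix j assume "j \<in> D"
        then have "nat \<bar>i - j\<bar> \<le> m" "j \<noteq> i" using A(2) that by auto
        then show "nat \<bar>i - j\<bar> \<in> {1..m}" by auto
      qed
    qed (use w in auto)
    finally show ?thesis using B by linarith
  qed
  have "(\<Sum>j\<in>A. w (nat \<bar>i - j\<bar>)) = (\<Sum>j\<in>{j\<in>A. j < i}. w (nat \<bar>i - j\<bar>)) + (\<Sum>j\<in>{j\<in>A. \<not> j < i}. w (nat \<bar>i - j\<bar>))"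
    by (subst sum.union_disjoint[symmetric]) (auto simp: A intro: sum.cong)
  also have "(\<Sum>j\<in>{j\<in>A. \<not> j < i}. w (nat \<bar>i - j\<bar>)) = (\<Sum>j\<in>{j\<in>A. j = i}. w (nat \<bar>i - j\<bar>)) + (\<Sum>j\<in>{j\<in>A. i < j}. w (nat \<bar>i - j\<bar>))"
    by (subst sum.union_disjoint[symmetric]) (auto simp: A intro: sum.cong)
  also have "(\<Sum>j\<in>{j\<in>A. j = i}. w (nat \<bar>i - j\<bar>)) \<le> (\<Sum>j\<in>{i}. w (nat \<bar>i - j\<bar>))"
    by (rule sum_mono2) (use w in auto)
  also have "\<dots> \<le> 1" using w by simp
  finally show ?thesis
    using part[of "{j\<in>A. j < i}"] part[of "{j\<in>A. i < j}"] by (force simp: inj_on_def)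
qed

text \<open>Dominated convergence for the counting measure, with majorant
  \<open>|c r|\<close>.\<close>

lemma weighted_infsum_limit:
  fixes c :: "int \<Rightarrow> real" and v :: "nat \<Rightarrow> int \<Rightarrow> real"
  assumes c: "(\<lambda>r. norm (c r)) summable_on UNIV" and S: "\<And>n. finite (S n)" "\<And>n r. r \<notin> S n \<Longrightarrow> v n r = 0"
    and v: "\<And>n r. \<bar>v n r\<bar> \<le> 1" "\<And>r. (\<lambda>n. v n r) \<longlonglongrightarrow> 1"
  shows "(\<lambda>n. \<Sum>r\<in>S n. v n r * c r) \<longlonglongrightarrow> infsum c UNIV"
proof -
  have abs: "Infinite_Set_Sum.abs_summable_on c UNIV" using c by (simp only: abs_summable_equivalent[symmetric])
  then have int: "integrable (count_space UNIV) c" by (simp add: Infinite_Set_Sum.abs_summable_on_def)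
  have "(\<lambda>n. LINT r|count_space UNIV. v n r * c r) \<longlonglongrightarrow> (LINT r|count_space UNIV. c r)"
  proof (rule integral_dominated_convergence[where w = "\<lambda>r. \<bar>c r\<bar>"])
    show "integrable (count_space UNIV) (\<lambda>r. \<bar>c r\<bar>)" using int by simp
    show "AE r in count_space UNIV. (\<lambda>n. v n r * c r) \<longlonglongrightarrow> c r"
      using tendsto_mult[OF v(2) tendsto_const] by (intro AE_I2) fastforce
    show "AE r in count_space UNIV. norm (v n r * c r) \<le> \<bar>c r\<bar>" for n
      using v(1) by (intro AE_I2) (simp add: abs_mult mult_left_le_one_le)
  qed auto
  moreover have "(LINT r|count_space UNIV. v n r * c r) = (\<Sum>r\<in>S n. v n r * c r)" for n
  proof -
    have sub: "{r. v n r * c r \<noteq> 0} \<subseteq> S n" using S(2) by force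
    then have f: "finite {r. v n r * c r \<noteq> 0}" using S(1) finite_subset by blast
    have "(LINT r|count_space UNIV. v n r * c r) = (\<Sum>r | r \<in> UNIV \<and> v n r * c r \<noteq> 0. v n r * c r)"
      by (rule lebesgue_integral_count_space_finite_support) (use f in simp)
    also have "\<dots> = (\<Sum>r\<in>S n. v n r * c r)"
      by (rule sum.mono_neutral_left) (use sub S(1) in auto)
    finally show ?thesis .
  qed
  moreover have "(LINT r|count_space UNIV. c r) = infsum c UNIV"
    using infsetsum_infsum[OF abs] by (simp add: infsetsum_def)
  ultimately show ?thesis by simp
qed

lemma sum_centered_sq_le:
  fixes y :: "'b \<Rightarrow> real"
  assumes "finite A"
  shows "(\<Sum>i\<in>A. (y i - (\<Sum>j\<in>A. y j) / real (card A))\<^sup>2) \<le> (\<Sum>i\<in>A. (y i)\<^sup>2)"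
proof (cases "A = {}")
  case False
  define m where "m = (\<Sum>j\<in>A. y j) / real (card A)"
  have N: "0 < real (card A)" using False assms by (simp add: card_gt_0_iff)
  have s: "(\<Sum>j\<in>A. y j) = real (card A) * m" using N by (simp add: m_def)
  have "(\<Sum>i\<in>A. (y i - m)\<^sup>2) = (\<Sum>i\<in>A. (y i)\<^sup>2 - (2 * m) * y i + m\<^sup>2)"
    by (intro sum.cong refl) (simp add: power2_diff)
  also have "\<dots> = (\<Sum>i\<in>A. (y i)\<^sup>2) - 2 * m * (\<Sum>i\<in>A. y i) + real (card A) * m\<^sup>2"
    unfolding sum.distrib sum_subtractf sum_distrib_left[symmetric] by simp
  also have "\<dots> = (\<Sum>i\<in>A. (y i)\<^sup>2) - real (card A) * m\<^sup>2" by (simp add: s power2_eq_square)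
  also have "\<dots> \<le> (\<Sum>i\<in>A. (y i)\<^sup>2)" by simp
  finally show ?thesis by (simp add: m_def)
qed simp

context prob_space
begin

lemma tendsto_in_prob_dominated:
  assumes D: "tendsto_in_prob M D 0" and Y: "\<And>n. Y n \<in> borel_measurable M"
    and le: "\<forall>\<^sub>F n in sequentially. \<forall>\<omega>\<in>space M. \<bar>Y n \<omega>\<bar> \<le> D n \<omega>"
  shows "tendsto_in_prob M Y 0"
proof (rule tendsto_in_probI[OF Y])
  fix \<epsilon> :: real assume \<epsilon>: "0 < \<epsilon>"
  have "\<forall>\<^sub>F n in sequentially. \<forall>\<omega>\<in>space M - {\<omega> \<in> space M. \<epsilon> < \<bar>D n \<omega> - 0\<bar>}. \<bar>Y n \<omega> - 0\<bar> \<le> \<epsilon>"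
    using le by eventually_elim force
  with tendsto_in_probD[OF D \<epsilon>]
  show "\<exists>B. vanishing B \<and> (\<forall>\<^sub>F n in sequentially. \<forall>\<omega>\<in>space M - B n. \<bar>Y n \<omega> - 0\<bar> \<le> \<epsilon>)"
    by blast
qed

lemma abs_tendsto_in_prob:
  assumes "tendsto_in_prob M Y 0"
  shows "tendsto_in_prob M (\<lambda>n \<omega>. \<bar>Y n \<omega>\<bar>) 0"
  using assms by (simp add: tendsto_in_prob_def borel_measurable_abs)

end

section \<open>HAC weights and the window around the quantile\<close>

locale hac_setting = quantile_kernel +
  fixes W :: "real \<Rightarrow> real" and b :: "nat \<Rightarrow> real"
  assumes hac: "hac_kernel W"
    and b_pos: "\<And>n. 1 \<le> n \<Longrightarrow> 0 < b n"
    and b_top: "filterlim b at_top sequentially"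
    and b_sqrt: "(\<lambda>n. b n / sqrt (real n)) \<longlonglongrightarrow> 0"
begin

definition w :: "nat \<Rightarrow> int \<Rightarrow> real" where
  "w n k = W (real_of_int \<bar>k\<bar> / b n)"

text \<open>Fixed once, so that the same constant serves all bandwidths and all lengths of the
  sum.\<close>

definition J :: real where
  "J = (SOME J. 0 \<le> J \<and> (\<forall>b>0. \<forall>n::nat. (\<Sum>k\<in>{1..n}. W (real k / b)) \<le> b * J))"

lemma J: "0 \<le> J" "0 < c \<Longrightarrow> (\<Sum>k\<in>{1..n}. W (real k / c)) \<le> c * J"
proof -
  have "\<exists>J. 0 \<le> J \<and> (\<forall>b>0. \<forall>n::nat. (\<Sum>k\<in>{1..n}. W (real k / b)) \<le> b * J)"
    by (rule hac_kernel_sum[OF hac]) blast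
  from someI_ex[OF this] show "0 \<le> J" "0 < c \<Longrightarrow> (\<Sum>k\<in>{1..n}. W (real k / c)) \<le> c * J"
    unfolding J_def by blast+
qed

text \<open>Bound for the row sums of the weight matrix \<open>w n (i - j)\<close>: the diagonal
  plus two one-sided sums. Its order is that of \<open>b n\<close>.\<close>

definition B :: "nat \<Rightarrow> real" where "B n = 1 + 2 * (b n * J)"

lemma W_bounds: "0 \<le> t \<Longrightarrow> 0 \<le> W t" "0 \<le> t \<Longrightarrow> W t \<le> 1" "W 0 = 1"
  using hac by (auto simp: hac_kernel_def)

lemma w_bounds:
  assumes "1 \<le> n"
  shows "0 \<le> w n k" "w n k \<le> 1"
  using W_bounds b_pos[OF assms] by (auto simp: w_def)

lemma w_abs [simp]: "w n \<bar>k\<bar> = w n k"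
  by (simp add: w_def)

lemma w_row_sum:
  assumes n: "1 \<le> n" and A: "finite A" "\<And>j. j \<in> A \<Longrightarrow> nat \<bar>i - j\<bar> \<le> n"
  shows "(\<Sum>j\<in>A. w n (i - j)) \<le> B n"
proof -
  have "(\<Sum>j\<in>A. W (real (nat \<bar>i - j\<bar>) / b n)) \<le> 1 + 2 * (b n * J)"
    by (rule symmetric_row_sum[OF _ _ J(2) A]) (use W_bounds b_pos[OF n] in auto)
  then show ?thesis by (simp add: w_def B_def)
qed

lemma B_ge1: "1 \<le> n \<Longrightarrow> 1 \<le> B n"
  using b_pos[of n] J(1) by (simp add: B_def)

lemma B_sqrt: "(\<lambda>n. B n / sqrt (real n)) \<longlonglongrightarrow> 0"
proof -
  have "(\<lambda>n. 1 / sqrt (real n) + 2 * J * (b n / sqrt (real n))) \<longlonglongrightarrow> 0 + 2 * J * 0"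
    by (intro tendsto_intros b_sqrt) real_asymp
  then show ?thesis by (simp add: B_def add_divide_distrib mult_ac)
qed

text \<open>The geometric mean of \<open>1 / sqrt n\<close> and \<open>1 / b n\<close>. As
  \<open>b n / sqrt n\<close> tends to 0, it is of larger order than \<open>1 / sqrt n\<close>, the
  order of the fluctuations of \<open>U_stat\<close>, while \<open>b n * rt n\<close> still tends to
  0.\<close>

definition rt :: "nat \<Rightarrow> real" where "rt n = 1 / sqrt (sqrt (real n) * b n)"

lemma rt_eqs:
  assumes n: "1 \<le> n"
  shows "0 < rt n" "sqrt (real n) * rt n = sqrt (inverse (b n / sqrt (real n)))" "b n * rt n = sqrt (b n / sqrt (real n))"
proof -
  define s where "s = sqrt (real n)"
  have s: "0 < s" using n by (simp add: s_def)
  have bn: "0 < b n" by (rule b_pos[OF n])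
  have e: "x / (sqrt x * sqrt y) = sqrt (x / y)" if "0 < x" "0 < y" for x y :: real
  proof -
    have "x / (sqrt x * sqrt y) = (sqrt x * sqrt x) / (sqrt x * sqrt y)" using that by simp
    also have "\<dots> = sqrt x / sqrt y" by (rule mult_divide_mult_cancel_left) (use that in simp)
    finally show ?thesis by (simp add: real_sqrt_divide)
  qed
  show "0 < rt n" using s bn by (simp add: rt_def s_def)
  show "sqrt (real n) * rt n = sqrt (inverse (b n / sqrt (real n)))"
    using e[OF s bn] by (simp add: rt_def s_def[symmetric] real_sqrt_mult)
  show "b n * rt n = sqrt (b n / sqrt (real n))"
    using e[OF bn s] by (simp add: rt_def s_def[symmetric] real_sqrt_mult mult.commute)
qed

lemma eventually_ge1: "\<forall>\<^sub>F n in sequentially. 1 \<le> n"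
  by (rule eventually_ge_at_top)

lemma b_rt: "(\<lambda>n. b n * rt n) \<longlonglongrightarrow> 0"
proof -
  have "(\<lambda>n. sqrt (b n / sqrt (real n))) \<longlonglongrightarrow> sqrt 0" by (intro tendsto_intros b_sqrt)
  moreover have "\<forall>\<^sub>F n in sequentially. sqrt (b n / sqrt (real n)) = b n * rt n"
    using eventually_ge1 by eventually_elim (simp only: rt_eqs)
  ultimately show ?thesis by (auto intro: Lim_transform_eventually)
qed

lemma scale_rt: "scale rt"
  unfolding scale_def
proof (intro conjI)
  show "\<forall>\<^sub>F n in sequentially. 0 < rt n" using eventually_ge1 by eventually_elim (rule rt_eqs)
  have "filterlim (\<lambda>n. inverse (b n / sqrt (real n))) at_top sequentially"
  proof (rule filterlim_inverse_at_top[OF b_sqrt])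
    show "\<forall>\<^sub>F n in sequentially. 0 < b n / sqrt (real n)"
      using eventually_ge1 by eventually_elim (use b_pos in auto)
  qed
  then have "filterlim (\<lambda>n. sqrt (inverse (b n / sqrt (real n)))) at_top sequentially"
    by (rule filterlim_compose[OF sqrt_at_top])
  moreover have "\<forall>\<^sub>F n in sequentially. sqrt (inverse (b n / sqrt (real n))) = sqrt (real n) * rt n"
    using eventually_ge1 by eventually_elim (simp only: rt_eqs)
  ultimately show "filterlim (\<lambda>n. sqrt (real n) * rt n) at_top sequentially"
    by (simp only: filterlim_cong[OF refl refl])
  show "rt \<longlonglongrightarrow> 0"
  proof (rule tendsto_sandwich[OF _ _ tendsto_const b_rt])
    show "\<forall>\<^sub>F n in sequentially. 0 \<le> rt n" using eventually_ge1 by eventually_elim (simp add: rt_eqs less_imp_le)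
    show "\<forall>\<^sub>F n in sequentially. rt n \<le> b n * rt n"
      using eventually_ge1 filterlim_at_top[THEN iffD1, OF b_top, rule_format, of 1]
    proof eventually_elim
      case (elim n)
      then show ?case using rt_eqs(1)[OF elim(1)] by (simp add: mult_le_cancel_right1)
    qed
  qed
qed

lemma B_rt: "(\<lambda>n. B n * rt n) \<longlonglongrightarrow> 0"
proof -
  have "(\<lambda>n. rt n + 2 * J * (b n * rt n)) \<longlonglongrightarrow> 0 + 2 * J * 0"
    using scale_rt by (intro tendsto_intros b_rt) (simp add: scale_def)
  then show ?thesis by (simp add: B_def algebra_simps)
qed

section \<open>Error of the estimated projections\<close>

definition err :: "nat \<Rightarrow> 'a \<Rightarrow> int \<Rightarrow> real" where
  "err n \<omega> i = h1_hat X g n \<omega> (X i \<omega>) (tn n \<omega>) - a q i \<omega>"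

text \<open>Three sources of error: the random level, enclosed by the deterministic levels
  \<open>q - rt n\<close> and \<open>q + rt n\<close>; the row remainders; and the centring by a
  sample mean.\<close>

definition \<Theta> :: "nat \<Rightarrow> 'a \<Rightarrow> real" where
  "\<Theta> n \<omega> = (V n \<omega> (q + rt n) - V n \<omega> (q - rt n)) + (\<Sum>i\<in>{1..int n}. (R q n i \<omega>)\<^sup>2) / real n + (abar q n \<omega>)\<^sup>2"

lemma V_mono: "s \<le> t \<Longrightarrow> V n \<omega> s \<le> V n \<omega> t"
  unfolding V_def by (intro divide_right_mono sum_mono h_ker_mono) auto

lemma Theta_nonneg: "1 \<le> n \<Longrightarrow> 0 \<le> \<Theta> n \<omega>"
  unfolding \<Theta>_def using rt_eqs(1)[of n] by (intro add_nonneg_nonneg divide_nonneg_nonneg sum_nonneg) (auto intro: V_mono)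

lemma err_bound:
  assumes n: "1 \<le> n" and close: "\<bar>tn n \<omega> - q\<bar> \<le> rt n"
  shows "(\<Sum>i\<in>{1..int n}. (err n \<omega> i)\<^sup>2) / real n \<le> 3 * \<Theta> n \<omega>"
proof -
  let ?I = "{1..int n}"
  define N where "N = real n"
  have N: "0 < N" using n by (simp add: N_def)
  define G where "G i t = (\<Sum>j\<in>?I. h_ker g (X i \<omega>) (X j \<omega>) t) / N" for i t
  define y where "y i = G i (tn n \<omega>) - G i q" for i
  define z where "z i = R q n i \<omega>" for i
  have VG: "V n \<omega> t = (\<Sum>i\<in>?I. G i t) / N" for t
    by (simp add: V_def G_def N_def sum_divide_distrib[symmetric] power2_eq_square)
  have zG: "z i = G i q - H q (X i \<omega>)" for i by (simp add: z_def R_def G_def N_def)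
  \<comment> \<open>The centring in \<open>h1_hat\<close> centres the level error \<open>y\<close>
    and the row remainder \<open>z\<close>; since \<open>a\<close> is centred at
    \<open>U_fun\<close> rather than at its sample mean, \<open>abar\<close> is left over.\<close>
  have eq: "err n \<omega> i = (y i - (\<Sum>j\<in>?I. y j) / N) + (z i - (\<Sum>j\<in>?I. z j) / N) - abar q n \<omega>" for i
  proof -
    have "h1_hat X g n \<omega> (X i \<omega>) (tn n \<omega>) = G i (tn n \<omega>) - V n \<omega> (tn n \<omega>)"
      by (simp add: h1_hat_def G_def V_def N_def)
    moreover have "abar q n \<omega> = (\<Sum>j\<in>?I. H q (X j \<omega>)) / N - U_fun M X g q"
      using N by (simp add: abar_def a_eq sum_subtractf N_def diff_divide_distrib)
    ultimately show ?thesis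
      unfolding err_def a_eq VG zG y_def sum_subtractf diff_divide_distrib by simp
  qed
  have Gm: "G i s \<le> G i t" if "s \<le> t" for i s t
    unfolding G_def using that N by (intro divide_right_mono sum_mono h_ker_mono) auto
  have G01: "0 \<le> G i t" "G i t \<le> 1" for i t
  proof -
    show "0 \<le> G i t" unfolding G_def using N by (intro divide_nonneg_nonneg sum_nonneg) auto
    have "(\<Sum>j\<in>?I. h_ker g (X i \<omega>) (X j \<omega>) t) \<le> (\<Sum>j\<in>?I. 1)" by (intro sum_mono) simp
    then show "G i t \<le> 1" using N by (simp add: G_def N_def)
  qed
  \<comment> \<open>Row averages lie in \<open>[0, 1]\<close>, so the square of a difference is at
    most its absolute value, and monotonicity bounds that by an increment between fixed levels.
    Averaging over \<open>i\<close> turns these increments into one of \<open>V\<close>, which is of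
    the order of the window and not of its square.\<close>
  have y2: "(y i)\<^sup>2 \<le> G i (q + rt n) - G i (q - rt n)" for i
  proof -
    have "\<bar>y i\<bar> \<le> 1" unfolding y_def by (rule abs_diff_le_one) (rule G01)+
    then have "(y i)\<^sup>2 \<le> \<bar>y i\<bar>" using mult_left_mono[of "\<bar>y i\<bar>" 1 "\<bar>y i\<bar>"] by (simp add: power2_eq_square abs_mult_self_eq)
    moreover have "G i (q - rt n) \<le> G i (tn n \<omega>)" "G i (tn n \<omega>) \<le> G i (q + rt n)" "G i (q - rt n) \<le> G i q" "G i q \<le> G i (q + rt n)"
      using close by (auto intro!: Gm)
    then have "\<bar>y i\<bar> \<le> G i (q + rt n) - G i (q - rt n)" unfolding y_def by linarith
    ultimately show ?thesis by linarith
  qed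
  have sq3: "(x1 + x2 - x3)\<^sup>2 \<le> 3 * x1\<^sup>2 + 3 * x2\<^sup>2 + 3 * x3\<^sup>2" for x1 x2 x3 :: real
  proof -
    have "0 \<le> (x1 - x2)\<^sup>2 + (x1 + x3)\<^sup>2 + (x2 + x3)\<^sup>2" by simp
    then show ?thesis by (simp add: power2_eq_square algebra_simps)
  qed
  have "(\<Sum>i\<in>?I. (err n \<omega> i)\<^sup>2) \<le> (\<Sum>i\<in>?I. 3 * (y i - (\<Sum>j\<in>?I. y j) / N)\<^sup>2 + 3 * (z i - (\<Sum>j\<in>?I. z j) / N)\<^sup>2 + 3 * (abar q n \<omega>)\<^sup>2)"
    unfolding eq by (intro sum_mono sq3)
  also have "\<dots> = 3 * (\<Sum>i\<in>?I. (y i - (\<Sum>j\<in>?I. y j) / N)\<^sup>2) + 3 * (\<Sum>i\<in>?I. (z i - (\<Sum>j\<in>?I. z j) / N)\<^sup>2) + 3 * (N * (abar q n \<omega>)\<^sup>2)"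
    by (simp add: sum.distrib sum_distrib_left N_def)
  also have "\<dots> \<le> 3 * (\<Sum>i\<in>?I. (y i)\<^sup>2) + 3 * (\<Sum>i\<in>?I. (z i)\<^sup>2) + 3 * (N * (abar q n \<omega>)\<^sup>2)"
    using sum_centered_sq_le[of ?I y] sum_centered_sq_le[of ?I z] by (simp add: N_def)
  also have "(\<Sum>i\<in>?I. (y i)\<^sup>2) \<le> N * (V n \<omega> (q + rt n) - V n \<omega> (q - rt n))"
  proof -
    have "(\<Sum>i\<in>?I. (y i)\<^sup>2) \<le> (\<Sum>i\<in>?I. G i (q + rt n) - G i (q - rt n))" by (intro sum_mono y2)
    also have "\<dots> = N * (V n \<omega> (q + rt n) - V n \<omega> (q - rt n))" using N by (simp add: VG sum_subtractf right_diff_distrib)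
    finally show ?thesis .
  qed
  finally have "(\<Sum>i\<in>?I. (err n \<omega> i)\<^sup>2) \<le> 3 * (N * (V n \<omega> (q + rt n) - V n \<omega> (q - rt n))) + 3 * (\<Sum>i\<in>?I. (z i)\<^sup>2) + 3 * (N * (abar q n \<omega>)\<^sup>2)"
    by simp
  then have "(\<Sum>i\<in>?I. (err n \<omega> i)\<^sup>2) / N \<le> (3 * (N * (V n \<omega> (q + rt n) - V n \<omega> (q - rt n))) + 3 * (\<Sum>i\<in>?I. (z i)\<^sup>2) + 3 * (N * (abar q n \<omega>)\<^sup>2)) / N"
    using N by (intro divide_right_mono) auto
  also have "\<dots> = 3 * \<Theta> n \<omega>"
  proof -
    have "(3 * (N * x) + 3 * y + 3 * (N * z)) / N = 3 * (x + y / N + z)" for x y z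
      using N by (simp add: add_divide_distrib)
    then show ?thesis unfolding \<Theta>_def z_def N_def .
  qed
  finally show ?thesis by (simp add: N_def)
qed

lemma err_meas [measurable]: "(\<lambda>\<omega>. err n \<omega> i) \<in> borel_measurable M"
  unfolding err_def h1_hat_def by measurable

lemma Theta_meas [measurable]: "\<Theta> n \<in> borel_measurable M"
  unfolding \<Theta>_def by measurable

lemma Theta_expectation:
  assumes n: "1 \<le> n" and T: "q + rt n \<in> T" "q - rt n \<in> T" "q \<in> T"
  shows "integrable M (\<Theta> n)"
    "expectation (\<Theta> n) \<le> (U_fun M X g (q + rt n) - U_fun M X g (q - rt n)) + 2 * ((1 + 16 * \<Gamma>) / sqrt (real n)) + 8 * \<Gamma> / real n"
proof -
  note V1 = V_L1[OF T(1) n] and V2 = V_L1[OF T(2) n] and r = mean_R_sq[OF T(3) n] and ab = abar_sq[OF T(3) n]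
  let ?U = "U_fun M X g (q + rt n) - U_fun M X g (q - rt n)"
  let ?bd = "\<lambda>\<omega>. ?U + \<bar>V n \<omega> (q + rt n) - U_fun M X g (q + rt n)\<bar> + \<bar>V n \<omega> (q - rt n) - U_fun M X g (q - rt n)\<bar>
     + (\<Sum>i\<in>{1..int n}. (R q n i \<omega>)\<^sup>2) / real n + (abar q n \<omega>)\<^sup>2"
  have i1: "integrable M (\<lambda>\<omega>. \<bar>V n \<omega> (q + rt n) - U_fun M X g (q + rt n)\<bar>)" using V1(1) by simp
  have i2: "integrable M (\<lambda>\<omega>. \<bar>V n \<omega> (q - rt n) - U_fun M X g (q - rt n)\<bar>)" using V2(1) by simp
  have ic: "integrable M (\<lambda>\<omega>. ?U)" by simp
  note ii = ic i1 i2 r(1) ab(1)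
  have ibd: "integrable M ?bd" by (intro Bochner_Integration.integrable_add ii)
  have le: "\<Theta> n \<omega> \<le> ?bd \<omega>" for \<omega>
  proof -
    have "x - y \<le> x' - y' + \<bar>x - x'\<bar> + \<bar>y - y'\<bar>" for x y x' y' :: real by linarith
    then show ?thesis unfolding \<Theta>_def by (intro add_right_mono)
  qed
  show iT: "integrable M (\<Theta> n)"
    by (rule Bochner_Integration.integrable_bound[OF ibd])
       (use le Theta_nonneg[OF n] in \<open>auto intro!: AE_I2 intro: order_trans[OF le abs_ge_self]\<close>)
  have "expectation (\<Theta> n) \<le> expectation ?bd" by (rule integral_mono[OF iT ibd le])
  also have "\<dots> = ?U + expectation (\<lambda>\<omega>. \<bar>V n \<omega> (q + rt n) - U_fun M X g (q + rt n)\<bar>) + expectation (\<lambda>\<omega>. \<bar>V n \<omega> (q - rt n) - U_fun M X g (q - rt n)\<bar>)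
     + expectation (\<lambda>\<omega>. (\<Sum>i\<in>{1..int n}. (R q n i \<omega>)\<^sup>2) / real n) + expectation (\<lambda>\<omega>. (abar q n \<omega>)\<^sup>2)"
    by (simp only: Bochner_Integration.integral_add Bochner_Integration.integrable_add ii lebesgue_integral_const prob_space scaleR_one)
  also have "\<dots> \<le> ?U + (1 + 16 * \<Gamma>) / sqrt (real n) + (1 + 16 * \<Gamma>) / sqrt (real n) + 6 * \<Gamma> / real n + 2 * \<Gamma> / real n"
    by (intro add_mono order_refl V1(2) V2(2) r(2) ab(2))
  also have "\<dots> = ?U + 2 * ((1 + 16 * \<Gamma>) / sqrt (real n)) + 8 * \<Gamma> / real n" by (simp add: add_divide_distrib)
  finally show "expectation (\<Theta> n) \<le> ?U + 2 * ((1 + 16 * \<Gamma>) / sqrt (real n)) + 8 * \<Gamma> / real n" .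
qed

lemma Theta_tendsto: "tendsto_in_prob M (\<lambda>n \<omega>. B n * \<Theta> n \<omega>) 0"
proof (rule tendsto_in_prob_L1)
  let ?u = "\<lambda>n. U_fun M X g (q + rt n) - U_fun M X g (q - rt n)"
  have rt0: "rt \<longlonglongrightarrow> 0" using scale_rt by (simp add: scale_def)
  show "(\<lambda>n. B n * (?u n + 2 * ((1 + 16 * \<Gamma>) / sqrt (real n)) + 8 * \<Gamma> / real n)) \<longlonglongrightarrow> 0"
  proof -
    \<comment> \<open>The window term is a difference quotient times \<open>B n * rt n\<close>; the
      other two are of order \<open>B n / sqrt n\<close> and \<open>B n / n\<close>.\<close>
    have "(\<lambda>n. ((U_fun M X g (q + rt n * 1) - p) / rt n - (U_fun M X g (q + rt n * - 1) - p) / rt n) * (B n * rt n)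
       + 2 * (1 + 16 * \<Gamma>) * (B n / sqrt (real n)) + 8 * \<Gamma> * ((B n / sqrt (real n)) * (1 / sqrt (real n))))
       \<longlonglongrightarrow> (u * 1 - u * - 1) * 0 + 2 * (1 + 16 * \<Gamma>) * 0 + 8 * \<Gamma> * (0 * 0)"
      by (intro tendsto_intros U_difference_quotient scale_rt B_rt B_sqrt) real_asymp
    moreover have "\<forall>\<^sub>F n in sequentially. ((U_fun M X g (q + rt n * 1) - p) / rt n - (U_fun M X g (q + rt n * - 1) - p) / rt n) * (B n * rt n)
       + 2 * (1 + 16 * \<Gamma>) * (B n / sqrt (real n)) + 8 * \<Gamma> * ((B n / sqrt (real n)) * (1 / sqrt (real n)))
       = B n * (?u n + 2 * ((1 + 16 * \<Gamma>) / sqrt (real n)) + 8 * \<Gamma> / real n)"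
      using eventually_ge1
    proof eventually_elim
      case (elim n)
      have "(B n / sqrt (real n)) * (1 / sqrt (real n)) = B n / real n" by simp
      moreover have "((U_fun M X g (q + rt n * 1) - p) / rt n - (U_fun M X g (q + rt n * - 1) - p) / rt n) * (B n * rt n) = B n * ?u n"
        using rt_eqs(1)[OF elim] by (simp add: diff_divide_distrib[symmetric])
      ultimately show ?case unfolding distrib_left by (simp add: mult_ac)
    qed
    ultimately show ?thesis by (auto intro: Lim_transform_eventually)
  qed
  have T1: "\<forall>\<^sub>F n in sequentially. q + rt n * 1 \<in> T" and T2: "\<forall>\<^sub>F n in sequentially. q + rt n * - 1 \<in> T"
    by (rule eventually_T[OF rt0])+
  have qT: "q \<in> T" using eventually_nhds_x_imp_x[OF T_nhds] .
  show "\<forall>\<^sub>F n in sequentially. integrable M (\<lambda>\<omega>. B n * \<Theta> n \<omega>) \<and>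
     expectation (\<lambda>\<omega>. \<bar>B n * \<Theta> n \<omega> - 0\<bar>) \<le> B n * (?u n + 2 * ((1 + 16 * \<Gamma>) / sqrt (real n)) + 8 * \<Gamma> / real n)"
    using T1 T2 eventually_ge1
  proof eventually_elim
    case (elim n)
    have T': "q + rt n \<in> T" "q - rt n \<in> T" using elim by simp_all
    note E = Theta_expectation[OF elim(3) T' qT]
    have Bn: "0 \<le> B n" using B_ge1[OF elim(3)] by simp
    have "expectation (\<lambda>\<omega>. \<bar>B n * \<Theta> n \<omega> - 0\<bar>) = B n * expectation (\<Theta> n)"
      using Bn Theta_nonneg[OF elim(3)] by (simp add: abs_mult)
    also have "\<dots> \<le> B n * (?u n + 2 * ((1 + 16 * \<Gamma>) / sqrt (real n)) + 8 * \<Gamma> / real n)"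
      by (rule mult_left_mono[OF E(2) Bn])
    finally show ?case using E(1) by simp
  qed
qed measurable

lemma err_tendsto: "tendsto_in_prob M (\<lambda>n \<omega>. B n * ((\<Sum>i\<in>{1..int n}. (err n \<omega> i)\<^sup>2) / real n)) 0"
proof (rule tendsto_in_probI)
  fix \<epsilon> :: real assume \<epsilon>: "0 < \<epsilon>"
  let ?A = "\<lambda>n. {\<omega> \<in> space M. 1 * rt n < \<bar>tn n \<omega> - q\<bar>}" and ?B = "\<lambda>n. {\<omega> \<in> space M. \<epsilon> / 3 < \<bar>B n * \<Theta> n \<omega> - 0\<bar>}"
  have e: "0 < \<epsilon> / 3" using \<epsilon> by simp
  show "\<exists>B'. vanishing B' \<and> (\<forall>\<^sub>F n in sequentially. \<forall>\<omega>\<in>space M - B' n. \<bar>B n * ((\<Sum>i\<in>{1..int n}. (err n \<omega> i)\<^sup>2) / real n) - 0\<bar> \<le> \<epsilon>)"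
  proof (intro exI[of _ "\<lambda>n. ?A n \<union> ?B n"] conjI)
    show "vanishing (\<lambda>n. ?A n \<union> ?B n)"
      by (intro vanishing_Un tn_scaled[OF scale_rt] tendsto_in_probD[OF Theta_tendsto e]) simp
    show "\<forall>\<^sub>F n in sequentially. \<forall>\<omega>\<in>space M - (?A n \<union> ?B n). \<bar>B n * ((\<Sum>i\<in>{1..int n}. (err n \<omega> i)\<^sup>2) / real n) - 0\<bar> \<le> \<epsilon>"
      using eventually_ge1
    proof eventually_elim
      case (elim n)
      have Bn: "0 \<le> B n" using B_ge1[OF elim] by simp
      show ?case
      proof
        fix \<omega> assume "\<omega> \<in> space M - (?A n \<union> ?B n)"
        then have w: "\<bar>tn n \<omega> - q\<bar> \<le> rt n" "\<bar>B n * \<Theta> n \<omega>\<bar> \<le> \<epsilon> / 3" by (auto simp: not_less)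
        have "0 \<le> (\<Sum>i\<in>{1..int n}. (err n \<omega> i)\<^sup>2) / real n" by (intro divide_nonneg_nonneg sum_nonneg) auto
        then have "0 \<le> B n * ((\<Sum>i\<in>{1..int n}. (err n \<omega> i)\<^sup>2) / real n)" using Bn by (rule mult_nonneg_nonneg[rotated])
        moreover have "B n * ((\<Sum>i\<in>{1..int n}. (err n \<omega> i)\<^sup>2) / real n) \<le> B n * (3 * \<Theta> n \<omega>)"
          by (intro mult_left_mono err_bound elim w Bn)
        ultimately show "\<bar>B n * ((\<Sum>i\<in>{1..int n}. (err n \<omega> i)\<^sup>2) / real n) - 0\<bar> \<le> \<epsilon>"
          using w(2) by linarith
      qed
    qed
  qed
qed measurable

section \<open>Replacing the estimated by the true projections\<close>

definition S2 :: "nat \<Rightarrow> 'a \<Rightarrow> real" where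
  "S2 n \<omega> = (\<Sum>r\<in>{- (int n - 1)..int n - 1}. W (real_of_int \<bar>r\<bar> / b n) * rho_hat X g n \<omega> \<bar>r\<bar> (tn n \<omega>))"

text \<open>The quadratic form behind \<open>S2\<close>, evaluated at the unobservable projections
  at the true quantile.\<close>

definition Qa :: "nat \<Rightarrow> 'a \<Rightarrow> real" where
  "Qa n \<omega> = (\<Sum>i\<in>{1..int n}. \<Sum>j\<in>{1..int n}. w n \<bar>i - j\<bar> * (a q i \<omega> * a q j \<omega>)) / real n"

lemma S2_meas [measurable]: "S2 n \<in> borel_measurable M"
  unfolding S2_def rho_hat_def h1_hat_def by measurable

lemma Qa_meas [measurable]: "Qa n \<in> borel_measurable M"
  unfolding Qa_def by measurable

lemma S2_eq: "S2 n \<omega> = (\<Sum>i\<in>{1..int n}. \<Sum>j\<in>{1..int n}. w n \<bar>i - j\<bar> * ((a q i \<omega> + err n \<omega> i) * (a q j \<omega> + err n \<omega> j))) / real n"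
  using lag_sum_eq[where n = n and w = "\<lambda>k. w n k" and y = "\<lambda>i. a q i \<omega> + err n \<omega> i"]
  by (simp add: S2_def rho_hat_def err_def w_def)

definition cross :: "nat \<Rightarrow> 'a \<Rightarrow> real" where
  "cross n \<omega> = (\<Sum>i\<in>{1..int n}. err n \<omega> i * (\<Sum>j\<in>{1..int n}. w n \<bar>i - j\<bar> * a q j \<omega>)) / real n"

text \<open>Normalised by \<open>B n\<close> so that its mean is at most
  \<open>2 * \<Gamma>\<close>, because \<open>weighted_sum_a\<close> is linear in the weights. The
  factor \<open>B n\<close> reappears with the error term in \<open>cross_sq\<close>, where it is
  affordable.\<close>

definition smoothed :: "nat \<Rightarrow> 'a \<Rightarrow> real" where
  "smoothed n \<omega> = (\<Sum>i\<in>{1..int n}. (\<Sum>j\<in>{1..int n}. w n \<bar>i - j\<bar> * a q j \<omega>)\<^sup>2) / real n / B n"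

lemma S2_Qa:
  assumes n: "1 \<le> n"
  shows "\<bar>S2 n \<omega> - Qa n \<omega>\<bar> \<le> 2 * \<bar>cross n \<omega>\<bar> + B n * ((\<Sum>i\<in>{1..int n}. (err n \<omega> i)\<^sup>2) / real n)"
proof -
  have row: "(\<Sum>j\<in>{1..int n}. w n \<bar>i - j\<bar>) \<le> B n" if "i \<in> {1..int n}" for i
    unfolding w_abs by (rule w_row_sum[OF n]) (use that in auto)
  from quadratic_perturbation[of "{1..int n}" "w n" "B n" "\<lambda>i. a q i \<omega>" "err n \<omega>", OF _ w_bounds(1)[OF n] row]
  have "\<bar>S2 n \<omega> * real n - Qa n \<omega> * real n\<bar> \<le> 2 * \<bar>cross n \<omega> * real n\<bar> + B n * (\<Sum>i\<in>{1..int n}. (err n \<omega> i)\<^sup>2)"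
    using n by (simp add: S2_eq Qa_def cross_def)
  then have "\<bar>S2 n \<omega> - Qa n \<omega>\<bar> * real n \<le> (2 * \<bar>cross n \<omega>\<bar> + B n * ((\<Sum>i\<in>{1..int n}. (err n \<omega> i)\<^sup>2) / real n)) * real n"
    using n by (simp add: left_diff_distrib[symmetric] abs_mult distrib_right)
  then show ?thesis using n by simp
qed

lemma q_T: "q \<in> T"
  using eventually_nhds_x_imp_x[OF T_nhds] .

lemma smoothed_L1:
  assumes n: "1 \<le> n"
  shows "integrable M (smoothed n)" "expectation (smoothed n) \<le> 2 * \<Gamma>"
proof -
  let ?I = "{1..int n}"
  have Bn: "0 < B n" using B_ge1[OF n] by simp
  have row: "(\<Sum>j\<in>?I. w n \<bar>i - j\<bar>) \<le> B n" if "i \<in> ?I" for i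
    unfolding w_abs by (rule w_row_sum[OF n]) (use that in auto)
  have int: "integrable M (\<lambda>\<omega>. (\<Sum>j\<in>?I. w n \<bar>i - j\<bar> * a q j \<omega>)\<^sup>2)" for i
  proof (rule integrable_bounded[where B = "(real n)\<^sup>2"])
    fix \<omega>
    have "\<bar>\<Sum>j\<in>?I. w n \<bar>i - j\<bar> * a q j \<omega>\<bar> \<le> (\<Sum>j\<in>?I. \<bar>w n \<bar>i - j\<bar> * a q j \<omega>\<bar>)" by (rule sum_abs)
    also have "\<dots> \<le> (\<Sum>j\<in>?I. 1)"
      using w_bounds[OF n] a_bound by (intro sum_mono abs_mult_le_one) auto
    finally have "\<bar>\<Sum>j\<in>?I. w n \<bar>i - j\<bar> * a q j \<omega>\<bar> \<le> \<bar>real n\<bar>" by simp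
    then show "\<bar>(\<Sum>j\<in>?I. w n \<bar>i - j\<bar> * a q j \<omega>)\<^sup>2\<bar> \<le> (real n)\<^sup>2" by (simp only: abs_power2 abs_le_square_iff)
  qed measurable
  show "integrable M (smoothed n)"
    unfolding smoothed_def by (intro Bochner_Integration.integrable_divide Bochner_Integration.integrable_sum int)
  have "expectation (smoothed n) = (\<Sum>i\<in>?I. expectation (\<lambda>\<omega>. (\<Sum>j\<in>?I. w n \<bar>i - j\<bar> * a q j \<omega>)\<^sup>2)) / real n / B n"
    unfolding smoothed_def by (simp only: integral_divide_zero Bochner_Integration.integral_sum[OF int])
  also have "\<dots> \<le> (\<Sum>i\<in>?I. 2 * \<Gamma> * B n) / real n / B n"
  proof (intro divide_right_mono sum_mono)
    fix i assume i: "i \<in> ?I"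
    have "expectation (\<lambda>\<omega>. (\<Sum>j\<in>?I. w n \<bar>i - j\<bar> * a q j \<omega>)\<^sup>2) \<le> 2 * \<Gamma> * (\<Sum>j\<in>?I. w n \<bar>i - j\<bar>)"
      by (rule weighted_sum_a[OF q_T]) (use w_bounds[OF n] in auto)
    also have "\<dots> \<le> 2 * \<Gamma> * B n" using Gamma_ge by (intro mult_left_mono row i) auto
    finally show "expectation (\<lambda>\<omega>. (\<Sum>j\<in>?I. w n \<bar>i - j\<bar> * a q j \<omega>)\<^sup>2) \<le> 2 * \<Gamma> * B n" .
  qed (use Bn in auto)
  also have "\<dots> = 2 * \<Gamma>" using Bn n by simp
  finally show "expectation (smoothed n) \<le> 2 * \<Gamma>" .
qed

lemma cross_meas [measurable]: "cross n \<in> borel_measurable M"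
  unfolding cross_def by measurable

lemma smoothed_meas [measurable]: "smoothed n \<in> borel_measurable M"
  unfolding smoothed_def by measurable

lemma cross_sq:
  assumes n: "1 \<le> n"
  shows "(cross n \<omega>)\<^sup>2 \<le> B n * ((\<Sum>i\<in>{1..int n}. (err n \<omega> i)\<^sup>2) / real n) * smoothed n \<omega>"
proof -
  have Bn: "0 < B n" using B_ge1[OF n] by simp
  let ?A = "\<lambda>i. \<Sum>j\<in>{1..int n}. w n \<bar>i - j\<bar> * a q j \<omega>"
  have "(\<Sum>i\<in>{1..int n}. err n \<omega> i * ?A i)\<^sup>2 \<le> (\<Sum>i\<in>{1..int n}. (err n \<omega> i)\<^sup>2) * (\<Sum>i\<in>{1..int n}. (?A i)\<^sup>2)"
    by (rule Cauchy_Schwarz_ineq_sum)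
  then have "(\<Sum>i\<in>{1..int n}. err n \<omega> i * ?A i)\<^sup>2 / (real n)\<^sup>2 \<le> (\<Sum>i\<in>{1..int n}. (err n \<omega> i)\<^sup>2) * (\<Sum>i\<in>{1..int n}. (?A i)\<^sup>2) / (real n)\<^sup>2"
    by (intro divide_right_mono) auto
  then show ?thesis using Bn unfolding cross_def smoothed_def by (simp add: power_divide power2_eq_square)
qed

lemma cross_tendsto: "tendsto_in_prob M cross 0"
proof (rule tendsto_in_prob_product_bound[OF err_tendsto, where y = "\<lambda>n \<omega>. \<bar>smoothed n \<omega>\<bar>" and C = "2 * \<Gamma>"])
  have nn: "\<bar>smoothed n \<omega>\<bar> = smoothed n \<omega>" if "1 \<le> n" for n \<omega>
    using B_ge1[OF that] unfolding smoothed_def by (intro abs_of_nonneg divide_nonneg_nonneg sum_nonneg) auto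
  show "\<forall>\<^sub>F n in sequentially. integrable M (\<lambda>\<omega>. \<bar>smoothed n \<omega>\<bar>) \<and> expectation (\<lambda>\<omega>. \<bar>smoothed n \<omega>\<bar>) \<le> 2 * \<Gamma>"
    using eventually_ge1 by eventually_elim (use smoothed_L1 nn in simp)
  show "\<forall>\<^sub>F n in sequentially. \<forall>\<omega>\<in>space M. (cross n \<omega>)\<^sup>2 \<le> B n * ((\<Sum>i\<in>{1..int n}. (err n \<omega> i)\<^sup>2) / real n) * \<bar>smoothed n \<omega>\<bar>"
    using eventually_ge1 by eventually_elim (use cross_sq nn in simp)
qed measurable

lemma S2_minus_Qa: "tendsto_in_prob M (\<lambda>n \<omega>. S2 n \<omega> - Qa n \<omega>) 0"
proof (rule tendsto_in_prob_dominated)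
  have "tendsto_in_prob M (\<lambda>n \<omega>. 2 * \<bar>cross n \<omega>\<bar> + B n * ((\<Sum>i\<in>{1..int n}. (err n \<omega> i)\<^sup>2) / real n)) (2 * 0 + 0)"
    by (intro tendsto_in_prob_add tendsto_in_prob_cmult abs_tendsto_in_prob cross_tendsto err_tendsto)
  then show "tendsto_in_prob M (\<lambda>n \<omega>. 2 * \<bar>cross n \<omega>\<bar> + B n * ((\<Sum>i\<in>{1..int n}. (err n \<omega> i)\<^sup>2) / real n)) 0" by simp
  show "\<forall>\<^sub>F n in sequentially. \<forall>\<omega>\<in>space M. \<bar>S2 n \<omega> - Qa n \<omega>\<bar> \<le> 2 * \<bar>cross n \<omega>\<bar> + B n * ((\<Sum>i\<in>{1..int n}. (err n \<omega> i)\<^sup>2) / real n)"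
    using eventually_ge1 by eventually_elim (use S2_Qa in blast)
qed measurable

section \<open>The quadratic form of the true projections\<close>

definition c :: "int \<Rightarrow> real" where "c r = acov q (nat \<bar>r\<bar>)"

lemma c_abs_summable: "(\<lambda>r. norm (c r)) summable_on UNIV"
proof (rule nonneg_bdd_above_summable_on)
  show "bdd_above (sum (\<lambda>r. norm (c r)) ` {F. F \<subseteq> UNIV \<and> finite F})"
  proof (rule bdd_aboveI2)
    fix F assume "F \<in> {F :: int set. F \<subseteq> UNIV \<and> finite F}"
    then have F: "finite F" by simp
    have "(\<Sum>r\<in>F. norm (c r)) \<le> (\<Sum>r\<in>F. \<gamma> (nat \<bar>0 - r\<bar>))"
      using acov_bound[OF q_T] by (intro sum_mono) (simp add: c_def)
    also have "\<dots> \<le> 2 * \<Gamma>" by (rule sum_gamma_int_le[OF F])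
    finally show "(\<Sum>r\<in>F. norm (c r)) \<le> 2 * \<Gamma>" .
  qed
qed simp

text \<open>The weight of \<open>c r\<close> in the mean of \<open>Qa\<close>: the HAC weight times
  the share of the \<open>n\<close> indices that have a partner at lag \<open>r\<close>.\<close>

definition v :: "nat \<Rightarrow> int \<Rightarrow> real" where
  "v n r = (if r \<in> {- (int n - 1)..int n - 1} then w n r * (real (card {1..int n - \<bar>r\<bar>}) / real n) else 0)"

lemma v_bound: "\<bar>v n r\<bar> \<le> 1"
proof (cases "1 \<le> n")
  case True
  have "real (card {1..int n - \<bar>r\<bar>}) \<le> real n" by simp
  then have "\<bar>real (card {1..int n - \<bar>r\<bar>}) / real n\<bar> \<le> 1" using True by simp
  then have "\<bar>w n r * (real (card {1..int n - \<bar>r\<bar>}) / real n)\<bar> \<le> 1"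
    using w_bounds[OF True, of r] by (intro abs_mult_le_one) auto
  then show ?thesis by (simp only: v_def split: if_split) simp
next
  case False
  then show ?thesis by (simp add: v_def)
qed

lemma v_tendsto: "(\<lambda>n. v n r) \<longlonglongrightarrow> 1"
proof -
  have "(\<lambda>n. W (real_of_int \<bar>r\<bar> / b n)) \<longlonglongrightarrow> W 0"
  proof (rule continuous_within_tendsto_compose[where S = "{0..}" and f = W and x = "\<lambda>n. real_of_int \<bar>r\<bar> / b n" and a = 0])
    show "continuous (at 0 within {0..}) W" using hac by (simp add: hac_kernel_def)
    show "\<forall>\<^sub>F n in sequentially. real_of_int \<bar>r\<bar> / b n \<in> {0..}"
      using eventually_ge1
    proof eventually_elim
      case (elim n)
      then show ?case using b_pos[OF elim] by simp
    qed
    show "(\<lambda>n. real_of_int \<bar>r\<bar> / b n) \<longlonglongrightarrow> 0"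
      by (rule tendsto_divide_0[OF tendsto_const filterlim_at_top_imp_at_infinity[OF b_top]])
  qed
  moreover have "(\<lambda>n. 1 - real_of_int \<bar>r\<bar> / real n) \<longlonglongrightarrow> 1" by real_asymp
  ultimately have "(\<lambda>n. W (real_of_int \<bar>r\<bar> / b n) * (1 - real_of_int \<bar>r\<bar> / real n)) \<longlonglongrightarrow> W 0 * 1"
    by (rule tendsto_mult)
  moreover have "\<forall>\<^sub>F n in sequentially. W (real_of_int \<bar>r\<bar> / b n) * (1 - real_of_int \<bar>r\<bar> / real n) = v n r"
    using eventually_ge_at_top[of "nat \<bar>r\<bar> + 1"]
  proof eventually_elim
    case (elim n)
    then have "r \<in> {- (int n - 1)..int n - 1}" by auto
    moreover have "real (card {1..int n - \<bar>r\<bar>}) = real n - real_of_int \<bar>r\<bar>" using elim by (simp add: of_nat_nat)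
    ultimately show ?case using elim by (simp add: v_def w_def diff_divide_distrib)
  qed
  ultimately show ?thesis using W_bounds(3) by (auto intro: Lim_transform_eventually)
qed

definition Qa_mean :: "nat \<Rightarrow> real" where
  "Qa_mean n = (\<Sum>r\<in>{- (int n - 1)..int n - 1}. v n r * c r)"

lemma Qa_mean_tendsto: "Qa_mean \<longlonglongrightarrow> infsum c UNIV"
  unfolding Qa_mean_def
  by (rule weighted_infsum_limit[OF c_abs_summable _ _ v_bound v_tendsto]) (auto simp: v_def)

definition lag :: "nat \<Rightarrow> int \<Rightarrow> 'a \<Rightarrow> real" where
  "lag n r \<omega> = (\<Sum>i\<in>{1..int n - \<bar>r\<bar>}. a q i \<omega> * a q (i + \<bar>r\<bar>) \<omega> - c r) / real n"

lemma lag_meas [measurable]: "lag n r \<in> borel_measurable M"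
  unfolding lag_def by measurable

lemma Lambda_nonneg: "0 \<le> \<Lambda>"
proof -
  have "0 \<le> \<Gamma>1" using gamma_le(2)[of 0] by simp
  then show ?thesis using Gamma_ge by (simp add: \<Lambda>_def)
qed

lemma lag_L1:
  assumes n: "1 \<le> n"
  shows "integrable M (lag n r)" "expectation (\<lambda>\<omega>. \<bar>lag n r \<omega>\<bar>) \<le> (1 + \<Lambda>) / sqrt (real n)"
proof -
  define k where "k = nat \<bar>r\<bar>"
  have k: "\<bar>r\<bar> = int k" "c r = acov q k" by (simp_all add: k_def c_def)
  let ?A = "{1..int n - int k}"
  let ?Y = "\<lambda>\<omega>. \<Sum>i\<in>?A. a q i \<omega> * a q (i + int k) \<omega> - acov q k"
  have lagY: "lag n r = (\<lambda>\<omega>. ?Y \<omega> / real n)" by (simp add: lag_def[abs_def] k)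
  have Yb: "\<bar>?Y \<omega>\<bar> \<le> real (card ?A) * (1 + \<bar>acov q k\<bar>)" for \<omega>
  proof -
    have "\<bar>a q i \<omega> * a q (i + int k) \<omega> - acov q k\<bar> \<le> 1 + \<bar>acov q k\<bar>" for i
      using abs_mult_le_one[OF a_bound[of q i \<omega>] a_bound[of q "i + int k" \<omega>]] by linarith
    then have "\<bar>?Y \<omega>\<bar> \<le> (\<Sum>i\<in>?A. 1 + \<bar>acov q k\<bar>)" by (intro order_trans[OF sum_abs sum_mono])
    then show ?thesis by simp
  qed
  have iY: "integrable M (\<lambda>\<omega>. (?Y \<omega>)\<^sup>2)"
    by (rule integrable_bounded[where B = "(real (card ?A) * (1 + \<bar>acov q k\<bar>))\<^sup>2"])
       (use Yb in \<open>auto intro!: power2_le_iff_abs_le[THEN iffD2]\<close>)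
  then have i: "integrable M (\<lambda>\<omega>. (lag n r \<omega>)\<^sup>2)" by (simp add: lagY power_divide)
  have "expectation (\<lambda>\<omega>. (lag n r \<omega>)\<^sup>2) = expectation (\<lambda>\<omega>. (?Y \<omega>)\<^sup>2) / (real n)\<^sup>2" by (simp add: lagY power_divide)
  also have "\<dots> \<le> real (card ?A) * \<Lambda> / (real n)\<^sup>2"
    by (intro divide_right_mono acov_sum_variance[OF q_T]) auto
  also have "\<dots> \<le> real n * \<Lambda> / (real n)\<^sup>2"
    by (intro divide_right_mono mult_right_mono Lambda_nonneg) auto
  also have "\<dots> = \<Lambda> / real n" using n by (simp add: power2_eq_square)
  finally have le: "expectation (\<lambda>\<omega>. (lag n r \<omega>)\<^sup>2) \<le> \<Lambda> / real n" .
  from L1_le_L2[OF lag_meas i le n]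
  show "integrable M (lag n r)" "expectation (\<lambda>\<omega>. \<bar>lag n r \<omega>\<bar>) \<le> (1 + \<Lambda>) / sqrt (real n)" by auto
qed

lemma Qa_minus_mean: "Qa n \<omega> - Qa_mean n = (\<Sum>r\<in>{- (int n - 1)..int n - 1}. w n r * lag n r \<omega>)"
proof -
  have "Qa n \<omega> = (\<Sum>r\<in>{- (int n - 1)..int n - 1}. w n \<bar>r\<bar> * (1 / real n * (\<Sum>i\<in>{1..int n - \<bar>r\<bar>}. a q i \<omega> * a q (i + \<bar>r\<bar>) \<omega>)))"
    unfolding Qa_def by (rule lag_sum_eq[symmetric])
  then have "Qa n \<omega> - Qa_mean n = (\<Sum>r\<in>{- (int n - 1)..int n - 1}. w n \<bar>r\<bar> * (1 / real n * (\<Sum>i\<in>{1..int n - \<bar>r\<bar>}. a q i \<omega> * a q (i + \<bar>r\<bar>) \<omega>)) - v n r * c r)"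
    by (simp add: Qa_mean_def sum_subtractf)
  also have "\<dots> = (\<Sum>r\<in>{- (int n - 1)..int n - 1}. w n r * lag n r \<omega>)"
  proof (rule sum.cong)
    fix r assume r: "r \<in> {- (int n - 1)..int n - 1}"
    have "lag n r \<omega> = (\<Sum>i\<in>{1..int n - \<bar>r\<bar>}. a q i \<omega> * a q (i + \<bar>r\<bar>) \<omega>) / real n - real (card {1..int n - \<bar>r\<bar>}) * c r / real n"
      by (simp add: lag_def sum_subtractf diff_divide_distrib)
    then show "w n \<bar>r\<bar> * (1 / real n * (\<Sum>i\<in>{1..int n - \<bar>r\<bar>}. a q i \<omega> * a q (i + \<bar>r\<bar>) \<omega>)) - v n r * c r = w n r * lag n r \<omega>"
      using r by (simp add: v_def right_diff_distrib)
  qed simp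
  finally show ?thesis .
qed

text \<open>The triangle inequality over lags is affordable: each lag average is off by at most
  \<open>(1 + \<Lambda>) / sqrt n\<close> in mean, and the weights add up to at most
  \<open>B n\<close>, which is of smaller order than \<open>sqrt n\<close>.\<close>

lemma Qa_tendsto: "tendsto_in_prob M Qa (infsum c UNIV)"
proof (rule tendsto_in_prob_L1)
  show "(\<lambda>n. (1 + \<Lambda>) * (B n / sqrt (real n)) + \<bar>Qa_mean n - infsum c UNIV\<bar>) \<longlonglongrightarrow> 0"
  proof (rule tendsto_add_zero)
    show "(\<lambda>n. (1 + \<Lambda>) * (B n / sqrt (real n))) \<longlonglongrightarrow> 0"
      using tendsto_mult[OF tendsto_const B_sqrt, of "1 + \<Lambda>"] by simp
    show "(\<lambda>n. \<bar>Qa_mean n - infsum c UNIV\<bar>) \<longlonglongrightarrow> 0"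
      using Qa_mean_tendsto by (intro tendsto_rabs_zero LIM_zero)
  qed
  show "\<forall>\<^sub>F n in sequentially. integrable M (Qa n) \<and> expectation (\<lambda>\<omega>. \<bar>Qa n \<omega> - infsum c UNIV\<bar>) \<le> (1 + \<Lambda>) * (B n / sqrt (real n)) + \<bar>Qa_mean n - infsum c UNIV\<bar>"
    using eventually_ge1
  proof eventually_elim
    case (elim n)
    let ?S = "{- (int n - 1)..int n - 1}"
    have Q: "Qa n = (\<lambda>\<omega>. (\<Sum>r\<in>?S. w n r * lag n r \<omega>) + Qa_mean n)" using Qa_minus_mean by (auto simp: algebra_simps)
    have iS: "integrable M (\<lambda>\<omega>. \<Sum>r\<in>?S. w n r * \<bar>lag n r \<omega>\<bar>)" and iS': "integrable M (\<lambda>\<omega>. \<Sum>r\<in>?S. w n r * lag n r \<omega>)"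
      using lag_L1(1)[OF elim] by (intro Bochner_Integration.integrable_sum integrable_mult_right integrable_abs; simp)+
    have iQ: "integrable M (Qa n)" unfolding Q using iS' by simp
    have "expectation (\<lambda>\<omega>. \<bar>Qa n \<omega> - infsum c UNIV\<bar>) \<le> expectation (\<lambda>\<omega>. (\<Sum>r\<in>?S. w n r * \<bar>lag n r \<omega>\<bar>) + \<bar>Qa_mean n - infsum c UNIV\<bar>)"
    proof (rule integral_mono)
      show "integrable M (\<lambda>\<omega>. \<bar>Qa n \<omega> - infsum c UNIV\<bar>)" using iQ by simp
      show "integrable M (\<lambda>\<omega>. (\<Sum>r\<in>?S. w n r * \<bar>lag n r \<omega>\<bar>) + \<bar>Qa_mean n - infsum c UNIV\<bar>)" using iS by simp
      fix \<omega>
      have "\<bar>\<Sum>r\<in>?S. w n r * lag n r \<omega>\<bar> \<le> (\<Sum>r\<in>?S. \<bar>w n r * lag n r \<omega>\<bar>)" by (rule sum_abs)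
      also have "\<dots> = (\<Sum>r\<in>?S. w n r * \<bar>lag n r \<omega>\<bar>)" using w_bounds(1)[OF elim] by (simp add: abs_mult)
      finally show "\<bar>Qa n \<omega> - infsum c UNIV\<bar> \<le> (\<Sum>r\<in>?S. w n r * \<bar>lag n r \<omega>\<bar>) + \<bar>Qa_mean n - infsum c UNIV\<bar>"
        using Qa_minus_mean[of n \<omega>] by linarith
    qed
    also have "\<dots> = expectation (\<lambda>\<omega>. \<Sum>r\<in>?S. w n r * \<bar>lag n r \<omega>\<bar>) + \<bar>Qa_mean n - infsum c UNIV\<bar>"
      using iS by (subst Bochner_Integration.integral_add) (auto simp: prob_space)
    also have "expectation (\<lambda>\<omega>. \<Sum>r\<in>?S. w n r * \<bar>lag n r \<omega>\<bar>) = (\<Sum>r\<in>?S. w n r * expectation (\<lambda>\<omega>. \<bar>lag n r \<omega>\<bar>))"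
      using lag_L1(1)[OF elim] by (subst Bochner_Integration.integral_sum) auto
    also have "\<dots> \<le> (\<Sum>r\<in>?S. w n r * ((1 + \<Lambda>) / sqrt (real n)))"
      by (intro sum_mono mult_left_mono lag_L1 w_bounds elim)
    also have "\<dots> = (\<Sum>r\<in>?S. w n r) * ((1 + \<Lambda>) / sqrt (real n))" by (rule sum_distrib_right[symmetric])
    also have "\<dots> \<le> B n * ((1 + \<Lambda>) / sqrt (real n))"
    proof (rule mult_right_mono)
      have "(\<Sum>r\<in>?S. w n (0 - r)) \<le> B n" by (rule w_row_sum[OF elim]) auto
      then show "(\<Sum>r\<in>?S. w n r) \<le> B n" by (simp add: w_def)
    qed (use Lambda_nonneg in simp)
    finally show ?case using iQ by (simp add: mult.commute)
  qed
qed measurable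

theorem S2_consistent: "tendsto_in_prob M S2 (infsum c UNIV)"
  using tendsto_in_prob_add[OF S2_minus_Qa Qa_tendsto] by simp

theorem sigma2_hat_consistent:
  assumes K: "density_kernel K" and d: "scale d"
  shows "tendsto_in_prob M (sigma2_hat X g K d W b p) (4 / u\<^sup>2 * infsum c UNIV)"
proof -
  note uh = u_hat_consistent[OF K d]
  have eq: "sigma2_hat X g K d W b p n = (\<lambda>\<omega>. 4 / (u_hat X g K d n \<omega> (tn n \<omega>))\<^sup>2 * S2 n \<omega>)" for n
    by (simp add: sigma2_hat_def S2_def fun_eq_iff)
  have [measurable]: "(\<lambda>\<omega>. u_hat X g K d n \<omega> (tn n \<omega>)) \<in> borel_measurable M" for n
    using tendsto_in_prob_meas[OF uh] .
  have "tendsto_in_prob M (\<lambda>n \<omega>. (\<lambda>z. 4 / (fst z)\<^sup>2 * snd z) (u_hat X g K d n \<omega> (tn n \<omega>), S2 n \<omega>)) ((\<lambda>z. 4 / (fst z)\<^sup>2 * snd z) (u, infsum c UNIV))"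
  proof (rule tendsto_in_prob_cont2[OF uh S2_consistent])
    show "isCont (\<lambda>z. 4 / (fst z)\<^sup>2 * snd z) (u, infsum c UNIV)"
      using u_pos by (intro continuous_intros) auto
  qed simp
  then show ?thesis by (simp add: eq[abs_def])
qed

end

section \<open>From the stated hypotheses to their quantitative form\<close>

lemma unstable_measure_le:
  fixes P :: "(real \<times> real) measure"
  assumes g: "(\<lambda>(x, y). g x y) \<in> borel_measurable borel" and P: "finite_measure P" "sets P = sets borel"
    and le: "(\<integral>\<^sup>+ z. (SUP w\<in>{w. norm (w - z) \<le> \<epsilon>}. ennreal (\<bar>h_ker g (fst w) (snd w) t - h_ker g (fst z) (snd z) t\<bar>\<^sup>2)) \<partial>completion P) \<le> ennreal (L * \<epsilon>)"
    and L: "0 \<le> L * \<epsilon>"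
  shows "measure P (unstable g t \<epsilon>) \<le> L * \<epsilon>"
proof -
  interpret finite_measure P by fact
  let ?U = "unstable g t \<epsilon>"
  have U: "?U \<in> sets P" using unstable_borel[OF g] P by simp
  have "emeasure P ?U = (\<integral>\<^sup>+ z. indicator ?U z \<partial>P)" using U by simp
  also have "\<dots> \<le> (\<integral>\<^sup>+ z. (SUP w\<in>{w. norm (w - z) \<le> \<epsilon>}. ennreal (\<bar>h_ker g (fst w) (snd w) t - h_ker g (fst z) (snd z) t\<bar>\<^sup>2)) \<partial>P)"
  proof (rule nn_integral_mono)
    fix z
    show "indicator ?U z \<le> (SUP w\<in>{w. norm (w - z) \<le> \<epsilon>}. ennreal (\<bar>h_ker g (fst w) (snd w) t - h_ker g (fst z) (snd z) t\<bar>\<^sup>2))"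
    proof (cases "z \<in> ?U")
      case True
      then obtain w where w: "dist w z < \<epsilon>" "h_ker g (fst w) (snd w) t \<noteq> h_ker g (fst z) (snd z) t"
        by (auto simp: unstable_def)
      \<comment> \<open>The kernel takes only the values 0 and 1, so on the unstable set the
        supremum is at least 1.\<close>
      have "\<bar>h_ker g (fst w) (snd w) t - h_ker g (fst z) (snd z) t\<bar>\<^sup>2 = 1"
        using w(2) by (auto simp: h_ker_if split: if_splits)
      then have "indicator ?U z = ennreal (\<bar>h_ker g (fst w) (snd w) t - h_ker g (fst z) (snd z) t\<bar>\<^sup>2)" using True by simp
      also have "\<dots> \<le> (SUP w\<in>{w. norm (w - z) \<le> \<epsilon>}. ennreal (\<bar>h_ker g (fst w) (snd w) t - h_ker g (fst z) (snd z) t\<bar>\<^sup>2))"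
        using w(1) by (intro SUP_upper) (simp add: dist_norm less_imp_le)
      finally show ?thesis .
    qed simp
  qed
  \<comment> \<open>\<open>nn_integral\<close> is a supremum over simple functions from below and
    agrees for a measure and its completion, also for this supremum, which need not be Borel
    measurable.\<close>
  also have "\<dots> \<le> ennreal (L * \<epsilon>)" using le by (simp only: nn_integral_completion)
  finally show ?thesis using L by (simp add: emeasure_eq_measure)
qed

lemma near_epoch_rate:
  fixes s :: "nat \<Rightarrow> real" and \<pi> :: "nat \<Rightarrow> real"
  assumes O: "s \<in> O(\<lambda>l. 1 / real l ^ 6)" and \<pi>: "\<And>l. 1 \<le> l \<Longrightarrow> \<pi> l \<le> s l" "\<And>l. \<pi> l \<le> 1"
  obtains C where "0 \<le> C" "\<And>l. 1 \<le> l \<Longrightarrow> \<pi> l \<le> C / real l ^ 6"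
proof -
  obtain c where c: "0 < c" "\<forall>\<^sub>F l in sequentially. norm (s l) \<le> c * norm (1 / real l ^ 6)"
    using O by (elim landau_o.bigE)
  then obtain N where N: "\<And>l. N \<le> l \<Longrightarrow> norm (s l) \<le> c * norm (1 / real l ^ 6)"
    by (auto simp: eventually_sequentially)
  show thesis
  \<comment> \<open>For \<open>l\<close> below \<open>N\<close> the bound is the trivial 1, which
    \<open>N ^ 6 / l ^ 6\<close> dominates.\<close>
  proof (rule that[of "c + real N ^ 6"])
    show "0 \<le> c + real N ^ 6" using c by simp
    fix l :: nat assume l: "1 \<le> l"
    have lp: "0 < real l ^ 6" using l by simp
    show "\<pi> l \<le> (c + real N ^ 6) / real l ^ 6"
    proof (cases "N \<le> l")
      case True
      have "\<pi> l \<le> c / real l ^ 6" using \<pi>(1)[OF l] N[OF True] by simp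
      also have "\<dots> \<le> (c + real N ^ 6) / real l ^ 6" by (intro divide_right_mono) auto
      finally show ?thesis .
    next
      case False
      then have "real l ^ 6 \<le> real N ^ 6" by (intro power_mono) auto
      then have "real l ^ 6 \<le> c + real N ^ 6" using c by linarith
      then have "1 \<le> (c + real N ^ 6) / real l ^ 6" using lp by simp
      then show ?thesis using \<pi>(2)[of l] by linarith
    qed
  qed
qed

text \<open>The expansion is centred at the value \<open>p\<close>, not at \<open>U q\<close>: it
  forces the limit of \<open>U\<close> at \<open>q\<close> to be \<open>p\<close>, and continuity
  identifies that limit with \<open>U q\<close>. The infimum in \<open>gen_inv\<close> by itself
  would leave \<open>U q = p\<close> open.\<close>

lemma smooth_quantile_value:
  fixes U :: "real \<Rightarrow> real"
  assumes "U differentiable (at q)"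
    and o: "(\<lambda>t. \<bar>U t - p - u * (t - q)\<bar>) \<in> o[at q](\<lambda>t. \<bar>t - q\<bar> powr (3 / 2))"
  shows "U q = p"
proof -
  have "isCont U q" using assms(1) by (rule differentiable_imp_continuous_within)
  then have "((\<lambda>t. U t - p - u * (t - q)) \<longlongrightarrow> U q - p - u * (q - q)) (at q)"
    unfolding isCont_def by (intro tendsto_intros)
  then have 1: "((\<lambda>t. \<bar>U t - p - u * (t - q)\<bar>) \<longlongrightarrow> \<bar>U q - p\<bar>) (at q)" using tendsto_rabs by fastforce
  have "((\<lambda>t. \<bar>t - q\<bar> powr (3 / 2)) \<longlongrightarrow> \<bar>q - q\<bar> powr (3 / 2)) (at q)"
    by (intro tendsto_powr2 tendsto_intros) auto
  then have z: "((\<lambda>t. \<bar>t - q\<bar> powr (3 / 2)) \<longlongrightarrow> 0) (at q)" by simp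
  have "\<forall>\<^sub>F t in at q. norm \<bar>U t - p - u * (t - q)\<bar> \<le> 1 * norm (\<bar>t - q\<bar> powr (3 / 2))"
    using landau_o.smallD[OF o, of 1] by simp
  then have "((\<lambda>t. \<bar>U t - p - u * (t - q)\<bar>) \<longlongrightarrow> 0) (at q)"
    by (intro tendsto_sandwich[OF _ _ tendsto_const z]) (auto elim: eventually_mono)
  from tendsto_unique[OF _ 1 this] show ?thesis by simp
qed

text \<open>Once \<open>d n < 1\<close>, \<open>d n powr (8 / 3) \<le> (d n)\<^sup>2\<close>, so the
  square root of the quantity assumed to diverge lies below \<open>sqrt n * d n\<close>.\<close>

lemma bandwidth_sqrt:
  fixes d :: "nat \<Rightarrow> real"
  assumes pos: "\<And>n. 1 \<le> n \<Longrightarrow> 0 < d n" and lim: "d \<longlonglongrightarrow> 0"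
    and top: "filterlim (\<lambda>n. real n * d n powr (8 / 3)) at_top sequentially"
  shows "filterlim (\<lambda>n. sqrt (real n) * d n) at_top sequentially"
proof -
  have "filterlim (\<lambda>n. sqrt (real n * d n powr (8 / 3))) at_top sequentially"
    by (rule filterlim_compose[OF sqrt_at_top top])
  moreover have "\<forall>\<^sub>F n in sequentially. sqrt (real n * d n powr (8 / 3)) \<le> sqrt (real n) * d n"
    using eventually_ge_at_top[of 1] order_tendstoD(2)[OF lim, of 1, simplified]
  proof eventually_elim
    case (elim n)
    have d: "0 < d n" "d n < 1" using pos elim by auto
    have "d n powr (8 / 3) \<le> d n powr 2" using d by (intro powr_mono') auto
    also have "\<dots> = (d n)\<^sup>2" using d by simp
    finally have "sqrt (real n * d n powr (8 / 3)) \<le> sqrt (real n * (d n)\<^sup>2)" by (intro real_sqrt_le_mono mult_left_mono) auto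
    also have "\<dots> = sqrt (real n) * d n" using d by (simp add: real_sqrt_mult)
    finally show ?case .
  qed
  ultimately show ?thesis by (rule filterlim_at_top_mono)
qed

theorem theorem2p4:
  fixes M :: "'a measure"
    and X Z :: "int \<Rightarrow> 'a \<Rightarrow> real"
    and g :: "real \<Rightarrow> real \<Rightarrow> real"
    and p :: real
    and a :: "nat \<Rightarrow> real" and \<phi> :: "real \<Rightarrow> real"
    and K W :: "real \<Rightarrow> real"
    and d b :: "nat \<Rightarrow> real"
  assumes "prob_space M"
    and "0 < p" and "p < 1"
    and "strictly_stationary M X"
    and "\<And>x y. g x y = g y x"
    and "(\<lambda>(x, y). g x y) \<in> borel_measurable borel"
    and short_range_dependence:
      "near_epoch_dependent_in_prob M X Z a \<phi>"
      "absolutely_regular M Z"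
      "(\<lambda>l. a l * \<phi> (1 / real l ^ 6)) \<in> O(\<lambda>l. 1 / real l ^ 6)"
      "summable (\<lambda>k. real k * beta_coeff M Z k)"
    and variation_h:
      "variation_condition_h M X g (U_inv M X g p)"
    and smoothness:
      "\<forall>\<^sub>F t in nhds (U_inv M X g p). U_fun M X g differentiable (at t)"
      "0 < deriv (U_fun M X g) (U_inv M X g p)"
      "(\<lambda>t. \<bar>U_fun M X g t - p - deriv (U_fun M X g) (U_inv M X g p) * (t - U_inv M X g p)\<bar>)
         \<in> o[at (U_inv M X g p)](\<lambda>t. \<bar>t - U_inv M X g p\<bar> powr (3 / 2))"
    and density:
      "density_kernel K"
      "\<And>n. 1 \<le> n \<Longrightarrow> 0 < d n"
      "d \<longlonglongrightarrow> 0"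
      "filterlim (\<lambda>n. real n * d n powr (8 / 3)) at_top sequentially"
    and hac:
      "hac_kernel W"
      "\<And>n. 1 \<le> n \<Longrightarrow> 0 < b n"
      "filterlim b at_top sequentially"
      "(\<lambda>n. b n / sqrt (real n)) \<longlonglongrightarrow> 0"
    and variation_g:
      "variation_condition_g M X g"
  shows "h1_autocov M X g p summable_on UNIV \<and>
         tendsto_in_prob M (sigma2_hat X g K d W b p) (sigma2 M X g p)"
proof -
  interpret prob_space M by fact
  define q where "q = U_inv M X g p"
  define u where "u = deriv (U_fun M X g) q"
  from short_range_dependence(1) obtain f :: "nat \<Rightarrow> (int \<Rightarrow> real) \<Rightarrow> real" where
    stat: "strictly_stationary M (\<lambda>i \<omega>. (X i \<omega>, Z i \<omega>))"
    and f_meas: "\<And>l. 1 \<le> l \<Longrightarrow> f l \<in> borel_measurable (PiM {- int l..int l} (\<lambda>_. borel))"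
    and f_near: "\<And>l \<epsilon>. 1 \<le> l \<Longrightarrow> 0 < \<epsilon> \<Longrightarrow>
        prob {\<omega> \<in> space M. \<epsilon> < \<bar>X 0 \<omega> - f l (\<lambda>i\<in>{- int l..int l}. Z i \<omega>)\<bar>} \<le> a l * \<phi> \<epsilon>"
    unfolding near_epoch_dependent_in_prob_def by blast
  let ?\<pi> = "\<lambda>l. prob {\<omega> \<in> space M. 1 / real l ^ 6 < \<bar>X 0 \<omega> - f l (\<lambda>i\<in>{- int l..int l}. Z i \<omega>)\<bar>}"
  obtain C where C: "0 \<le> C" "\<And>l. 1 \<le> l \<Longrightarrow> ?\<pi> l \<le> C / real l ^ 6"
  proof (rule near_epoch_rate[OF short_range_dependence(3), of ?\<pi>])
    show "?\<pi> l \<le> a l * \<phi> (1 / real l ^ 6)" if "1 \<le> l" for l using that by (intro f_near) auto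
  qed auto
  obtain L0 where L0: "\<forall>\<^sub>F t in nhds q. \<forall>\<epsilon>>0. (\<integral>\<^sup>+ z. (SUP w\<in>{w. norm (w - z) \<le> \<epsilon>}.
       ennreal (\<bar>h_ker g (fst w) (snd w) t - h_ker g (fst z) (snd z) t\<bar>\<^sup>2)) \<partial>completion (pair_law M X)) \<le> ennreal (L0 * \<epsilon>)"
    using variation_h unfolding variation_condition_h_def q_def by blast
  \<comment> \<open>The sign of \<open>L0\<close> is not known, while the locale asks for a
    nonnegative constant.\<close>
  define L where "L = max L0 0"
  have X0: "X 0 \<in> borel_measurable M" using assms(4) by (simp add: strictly_stationary_def)
  interpret PX: prob_space "distr M borel (X 0)" by (rule prob_space_distr[OF X0])
  interpret PP: pair_prob_space "distr M borel (X 0)" "distr M borel (X 0)" ..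
  have sets_PL: "sets (pair_law M X) = sets borel"
    unfolding pair_law_def by (simp add: borel_prod[symmetric] cong: sets_pair_measure_cong)
  have fin_PL: "finite_measure (pair_law M X)" unfolding pair_law_def by (rule PP.finite_measure_axioms)
  define T where "T = {t. \<forall>\<epsilon>>0. measure (pair_law M X) (unstable g t \<epsilon>) \<le> L * \<epsilon>}"
  have T: "\<forall>\<^sub>F t in nhds q. t \<in> T"
    using L0
  proof eventually_elim
    case (elim t)
    show ?case unfolding T_def
    proof (intro CollectI allI impI)
      fix \<epsilon> :: real assume \<epsilon>: "0 < \<epsilon>"
      have "ennreal (L0 * \<epsilon>) \<le> ennreal (L * \<epsilon>)" using \<epsilon> by (intro ennreal_leI mult_right_mono) (auto simp: L_def)
      with elim \<epsilon> show "measure (pair_law M X) (unstable g t \<epsilon>) \<le> L * \<epsilon>"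
        by (intro unstable_measure_le[OF assms(6) fin_PL sets_PL]) (auto simp: L_def intro: order_trans)
    qed
  qed
  have diff: "U_fun M X g differentiable (at q)"
    using eventually_nhds_x_imp_x[OF smoothness(1)] by (simp add: q_def)
  interpret H: hac_setting M X Z f g T C L p q u W b
  proof unfold_locales
    show "measure (pair_law M X) (unstable g t \<epsilon>) \<le> L * \<epsilon>" if "t \<in> T" "0 < \<epsilon>" for t \<epsilon>
      using that by (simp add: T_def)
    show "U_fun M X g q = p"
      by (rule smooth_quantile_value[OF diff]) (use smoothness(3) in \<open>simp add: q_def\<close>)
    show "(U_fun M X g has_real_derivative u) (at q)"
      using diff by (simp add: u_def DERIV_deriv_iff_real_differentiable)
    show "0 < u" using smoothness(2) by (simp add: u_def q_def)
  qed (use stat f_meas C assms T in \<open>auto simp: L_def\<close>)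
  \<comment> \<open>Both means vanish, and a negative lag becomes a positive one after a shift by
    stationarity.\<close>
  have cov: "h1_autocov M X g p r = H.c r" for r
  proof -
    have "h1_autocov M X g p r = expectation (\<lambda>\<omega>. H.a q 0 \<omega> * H.a q r \<omega>)"
      using H.a_mean[of q] by (simp add: h1_autocov_def covariance_def H.a_def[abs_def] q_def)
    also have "\<dots> = H.c r"
    proof (cases "0 \<le> r")
      case True
      then show ?thesis using H.acov_eq[of q 0 "nat r"] by (simp add: H.c_def)
    next
      case False
      then show ?thesis using H.acov_eq[of q r "nat (- r)"] by (simp add: H.c_def mult.commute)
    qed
    finally show ?thesis .
  qed
  then have cov': "h1_autocov M X g p = H.c" by (rule ext)
  have "\<forall>\<^sub>F n in sequentially. 0 < d n"
    using eventually_ge_at_top[of 1] by eventually_elim (rule density(2))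
  then have "H.scale d"
    unfolding H.scale_def using density(3) bandwidth_sqrt[OF density(2-4)] by simp
  from H.sigma2_hat_consistent[OF density(1) this]
  have "tendsto_in_prob M (sigma2_hat X g K d W b p) (sigma2 M X g p)"
    by (simp add: sigma2_def cov' u_def q_def)
  \<comment> \<open>\<open>infsum\<close> returns 0 for families that are not summable, so
    summability is what gives \<open>sigma2\<close> its meaning.\<close>
  moreover have "h1_autocov M X g p summable_on UNIV"
    unfolding cov' by (rule abs_summable_summable[OF H.c_abs_summable])
  ultimately show ?thesis by simp
qed

end
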